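(* Let $(\Omega_1,\mu_1)$ and $(\Omega_2,\mu_2)$ be two localizable measure spaces, let $\phi\in L^{\infty}(\Omega_1\times\Omega_2)$, and let $1\leq q\leq p\leq\infty$. Then $\phi$ is a Schur multiplier on $\mathcal{B}(L^p(\Omega_1),L^q(\Omega_2))$ if and only if the operator $u_\phi : L^1(\Omega_1)\to L^\infty(\Omega_2)$, $u_\phi(f)=\int_{\Omega_1}\phi(s,\cdot)f(s)\,d\mu_1(s)$, belongs to $\mathcal{L}_{q,p'}(L^1(\Omega_1),L^{\infty}(\Omega_2))$. Moreover, $\|T_\phi\|=L_{q,p'}(u_\phi)$.
   Context: For $r\in[1,\infty]$, $r'$ is the conjugate exponent. $\mathcal{B}(X,Y)$ denotes the bounded operators. Schur multipliers. For $\phi\in L^\infty(\Omega_1\times\Omega_2)$ let $T_\phi: L^{p'}(\Omega_1)\otimes L^q(\Omega_2)\to\mathcal{B}(L^p(\Omega_1),L^q(\Omega_2))$ be the linear map defined on elementary tensors by $[T_\phi(f\otimes g)](h)=\left(\int_{\Omega_1}\phi(s,\cdot)f(s)h(s)\,d\mu_1(s)\right)g(\cdot)$ for $h\in L^p(\Omega_1)$. The injective norm $\|u\|_\vee$ of $u=\sum_i f_i\otimes g_i\in L^{p'}(\Omega_1)\otimes L^q(\Omega_2)$ equals the operator norm of $L^p(\Omega_1)\to L^q(\Omega_2)$, $h\mapsto\sum_i\left(\int f_i h\,d\mu_1\right)g_i$. We say that $\phi$ is a Schur multiplier on $\mathcal{B}(L^p(\Omega_1),L^q(\Omega_2))$ if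 there is a constant $C\ge 0$ with $\|T_\phi(u)\|_{\mathcal{B}(L^p(\Omega_1),L^q(\Omega_2))}\le C\|u\|_\vee$ for all $u\in L^{p'}(\Omega_1)\otimes L^q(\Omega_2)$; the norm $\|T_\phi\|$ is the smallest such $C$. The norms $\alpha_{a,b}$. Let $a,b\in[1,\infty]$ with $\frac1a+\frac1b\ge 1$ and let $r\in[1,\infty]$ satisfy $\frac1r=\frac1a+\frac1b-1$. For vectors $x_1,\dots,x_n$ in a Banach space $X$ and $s\in[1,\infty]$ put $w_s(x_i,X)=\sup_{x^*\in X^*,\|x^*\|\le1}\left(\sum_i|\langle x^*,x_i\rangle|^s\right)^{1/s}$ (a maximum over $i$ if $s=\infty$). For $z\in X\otimes Y$, $\alpha_{a,b}(z)=\inf\{\|(\lambda_i)_i\|_{\ell_r}\,w_{b'}(x_i,X)\,w_{a'}(y_i,Y) : z=\sum_{i=1}^n\lambda_i x_i\otimes y_i\}$. Dual norm. For finite dimensional $M,N$ and $z\in M\otimes N$, $\alpha_{a,b}'(z,M,N)=\sup\{|\langle v,z\rangle| : v\in M^*\otimes N^*,\ \alpha_{a,b}(v)\le1\}$, with the canonical pairing of $M^*\otimes N^*$ and $M\otimes N$. For Banach spaces $X,Y$ and $z\in X\otimes Y$, $\alpha'_{a,b}(z)=\inf\{\alpha'_{a,b}(z,M,N): M\subset X,\ N\subset Y \text{ finite dimensional subspaces},\ z\in M\otimes N\}$. The space $\mathcal{L}_{a,b}(X,Y^* )$. An operator $T\in\mathcal{B}(X,Y^* )$ belongs to $\mathcal{L}_{a,b}(X,Y^*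 )$ if there is $C\ge0$ such that $\left|\sum_i\langle T(x_i),y_i\rangle\right|\le C\,\alpha'_{a,b}(\xi)$ for all $\xi=\sum_i x_i\otimes y_i\in X\otimes Y$; $L_{a,b}(T)$ is the infimum of such $C$. Here this is used with $(a,b)=(q,p')$, $X=L^1(\Omega_1)$, $Y=L^1(\Omega_2)$, $Y^*=L^\infty(\Omega_2)$ (note that $q\le p$ gives $\frac1q+\frac1{p'}\ge1$). *)

theory Defs
  imports "HOL-Probability.Essential_Supremum" "HOL-Library.Function_Algebras"
begin

section \<open>Normed spaces of functions\<close>

text \<open>
  A normed space is given by a linear space \<open>vecs\<close> of complex functions and a seminorm \<open>nrm\<close> on it,
  and stands for the quotient of \<open>vecs\<close> by the kernel of \<open>nrm\<close> (almost everywhere equal functions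
  are identified in \<open>L\<^sup>p\<close>). Functionals are functions too, so that duals are of the same kind.
  Every notion below only depends on the classes of the vectors modulo the kernel of \<open>nrm\<close>.
  The real-valued suprema and infima below are only used where they are taken over nonempty sets
  that are bounded above and below, respectively.
\<close>

definition cscale :: "complex \<Rightarrow> ('i \<Rightarrow> complex) \<Rightarrow> 'i \<Rightarrow> complex" where
  "cscale c f = (\<lambda>i. c * f i)"

global_interpretation cfun: vector_space "cscale :: complex \<Rightarrow> ('i \<Rightarrow> complex) \<Rightarrow> 'i \<Rightarrow> complex"
  by unfold_locales (auto simp: cscale_def fun_eq_iff algebra_simps)

record 'i nspace =
  vecs :: "('i \<Rightarrow> complex) set"
  nrm :: "('i \<Rightarrow> complex) \<Rightarrow> real"

definition fd_subspace :: "'i nspace \<Rightarrow> 'i nspace \<Rightarrow> bool" where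
  "fd_subspace X M \<longleftrightarrow>
     (\<exists>B. finite B \<and> cfun.span B \<subseteq> vecs X \<and> M = X\<lparr>vecs := cfun.span B\<rparr>)"

definition linear_functional :: "'i nspace \<Rightarrow> (('i \<Rightarrow> complex) \<Rightarrow> complex) \<Rightarrow> bool" where
  "linear_functional X f \<longleftrightarrow>
     (\<forall>x\<in>vecs X. \<forall>y\<in>vecs X. f (x + y) = f x + f y) \<and>
     (\<forall>c. \<forall>x\<in>vecs X. f (cscale c x) = c * f x)"

text \<open>The values of a functional outside of \<open>vecs X\<close> are irrelevant: two functionals that agree on
  \<open>vecs X\<close> are identified by the seminorm of the dual.\<close>

definition dual :: "'i nspace \<Rightarrow> ('i \<Rightarrow> complex) nspace" where
  "dual X =
     \<lparr>vecs = {f. linear_functional X f \<and> (\<exists>C. \<forall>x\<in>vecs X. cmod (f x) \<le> C * nrm X x)},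
      nrm = (\<lambda>f. SUP x\<in>{x \<in> vecs X. nrm X x \<le> 1}. cmod (f x))\<rparr>"

definition bounded_op :: "'i nspace \<Rightarrow> 'j nspace \<Rightarrow> (('i \<Rightarrow> complex) \<Rightarrow> 'j \<Rightarrow> complex) \<Rightarrow> bool" where
  "bounded_op X Z T \<longleftrightarrow>
     (\<forall>x\<in>vecs X. T x \<in> vecs Z) \<and>
     (\<forall>x\<in>vecs X. \<forall>y\<in>vecs X. nrm Z (T (x + y) - (T x + T y)) = 0) \<and>
     (\<forall>c. \<forall>x\<in>vecs X. nrm Z (T (cscale c x) - cscale c (T x)) = 0) \<and>
     (\<exists>C. \<forall>x\<in>vecs X. nrm Z (T x) \<le> C * nrm X x)"

definition opnorm :: "'i nspace \<Rightarrow> 'j nspace \<Rightarrow> (('i \<Rightarrow> complex) \<Rightarrow> 'j \<Rightarrow> complex) \<Rightarrow> real" where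
  "opnorm X Z T = (SUP x\<in>{x \<in> vecs X. nrm X x \<le> 1}. nrm Z (T x))"

section \<open>Tensor products\<close>

text \<open>
  A list \<open>[(x\<^sub>1, y\<^sub>1), \<dots>, (x\<^sub>n, y\<^sub>n)]\<close> represents the tensor \<open>x\<^sub>1 \<otimes> y\<^sub>1 + \<dots> + x\<^sub>n \<otimes> y\<^sub>n\<close>. Two lists represent
  the same element of the algebraic tensor product iff all bilinear forms (not only the bounded ones)
  take the same value on them. A bilinear form on the spaces modulo the kernels of the seminorms is
  one that vanishes as soon as one of its arguments is in the kernel.
\<close>

type_synonym ('i, 'j) tensor = "(('i \<Rightarrow> complex) \<times> ('j \<Rightarrow> complex)) list"

definition bilinear_form ::
  "'i nspace \<Rightarrow> 'j nspace \<Rightarrow> (('i \<Rightarrow> complex) \<Rightarrow> ('j \<Rightarrow> complex) \<Rightarrow> complex) \<Rightarrow> bool" where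
  "bilinear_form X Y B \<longleftrightarrow>
     (\<forall>y\<in>vecs Y. linear_functional X (\<lambda>x. B x y)) \<and>
     (\<forall>x\<in>vecs X. linear_functional Y (\<lambda>y. B x y)) \<and>
     (\<forall>x\<in>vecs X. \<forall>y\<in>vecs Y. nrm X x = 0 \<or> nrm Y y = 0 \<longrightarrow> B x y = 0)"

definition tensor_eq ::
  "'i nspace \<Rightarrow> 'j nspace \<Rightarrow> ('i, 'j) tensor \<Rightarrow> ('i, 'j) tensor \<Rightarrow> bool" where
  "tensor_eq X Y z w \<longleftrightarrow>
     (\<forall>B. bilinear_form X Y B \<longrightarrow> (\<Sum>(x, y)\<leftarrow>z. B x y) = (\<Sum>(x, y)\<leftarrow>w. B x y))"

definition pairing :: "('i \<Rightarrow> complex, 'j \<Rightarrow> complex) tensor \<Rightarrow> ('i, 'j) tensor \<Rightarrow> complex" where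
  "pairing v z = (\<Sum>(f, g)\<leftarrow>v. \<Sum>(x, y)\<leftarrow>z. f x * g y)"

section \<open>The norms \<open>\<alpha>\<^bsub>a,b\<^esub>\<close> and their duals\<close>

text \<open>Exponents are elements of \<open>[1,\<infinity>]\<close> in \<^typ>\<open>ennreal\<close>, where \<open>inverse 0 = \<infinity>\<close> and \<open>inverse \<infinity> = 0\<close>;
  thus the exponent \<open>r\<close> with \<open>1/r = 1/a + 1/b - 1\<close> is \<open>inverse (inverse a + inverse b - 1)\<close>.\<close>

definition conj_exp :: "ennreal \<Rightarrow> ennreal" where
  "conj_exp p = inverse (1 - inverse p)"

definition lnorm :: "ennreal \<Rightarrow> complex list \<Rightarrow> real" where
  "lnorm s cs =
     (if s = \<infinity> then Max (insert 0 (cmod ` set cs))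
      else (\<Sum>c\<leftarrow>cs. cmod c powr enn2real s) powr (1 / enn2real s))"

definition weak_norm :: "ennreal \<Rightarrow> 'i nspace \<Rightarrow> ('i \<Rightarrow> complex) list \<Rightarrow> real" where
  "weak_norm s X xs =
     (SUP f\<in>{f \<in> vecs (dual X). nrm (dual X) f \<le> 1}. lnorm s (map f xs))"

definition alpha ::
  "ennreal \<Rightarrow> ennreal \<Rightarrow> 'i nspace \<Rightarrow> 'j nspace \<Rightarrow> ('i, 'j) tensor \<Rightarrow> real" where
  "alpha a b X Y z =
     Inf {lnorm (inverse (inverse a + inverse b - 1)) (map (\<lambda>(c, x, y). c) ts)
          * weak_norm (conj_exp b) X (map (\<lambda>(c, x, y). x) ts)
          * weak_norm (conj_exp a) Y (map (\<lambda>(c, x, y). y) ts) | ts.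
          set ts \<subseteq> UNIV \<times> vecs X \<times> vecs Y \<and>
          tensor_eq X Y z (map (\<lambda>(c, x, y). (cscale c x, y)) ts)}"

definition alpha_dual_fd ::
  "ennreal \<Rightarrow> ennreal \<Rightarrow> 'i nspace \<Rightarrow> 'j nspace \<Rightarrow> ('i, 'j) tensor \<Rightarrow> real" where
  "alpha_dual_fd a b M N z =
     (SUP v\<in>{v. set v \<subseteq> vecs (dual M) \<times> vecs (dual N) \<and> alpha a b (dual M) (dual N) v \<le> 1}.
        cmod (pairing v z))"

definition alpha_dual ::
  "ennreal \<Rightarrow> ennreal \<Rightarrow> 'i nspace \<Rightarrow> 'j nspace \<Rightarrow> ('i, 'j) tensor \<Rightarrow> real" where
  "alpha_dual a b X Y z =
     Inf {alpha_dual_fd a b M N w | M N w.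
          fd_subspace X M \<and> fd_subspace Y N \<and> set w \<subseteq> vecs M \<times> vecs N \<and> tensor_eq X Y z w}"

section \<open>The space \<open>\<L>\<^bsub>a,b\<^esub>(X, Y\<^sup>*)\<close>\<close>

definition Lab_bound ::
  "ennreal \<Rightarrow> ennreal \<Rightarrow> 'i nspace \<Rightarrow> 'j nspace \<Rightarrow>
     (('i \<Rightarrow> complex) \<Rightarrow> ('j \<Rightarrow> complex) \<Rightarrow> complex) \<Rightarrow> real \<Rightarrow> bool" where
  "Lab_bound a b X Y T C \<longleftrightarrow> 0 \<le> C \<and>
     (\<forall>z. set z \<subseteq> vecs X \<times> vecs Y \<longrightarrow>
        cmod (\<Sum>(x, y)\<leftarrow>z. T x y) \<le> C * alpha_dual a b X Y z)"

definition Lab ::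
  "ennreal \<Rightarrow> ennreal \<Rightarrow> 'i nspace \<Rightarrow> 'j nspace \<Rightarrow>
     (('i \<Rightarrow> complex) \<Rightarrow> ('j \<Rightarrow> complex) \<Rightarrow> complex) set" where
  "Lab a b X Y = {T. bounded_op X (dual Y) T \<and> (\<exists>C. Lab_bound a b X Y T C)}"

definition Lab_norm ::
  "ennreal \<Rightarrow> ennreal \<Rightarrow> 'i nspace \<Rightarrow> 'j nspace \<Rightarrow>
     (('i \<Rightarrow> complex) \<Rightarrow> ('j \<Rightarrow> complex) \<Rightarrow> complex) \<Rightarrow> real" where
  "Lab_norm a b X Y T = Inf {C. Lab_bound a b X Y T C}"

section \<open>Measure spaces and \<open>L\<^sup>p\<close> spaces\<close>

text \<open>Localizable measure spaces: semi-finite, and every family of measurable sets has an essential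
  supremum. Semi-finiteness is spelled out, since the locale \<open>semifinite_measure\<close> of
  \<^theory>\<open>HOL-Analysis.Complete_Measure\<close> allows \<open>B = {}\<close> and hence holds for every measure.\<close>

definition localizable :: "'a measure \<Rightarrow> bool" where
  "localizable M \<longleftrightarrow>
     (\<forall>A\<in>sets M. emeasure M A = \<infinity> \<longrightarrow>
        (\<exists>B\<in>sets M. B \<subseteq> A \<and> 0 < emeasure M B \<and> emeasure M B < \<infinity>)) \<and>
     (\<forall>\<E>. \<E> \<subseteq> sets M \<longrightarrow>
        (\<exists>H\<in>sets M. (\<forall>E\<in>\<E>. E - H \<in> null_sets M) \<and>
           (\<forall>G\<in>sets M. (\<forall>E\<in>\<E>. E - G \<in> null_sets M) \<longrightarrow> H - G \<in> null_sets M)))"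

definition Lp :: "ennreal \<Rightarrow> 'a measure \<Rightarrow> 'a nspace" where
  "Lp p M =
     (if p = \<infinity> then
        \<lparr>vecs = {f \<in> borel_measurable M. esssup M (\<lambda>x. ennreal (cmod (f x))) < \<infinity>},
         nrm = (\<lambda>f. enn2real (esssup M (\<lambda>x. ennreal (cmod (f x)))))\<rparr>
      else
        \<lparr>vecs = {f \<in> borel_measurable M. integrable M (\<lambda>x. cmod (f x) powr enn2real p)},
         nrm = (\<lambda>f. (LINT x|M. cmod (f x) powr enn2real p) powr (1 / enn2real p))\<rparr>)"

text \<open>
  \<open>L\<^sup>\<infinity>(\<Omega>\<^sub>1 \<times> \<Omega>\<^sub>2)\<close> is taken with respect to the complete locally determined product measure:
  measurability and negligibility of a set are those of its intersections with the rectangles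
  \<open>E \<times> F\<close> with sides of finite measure. For sigma-finite measures this is the usual (completed)
  product; beyond that case the measure of the library's \<open>\<Otimes>\<^sub>M\<close> is not the product measure.
\<close>

definition Linf_prod :: "'a measure \<Rightarrow> 'b measure \<Rightarrow> ('a \<times> 'b \<Rightarrow> complex) set" where
  "Linf_prod M N =
     {\<phi>. \<exists>C. \<forall>E\<in>sets M. \<forall>F\<in>sets N. emeasure M E < \<infinity> \<longrightarrow> emeasure N F < \<infinity> \<longrightarrow>
        \<phi> \<in> borel_measurable (completion (restrict_space M E \<Otimes>\<^sub>M restrict_space N F)) \<and>
        (AE z in completion (restrict_space M E \<Otimes>\<^sub>M restrict_space N F). cmod (\<phi> z) \<le> C)}"

text \<open>
  For \<open>w \<in> L\<^sup>1(\<Omega>\<^sub>1)\<close>, the element \<open>t \<mapsto> \<integral> \<phi>(s,t) w(s) d\<mu>\<^sub>1(s)\<close> of \<open>L\<^sup>\<infinity>(\<Omega>\<^sub>2)\<close>. The integral, as a function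
  of \<open>t\<close>, is only determined and measurable up to a null set of each set of finite measure; the pieces
  are patched together to a measurable function since \<open>\<mu>\<^sub>2\<close> is localizable, in a way that is unique
  almost everywhere. The completion is needed as \<open>\<phi>\<close> need not have measurable sections.
\<close>

definition kernel_int ::
  "'a measure \<Rightarrow> 'b measure \<Rightarrow> ('a \<times> 'b \<Rightarrow> complex) \<Rightarrow> ('a \<Rightarrow> complex) \<Rightarrow> 'b \<Rightarrow> complex" where
  "kernel_int M N \<phi> w =
     (SOME g. g \<in> vecs (Lp \<infinity> N) \<and>
        (\<forall>F\<in>sets N. emeasure N F < \<infinity> \<longrightarrow>
           (AE t in N. t \<in> F \<longrightarrow> g t = (LINT s|completion M. \<phi> (s, t) * w s))))"

text \<open>The operator \<open>u\<^sub>\<phi> : L\<^sup>1(\<Omega>\<^sub>1) \<rightarrow> L\<^sup>\<infinity>(\<Omega>\<^sub>2)\<close>, where \<open>L\<^sup>\<infinity>(\<Omega>\<^sub>2)\<close> is identified with the dual of \<open>L\<^sup>1(\<Omega>\<^sub>2)\<close>.\<close>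

definition Linf_functional :: "'b measure \<Rightarrow> ('b \<Rightarrow> complex) \<Rightarrow> ('b \<Rightarrow> complex) \<Rightarrow> complex" where
  "Linf_functional N g = (\<lambda>h. LINT t|N. g t * h t)"

definition u_op ::
  "'a measure \<Rightarrow> 'b measure \<Rightarrow> ('a \<times> 'b \<Rightarrow> complex) \<Rightarrow>
     ('a \<Rightarrow> complex) \<Rightarrow> ('b \<Rightarrow> complex) \<Rightarrow> complex" where
  "u_op M N \<phi> f = Linf_functional N (kernel_int M N \<phi> f)"

section \<open>Schur multipliers\<close>

text \<open>The operator \<open>L\<^sup>p(\<Omega>\<^sub>1) \<rightarrow> L\<^sup>q(\<Omega>\<^sub>2)\<close> given by a tensor in \<open>L\<^bsup>p'\<^esup>(\<Omega>\<^sub>1) \<otimes> L\<^sup>q(\<Omega>\<^sub>2)\<close>; its operator norm is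
  the injective norm of the tensor.\<close>

definition tensor_op :: "'a measure \<Rightarrow> ('a, 'b) tensor \<Rightarrow> ('a \<Rightarrow> complex) \<Rightarrow> 'b \<Rightarrow> complex" where
  "tensor_op M u h = (\<lambda>t. \<Sum>(f, g)\<leftarrow>u. (LINT s|M. f s * h s) * g t)"

definition inj_norm ::
  "ennreal \<Rightarrow> ennreal \<Rightarrow> 'a measure \<Rightarrow> 'b measure \<Rightarrow> ('a, 'b) tensor \<Rightarrow> real" where
  "inj_norm p q M N u = opnorm (Lp p M) (Lp q N) (tensor_op M u)"

definition schur_map ::
  "'a measure \<Rightarrow> 'b measure \<Rightarrow> ('a \<times> 'b \<Rightarrow> complex) \<Rightarrow> ('a, 'b) tensor \<Rightarrow>
     ('a \<Rightarrow> complex) \<Rightarrow> 'b \<Rightarrow> complex" where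
  "schur_map M N \<phi> u h = (\<lambda>t. \<Sum>(f, g)\<leftarrow>u. kernel_int M N \<phi> (\<lambda>s. f s * h s) t * g t)"

definition schur_bound ::
  "ennreal \<Rightarrow> ennreal \<Rightarrow> 'a measure \<Rightarrow> 'b measure \<Rightarrow> ('a \<times> 'b \<Rightarrow> complex) \<Rightarrow> real \<Rightarrow> bool" where
  "schur_bound p q M N \<phi> C \<longleftrightarrow> 0 \<le> C \<and>
     (\<forall>u. set u \<subseteq> vecs (Lp (conj_exp p) M) \<times> vecs (Lp q N) \<longrightarrow>
        opnorm (Lp p M) (Lp q N) (schur_map M N \<phi> u) \<le> C * inj_norm p q M N u)"

definition schur_multiplier ::
  "ennreal \<Rightarrow> ennreal \<Rightarrow> 'a measure \<Rightarrow> 'b measure \<Rightarrow> ('a \<times> 'b \<Rightarrow> complex) \<Rightarrow> bool" where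
  "schur_multiplier p q M N \<phi> \<longleftrightarrow> (\<exists>C. schur_bound p q M N \<phi> C)"

definition schur_norm ::
  "ennreal \<Rightarrow> ennreal \<Rightarrow> 'a measure \<Rightarrow> 'b measure \<Rightarrow> ('a \<times> 'b \<Rightarrow> complex) \<Rightarrow> real" where
  "schur_norm p q M N \<phi> = Inf {C. schur_bound p q M N \<phi> C}"

end

theory Submission
  imports Defs
begin

text \<open>
  Both norm bounds are inequalities for the bilinear form \<open>\<beta>(x, y) = \<integral>\<integral> \<phi>(s,t) x(s) y(t)\<close> on \<open>L\<^sup>1 \<times> L\<^sup>1\<close>, and they
  are equivalent with the same constant. By duality in \<open>L\<^sup>q\<close>, \<open>\<phi>\<close> is a Schur multiplier with bound \<open>C\<close>
  iff \<open>|\<Sum> \<beta>(f h, g k)| \<le> C \<parallel>u\<parallel>\<close> for \<open>u = \<Sum> f \<otimes> g\<close> of injective norm \<open>\<parallel>u\<parallel>\<close> and \<open>h\<close>, \<open>k\<close> in the unit balls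
  of \<open>L\<^sup>p\<close> and \<open>L\<^bsup>q'\<^esup>\<close>. Averaging over finite partitions approximates tensors in \<open>L\<^sup>1 \<otimes> L\<^sup>1\<close> by tensors in
  \<open>\<ell>\<^sup>1 \<otimes> \<ell>\<^sup>1\<close>. There, Hoelder's inequality with the exponents \<open>r\<close>, \<open>p\<close>, \<open>q'\<close> gives \<open>\<alpha>'(\<Sum> f h \<otimes> g k) \<le> \<parallel>u\<parallel>\<close>.
  Conversely, \<open>\<alpha>'(z) \<le> D\<close> says that the matrix \<open>z\<close> is \<open>(r'; p, q')\<close>-dominated, and a separation argument
  in the style of Pietsch and Kwapien yields probability weights on the two partitions. Their roots \<open>h\<close>, \<open>k\<close>
  factor \<open>z\<^sub>A\<^sub>B = h\<^sub>A u\<^sub>A\<^sub>B k\<^sub>B\<close> with \<open>\<parallel>u\<parallel> \<le> D\<close>, so that the Schur bound applies.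
\<close>

section \<open>Hoelder inequality and duality of Lebesgue spaces\<close>

text \<open>Both norms are infima of admissible constants, and the aim is that the two sets of
  constants coincide, so nothing may be lost in passing to partitions. Averaging is a contraction of
  L^1, and the span of the normalized indicators is an isometric copy of ell^1. The subspaces in the
  definition of \<alpha>' are arbitrary, however: families of coordinates act on them through the
  masses of the partition sets, and the contraction property keeps their weak norms at most 1.
  Separation applies because domination becomes additive after raising to the power r', where 1/r' =
  1/p + 1/q': the inequality |z(a,b)|^r' <= D^r' (\<theta> |a|^p + (1 - \<theta>) |b|^q') is linear
  in the weights, with \<theta> the share of 1/p in 1/r'. Infinite exponents are the recurring
  obstacle: their reciprocal is 0 and sup norms carry no weight, so they appear as side conditions.
  Beyond sigma-finite measures the kernel integral is determined only on sets of finite measure, and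
  localizability glues the pieces.\<close>

lemma ennreal_inverse_inverse [simp]: "inverse (inverse x) = (x::ennreal)"
proof (cases x)
  case (real r)
  then show ?thesis by (cases "r = 0") (simp_all add: inverse_ennreal)
qed simp

lemma ennreal_inverse_antimono: "x \<le> y \<Longrightarrow> inverse y \<le> inverse (x::ennreal)"
proof (cases x; cases y)
  fix a b assume "x \<le> y" "0 \<le> a" "x = ennreal a" "0 \<le> b" "y = ennreal b"
  then show ?thesis by (cases "a = 0") (auto simp: inverse_ennreal intro!: ennreal_leI le_imp_inverse_le)
qed (auto simp: top_unique)

text \<open>The reciprocal 1/p as a real number, with value 0 at infinity. Hoelder conditions become
  linear equations between reals that cover infinite exponents as well.\<close>

definition iexp :: "ennreal \<Rightarrow> real" where
  "iexp p = enn2real (inverse p)"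

lemma iexp_top [simp]: "iexp \<infinity> = 0" "iexp top = 0"
  by (simp_all add: iexp_def)

lemma enn2real_ge_1:
  assumes "1 \<le> p" "p \<noteq> \<infinity>" shows "1 \<le> enn2real p"
  using enn2real_mono[of 1 p] assms by (simp add: less_top)

lemma iexp_finite:
  assumes "1 \<le> p" "p \<noteq> \<infinity>" shows "iexp p = 1 / enn2real p"
proof -
  have "p = ennreal (enn2real p)" using assms by (simp add: less_top)
  moreover have "0 < enn2real p" using enn2real_ge_1[OF assms] by simp
  ultimately have "inverse p = ennreal (inverse (enn2real p))"
    by (metis inverse_ennreal)
  then show ?thesis unfolding iexp_def
    by (simp add: inverse_eq_divide)
qed

lemma iexp_nonneg [simp]: "0 \<le> iexp p"
  by (simp add: iexp_def)

lemma iexp_eq_0_iff: "1 \<le> p \<Longrightarrow> iexp p = 0 \<longleftrightarrow> p = \<infinity>"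
  using iexp_finite[of p] enn2real_ge_1[of p] by (cases "p = \<infinity>") auto

lemma iexp_le_1: "1 \<le> p \<Longrightarrow> iexp p \<le> 1"
  using iexp_finite[of p] enn2real_ge_1[of p] by (cases "p = \<infinity>") auto

lemma inverse_le_1: "1 \<le> p \<Longrightarrow> inverse p \<le> (1::ennreal)"
  by (metis ennreal_inverse_antimono ennreal_inverse_1)

lemma inverse_eq_iexp:
  assumes "1 \<le> p" shows "inverse p = ennreal (iexp p)"
proof -
  have "inverse p \<noteq> top" using inverse_le_1[OF assms] by (auto simp: top_unique)
  then show ?thesis by (simp add: iexp_def less_top del: ennreal_inverse_eq_top_iff)
qed

lemma iexp_inverse:
  "0 \<le> x \<Longrightarrow> iexp (inverse (ennreal x)) = x"
  by (simp add: iexp_def)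

lemma one_le_inverse: "0 \<le> x \<Longrightarrow> x \<le> 1 \<Longrightarrow> 1 \<le> inverse (ennreal x)"
  by (metis ennreal_inverse_antimono ennreal_1 ennreal_leI ennreal_inverse_1)

lemma conj_exp_iexp:
  assumes "1 \<le> p" shows "conj_exp p = inverse (ennreal (1 - iexp p))"
  unfolding conj_exp_def inverse_eq_iexp[OF assms]
  using iexp_le_1[OF assms] by (simp add: ennreal_minus flip: ennreal_1)

lemma conj_exp_ge_1: "1 \<le> p \<Longrightarrow> 1 \<le> conj_exp p"
  by (simp add: conj_exp_iexp one_le_inverse iexp_le_1)

lemma iexp_conj_exp: "1 \<le> p \<Longrightarrow> iexp (conj_exp p) = 1 - iexp p"
  by (simp add: conj_exp_iexp iexp_inverse iexp_le_1)

lemma iexp_inj: "1 \<le> p \<Longrightarrow> 1 \<le> q \<Longrightarrow> iexp p = iexp q \<Longrightarrow> p = q"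
  by (metis ennreal_inverse_inverse inverse_eq_iexp)

lemma conj_exp_conj_exp: "1 \<le> p \<Longrightarrow> conj_exp (conj_exp p) = p"
  by (rule iexp_inj) (auto simp: conj_exp_ge_1 iexp_conj_exp)

lemma iexp_antimono: "1 \<le> q \<Longrightarrow> q \<le> p \<Longrightarrow> iexp p \<le> iexp q"
  unfolding iexp_def
  by (intro enn2real_mono ennreal_inverse_antimono)
     (auto intro: le_less_trans[OF inverse_le_1])

text \<open>Here q <= p enters: the two reciprocals add up to at least 1, so the truncated
  subtraction of \<open>ennreal\<close> is a true one, and 1/r = 1/q - 1/p.\<close>

lemma alpha_exponent:
  assumes "1 \<le> q" "q \<le> p"
  defines "r \<equiv> inverse (inverse q + inverse (conj_exp p) - 1)"
  shows "1 \<le> r" "iexp r = iexp q - iexp p"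
proof -
  have p: "1 \<le> p" using assms by simp
  have "inverse q + inverse (conj_exp p) - 1 = ennreal (iexp q + (1 - iexp p)) - ennreal 1"
    using iexp_le_1[OF p]
    by (simp add: inverse_eq_iexp assms conj_exp_ge_1 p iexp_conj_exp)
  also have "\<dots> = ennreal (iexp q - iexp p)"
    by (subst ennreal_minus) auto
  finally have r: "r = inverse (ennreal (iexp q - iexp p))" unfolding r_def by simp
  have *: "iexp p \<le> iexp q" using iexp_antimono assms by blast
  show "1 \<le> r" unfolding r using * iexp_le_1[OF assms(1)] iexp_nonneg[of p]
    by (intro one_le_inverse) linarith+
  show "iexp r = iexp q - iexp p" unfolding r using * by (simp add: iexp_inverse)
qed

section \<open>The inequalities of Young and Hoelder for three exponents\<close>

lemma weighted_AM_GM3: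
  fixes x y z :: real
  assumes "0 < x" "0 < y" "0 < z" "0 \<le> a" "0 \<le> b" "0 \<le> c" "a + b + c = 1"
  shows "x powr a * y powr b * z powr c \<le> a * x + b * y + c * z"
proof -
  let ?m = "a * x + b * y + c * z"
  have "0 < a \<or> 0 < b \<or> 0 < c" using assms by linarith
  then have m: "0 < ?m" using assms
    by (smt (verit) mult_nonneg_nonneg mult_pos_pos)
  \<comment> \<open>The tangent of \<open>ln\<close> at the weighted mean \<open>?m\<close>. Since
    a, b, c sum to 1, the weighted sum of these bounds at x, y, z collapses to
    \<open>ln ?m\<close>.\<close>
  have l: "ln t \<le> ln ?m + t / ?m - 1" if "0 < t" for t
  proof -
    have "ln (t / ?m) \<le> t / ?m - 1" using ln_le_minus_one that m by simp
    then show ?thesis using that m by (simp add: ln_div)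
  qed
  have "a * ln x + b * ln y + c * ln z
      \<le> a * (ln ?m + x / ?m - 1) + b * (ln ?m + y / ?m - 1) + c * (ln ?m + z / ?m - 1)"
    using assms by (intro add_mono mult_left_mono l) auto
  also have "\<dots> = (a + b + c) * (ln ?m - 1) + ?m / ?m"
    unfolding add_divide_distrib by (simp add: algebra_simps)
  also have "\<dots> = ln ?m" using assms m by simp
  finally have "exp (a * ln x + b * ln y + c * ln z) \<le> ?m" using m
    by (metis exp_le_cancel_iff exp_ln)
  then show ?thesis using assms by (simp add: powr_def exp_add)
qed

text \<open>For finite p this is an equality. For p = infinity both \<open>enn2real p\<close> and
  \<open>iexp p\<close> are 0 and the right side is 1, hence the side condition.\<close>

lemma le_powr_iexp:
  assumes "1 \<le> p" "0 < x" "p = \<infinity> \<Longrightarrow> x \<le> 1"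
  shows "x \<le> (x powr enn2real p) powr iexp p"
  using assms enn2real_ge_1[of p] by (cases "p = \<infinity>") (auto simp: iexp_finite powr_powr)

text \<open>Weighted AM-GM for the powers, with the reciprocals as weights. A term with infinite
  exponent has weight 0; the hypothesis that its factor is at most 1 takes its place.\<close>

lemma Young3:
  assumes "1 \<le> p" "1 \<le> q" "1 \<le> r" "iexp p + iexp q + iexp r = 1"
    and "0 \<le> x" "0 \<le> y" "0 \<le> z"
    and "p = \<infinity> \<Longrightarrow> x \<le> 1" "q = \<infinity> \<Longrightarrow> y \<le> 1" "r = \<infinity> \<Longrightarrow> z \<le> 1"
  shows "x * y * z \<le> iexp p * x powr enn2real p + iexp q * y powr enn2real q + iexp r * z powr enn2real r"
proof (cases "x = 0 \<or> y = 0 \<or> z = 0")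
  case True
  have "0 \<le> iexp p * x powr enn2real p + iexp q * y powr enn2real q + iexp r * z powr enn2real r"
    by simp
  then show ?thesis using True by auto
next
  case False
  then have pos: "0 < x" "0 < y" "0 < z" using assms by auto
  have "x * y * z \<le> (x powr enn2real p) powr iexp p * (y powr enn2real q) powr iexp q
      * (z powr enn2real r) powr iexp r"
    using assms pos by (intro mult_mono le_powr_iexp) auto
  also have "\<dots> \<le> iexp p * x powr enn2real p + iexp q * y powr enn2real q + iexp r * z powr enn2real r"
    using pos assms by (intro weighted_AM_GM3) auto
  finally show ?thesis .
qed

text \<open>Membership in L^p with norm at most c (see \<open>Lp_bound_iff\<close>), stated without
  roots and without the essential supremum: estimates can be integrated directly, and p = infinity
  is a plain almost everywhere bound.\<close>

definition Lp_bound :: "ennreal \<Rightarrow> 'a measure \<Rightarrow> ('a \<Rightarrow> complex) \<Rightarrow> real \<Rightarrow> bool" where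
  "Lp_bound p M f c \<longleftrightarrow> 0 \<le> c \<and> f \<in> borel_measurable M \<and>
     (if p = \<infinity> then AE x in M. cmod (f x) \<le> c
      else integrable M (\<lambda>x. cmod (f x) powr enn2real p) \<and>
           (LINT x|M. cmod (f x) powr enn2real p) \<le> c powr enn2real p)"

lemma Lp_bound_measurable: "Lp_bound p M f c \<Longrightarrow> f \<in> borel_measurable M"
  by (simp add: Lp_bound_def)

lemma Lp_bound_nonneg: "Lp_bound p M f c \<Longrightarrow> 0 \<le> c"
  by (simp add: Lp_bound_def)

lemma powr_inverse_le_iff:
  fixes x c p :: real
  assumes "0 \<le> x" "0 \<le> c" "0 < p"
  shows "x powr (1 / p) \<le> c \<longleftrightarrow> x \<le> c powr p"
proof
  assume "x powr (1 / p) \<le> c"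
  then have "(x powr (1 / p)) powr p \<le> c powr p" using assms by (intro powr_mono2) auto
  then show "x \<le> c powr p" using assms by (simp add: powr_powr)
next
  assume "x \<le> c powr p"
  then have "x powr (1 / p) \<le> (c powr p) powr (1 / p)" using assms by (intro powr_mono2) auto
  then show "x powr (1 / p) \<le> c" using assms by (simp add: powr_powr)
qed

lemma Lp_bound_iff:
  assumes "1 \<le> p" "0 \<le> c"
  shows "Lp_bound p M f c \<longleftrightarrow> f \<in> vecs (Lp p M) \<and> nrm (Lp p M) f \<le> c"
proof (cases "p = \<infinity>")
  case True
  let ?g = "\<lambda>x. ennreal (cmod (f x))"
  have "(AE x in M. cmod (f x) \<le> c) \<longleftrightarrow> esssup M ?g < \<infinity> \<and> enn2real (esssup M ?g) \<le> c"
    if f: "f \<in> borel_measurable M"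
  proof
    assume "AE x in M. cmod (f x) \<le> c"
    then have "esssup M ?g \<le> ennreal c"
      using f by (intro esssup_I) (auto elim!: eventually_mono simp: ennreal_leI)
    then show "esssup M ?g < \<infinity> \<and> enn2real (esssup M ?g) \<le> c"
      using assms by (auto simp: enn2real_leI intro: le_less_trans)
  next
    assume a: "esssup M ?g < \<infinity> \<and> enn2real (esssup M ?g) \<le> c"
    then have "esssup M ?g \<le> ennreal c"
      by (metis ennreal_enn2real ennreal_leI infinity_ennreal_def)
    then have "AE x in M. ?g x \<le> ennreal c"
      using esssup_AE[of ?g M] by (auto elim!: eventually_mono)
    then show "AE x in M. cmod (f x) \<le> c" using assms by (auto elim!: eventually_mono)
  qed
  then show ?thesis using True assms by (auto simp: Lp_bound_def Lp_def)
next
  case False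
  then have "1 \<le> enn2real p" using enn2real_ge_1 assms by blast
  then show ?thesis using False assms
    by (auto simp: Lp_bound_def Lp_def powr_inverse_le_iff)
qed

lemma nrm_Lp_nonneg: "0 \<le> nrm (Lp p M) f"
  by (auto simp: Lp_def)

lemma vecs_Lp_iff: "1 \<le> p \<Longrightarrow> f \<in> vecs (Lp p M) \<longleftrightarrow> (\<exists>c. Lp_bound p M f c)"
  by (metis Lp_bound_iff Lp_bound_nonneg nrm_Lp_nonneg order_refl)

lemma Lp_bound_nrm: "1 \<le> p \<Longrightarrow> f \<in> vecs (Lp p M) \<Longrightarrow> Lp_bound p M f (nrm (Lp p M) f)"
  by (simp add: Lp_bound_iff nrm_Lp_nonneg)

lemma Lp_bound_mono: "Lp_bound p M f c \<Longrightarrow> c \<le> d \<Longrightarrow> Lp_bound p M f d"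
  using powr_mono2[of "enn2real p" c d] unfolding Lp_bound_def
  by (auto elim!: eventually_mono split: if_splits)

lemma Lp_bound_scale:
  assumes "Lp_bound p M f c"
  shows "Lp_bound p M (\<lambda>x. k * f x) (cmod k * c)"
  using assms unfolding Lp_bound_def
  by (auto simp: norm_mult powr_mult intro!: mult_left_mono elim!: eventually_mono)

lemma Lp_bound_dominated:
  assumes "Lp_bound p M f c" "g \<in> borel_measurable M" "AE x in M. cmod (g x) \<le> cmod (f x)"
  shows "Lp_bound p M g c"
proof (cases "p = \<infinity>")
  case True
  have "AE x in M. cmod (g x) \<le> c"
    using assms(1,3) True by (auto simp: Lp_bound_def elim!: eventually_elim2)
  then show ?thesis using True assms by (simp add: Lp_bound_def)
next
  case False
  have m: "g \<in> borel_measurable M" "f \<in> borel_measurable M" using assms by (auto simp: Lp_bound_def)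
  have ae: "AE x in M. cmod (g x) powr enn2real p \<le> cmod (f x) powr enn2real p"
    using assms(3) by (auto elim!: eventually_mono intro!: powr_mono2)
  have i: "integrable M (\<lambda>x. cmod (g x) powr enn2real p)"
    by (rule Bochner_Integration.integrable_bound[of _ "\<lambda>x. cmod (f x) powr enn2real p"])
       (use assms(1) False ae m in \<open>auto simp: Lp_bound_def\<close>)
  have "(LINT x|M. cmod (g x) powr enn2real p) \<le> (LINT x|M. cmod (f x) powr enn2real p)"
    using assms(1) False by (intro integral_mono_AE i ae) (auto simp: Lp_bound_def)
  then show ?thesis using i m False assms(1) by (auto simp: Lp_bound_def)
qed

lemma Lp_bound_0: "Lp_bound p M (\<lambda>x. 0) 0"
  by (auto simp: Lp_bound_def)

lemma Lp_bound_0_AE: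
  assumes "Lp_bound p M f 0" "1 \<le> p" shows "AE x in M. f x = 0"
proof (cases "p = \<infinity>")
  case False
  then have "integrable M (\<lambda>x. cmod (f x) powr enn2real p)"
    "(LINT x|M. cmod (f x) powr enn2real p) = 0"
    using assms(1) enn2real_ge_1[OF assms(2) False] integral_nonneg_AE[of "\<lambda>x. cmod (f x) powr enn2real p" M]
    by (auto simp: Lp_bound_def intro: antisym)
  then have "AE x in M. cmod (f x) powr enn2real p = 0"
    by (subst (asm) integral_nonneg_eq_0_iff_AE) auto
  then show ?thesis by simp
qed (use assms in \<open>auto simp: Lp_bound_def\<close>)

text \<open>|f + g| is at most twice the larger modulus, so its p-th power is dominated by 2^p times
  the sum of the p-th powers.\<close>

lemma Lp_add:
  assumes "1 \<le> p" "f \<in> vecs (Lp p M)" "g \<in> vecs (Lp p M)"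
  shows "(\<lambda>x. f x + g x) \<in> vecs (Lp p M)"
proof (cases "p = \<infinity>")
  case True
  obtain a b where "Lp_bound p M f a" "Lp_bound p M g b" using assms vecs_Lp_iff by metis
  then have "Lp_bound p M (\<lambda>x. f x + g x) (a + b)" using True
    by (auto simp: Lp_bound_def elim!: eventually_elim2 intro!: norm_triangle_le add_mono)
  then show ?thesis using assms vecs_Lp_iff by metis
next
  case False
  let ?p = "enn2real p"
  have [measurable]: "f \<in> borel_measurable M" "g \<in> borel_measurable M"
    using assms False by (auto simp: Lp_def)
  have i: "integrable M (\<lambda>x. 2 powr ?p * (cmod (f x) powr ?p + cmod (g x) powr ?p))"
    using assms False by (auto simp: Lp_def)
  have "cmod (f x + g x) powr ?p \<le> 2 powr ?p * (cmod (f x) powr ?p + cmod (g x) powr ?p)" for x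
  proof -
    let ?m = "max (cmod (f x)) (cmod (g x))"
    have "cmod (f x + g x) \<le> 2 * ?m" using norm_triangle_ineq[of "f x" "g x"] by linarith
    then have "cmod (f x + g x) powr ?p \<le> (2 * ?m) powr ?p" by (intro powr_mono2) auto
    also have "\<dots> = 2 powr ?p * ?m powr ?p" by (simp add: powr_mult)
    also have "?m powr ?p \<le> cmod (f x) powr ?p + cmod (g x) powr ?p" by (simp add: max_def)
    finally show ?thesis by simp
  qed
  then have "integrable M (\<lambda>x. cmod (f x + g x) powr ?p)"
    by (intro Bochner_Integration.integrable_bound[OF i]) auto
  then show ?thesis using False by (simp add: Lp_def)
qed

lemma Lp_scale: "1 \<le> p \<Longrightarrow> f \<in> vecs (Lp p M) \<Longrightarrow> (\<lambda>x. k * f x) \<in> vecs (Lp p M)"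
  using vecs_Lp_iff Lp_bound_scale by metis

lemma Lp_zero: "1 \<le> p \<Longrightarrow> (\<lambda>x. 0) \<in> vecs (Lp p M)"
  using vecs_Lp_iff Lp_bound_0 by metis

lemma Lp_sum_list:
  assumes "1 \<le> p" "\<And>t. t \<in> set ts \<Longrightarrow> f t \<in> vecs (Lp p M)"
  shows "(\<lambda>x. \<Sum>t\<leftarrow>ts. f t x) \<in> vecs (Lp p M)"
  using assms(2) by (induction ts) (auto intro: Lp_zero Lp_add assms(1))

text \<open>The factor \<open>iexp p\<close> makes the term of Young's inequality vanish for p =
  infinity, so one bound serves all exponents.\<close>

lemma Lp_bound_normalized_integral:
  assumes "1 \<le> p" "Lp_bound p M f c" "0 < c"
  shows "integrable M (\<lambda>x. iexp p * (cmod (f x) / c) powr enn2real p)"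
    and "(LINT x|M. iexp p * (cmod (f x) / c) powr enn2real p) \<le> iexp p"
proof -
  have "integrable M (\<lambda>x. iexp p * (cmod (f x) / c) powr enn2real p) \<and>
    (LINT x|M. iexp p * (cmod (f x) / c) powr enn2real p) \<le> iexp p"
  proof (cases "p = \<infinity>")
    case False
    have "integrable M (\<lambda>x. cmod (f x) powr enn2real p)"
      "(LINT x|M. cmod (f x) powr enn2real p) \<le> c powr enn2real p"
      using assms False by (auto simp: Lp_bound_def)
    then show ?thesis using assms by (simp add: powr_divide divide_le_eq mult_left_mono)
  qed simp
  then show "integrable M (\<lambda>x. iexp p * (cmod (f x) / c) powr enn2real p)"
    "(LINT x|M. iexp p * (cmod (f x) / c) powr enn2real p) \<le> iexp p" by auto
qed

text \<open>Young's inequality for the functions divided by their bounds, integrated: the right side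
  becomes 1/p + 1/q + 1/r = 1. A zero bound cannot be divided by, but then the product vanishes
  almost everywhere.\<close>

lemma Holder3:
  assumes pqr: "1 \<le> p" "1 \<le> q" "1 \<le> r" "iexp p + iexp q + iexp r = 1"
    and f: "Lp_bound p M f a" and g: "Lp_bound q M g b" and h: "Lp_bound r M h c"
  shows "integrable M (\<lambda>x. f x * g x * h x)" "(LINT x|M. cmod (f x * g x * h x)) \<le> a * b * c"
proof -
  have [measurable]: "f \<in> borel_measurable M" "g \<in> borel_measurable M" "h \<in> borel_measurable M"
    using f g h by (auto simp: Lp_bound_def)
  have "integrable M (\<lambda>x. f x * g x * h x) \<and> (LINT x|M. cmod (f x * g x * h x)) \<le> a * b * c"
  proof (cases "a = 0 \<or> b = 0 \<or> c = 0")
    case True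
    then have "(AE x in M. f x = 0) \<or> (AE x in M. g x = 0) \<or> (AE x in M. h x = 0)"
      using Lp_bound_0_AE[of p M f] Lp_bound_0_AE[of q M g] Lp_bound_0_AE[of r M h] f g h pqr
      by auto
    then have "AE x in M. f x * g x * h x = 0"
      by (elim disjE) (auto elim: eventually_mono)
    then have "integrable M (\<lambda>x. f x * g x * h x) \<longleftrightarrow> integrable M (\<lambda>x. 0::complex)"
      "(LINT x|M. cmod (f x * g x * h x)) = (LINT x|M. 0)"
      by (intro integrable_cong_AE integral_cong_AE; auto elim: eventually_mono)+
    then show ?thesis using f g h by (auto simp: Lp_bound_def)
  next
    case False
    then have pos: "0 < a" "0 < b" "0 < c" using f g h by (auto simp: Lp_bound_def)
    let ?w = "\<lambda>x. iexp p * (cmod (f x) / a) powr enn2real p + iexp q * (cmod (g x) / b) powr enn2real q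
      + iexp r * (cmod (h x) / c) powr enn2real r"
    note n = Lp_bound_normalized_integral[OF pqr(1) f pos(1)]
      Lp_bound_normalized_integral[OF pqr(2) g pos(2)]
      Lp_bound_normalized_integral[OF pqr(3) h pos(3)]
    have w: "integrable M ?w" using n by auto
    have lw: "(LINT x|M. ?w x) \<le> 1" using n pqr(4) by simp
    have "AE x in M. (p = \<infinity> \<longrightarrow> cmod (f x) \<le> a) \<and> (q = \<infinity> \<longrightarrow> cmod (g x) \<le> b) \<and> (r = \<infinity> \<longrightarrow> cmod (h x) \<le> c)"
      using f g h by (auto simp: Lp_bound_def)
    then have ae: "AE x in M. cmod (f x * g x * h x) \<le> a * b * c * ?w x"
    proof eventually_elim
      case (elim x)
      have "cmod (f x) / a * (cmod (g x) / b) * (cmod (h x) / c) \<le> ?w x"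
        using elim pos by (intro Young3 pqr) auto
      then show ?case using pos by (simp add: norm_mult field_simps)
    qed
    have w': "integrable M (\<lambda>x. a * b * c * ?w x)" using w by (rule integrable_mult_right)
    have i: "integrable M (\<lambda>x. f x * g x * h x)"
      by (rule Bochner_Integration.integrable_bound[OF w'])
        (use ae in \<open>auto elim!: eventually_mono intro: order_trans[OF _ abs_ge_self]\<close>)
    moreover have "(LINT x|M. cmod (f x * g x * h x)) \<le> (LINT x|M. a * b * c * ?w x)"
      using i by (intro integral_mono_AE w' ae integrable_norm)
    moreover have "(LINT x|M. a * b * c * ?w x) \<le> a * b * c"
      using lw pos by (subst integral_mult_right_zero) (simp add: mult_left_le)
    ultimately show ?thesis by linarith
  qed
  then show "integrable M (\<lambda>x. f x * g x * h x)" "(LINT x|M. cmod (f x * g x * h x)) \<le> a * b * c"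
    by auto
qed

lemma Holder:
  assumes "1 \<le> p" "Lp_bound (conj_exp p) M f a" "Lp_bound p M g b"
  shows "integrable M (\<lambda>x. f x * g x)" "(LINT x|M. cmod (f x * g x)) \<le> a * b"
    "cmod (LINT x|M. f x * g x) \<le> a * b"
proof -
  \<comment> \<open>A third factor with exponent infinity, whose reciprocal is 0.\<close>
  have *: "Lp_bound \<infinity> M (\<lambda>x. 1) 1" by (simp add: Lp_bound_def)
  show 1: "integrable M (\<lambda>x. f x * g x)" and 2: "(LINT x|M. cmod (f x * g x)) \<le> a * b"
    using Holder3[OF conj_exp_ge_1[OF assms(1)] assms(1) _ _ assms(2,3) *] assms(1)
    by (auto simp: iexp_conj_exp)
  show "cmod (LINT x|M. f x * g x) \<le> a * b" using 2 by (rule order_trans[OF integral_norm_bound])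
qed

section \<open>Duality of conjugate exponents over semi-finite measures\<close>

lemma conj_exp_top [simp]: "conj_exp top = 1"
  by (simp add: conj_exp_def)

lemma enn2real_conj_exp:
  assumes "1 \<le> q" "q \<noteq> \<infinity>" "q \<noteq> 1"
  shows "conj_exp q \<noteq> \<infinity>" "enn2real (conj_exp q) = enn2real q / (enn2real q - 1)" "1 < enn2real q"
proof -
  have "iexp q \<noteq> iexp 1" using iexp_inj[of q 1] assms by auto
  then have "enn2real q \<noteq> 1" using iexp_finite[OF assms(1,2)] iexp_finite[of 1]
    by (metis enn2real_1 ennreal_one_neq_top infinity_ennreal_def order_refl)
  then show 1: "1 < enn2real q" using enn2real_ge_1[OF assms(1,2)] by (metis less_le)
  have i: "iexp (conj_exp q) = 1 - 1 / enn2real q" using assms by (simp add: iexp_conj_exp iexp_finite)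
  show 2: "conj_exp q \<noteq> \<infinity>" using i 1 iexp_top by auto
  have "1 / enn2real (conj_exp q) = (enn2real q - 1) / enn2real q"
    using i 1 2 iexp_finite[OF conj_exp_ge_1[OF assms(1)]] by (simp add: field_simps)
  then show "enn2real (conj_exp q) = enn2real q / (enn2real q - 1)"
    by (metis divide_divide_eq_right mult_1 div_by_1)
qed

text \<open>The first half of \<open>localizable\<close>, separated so that duality also applies to
  finite counting measures.\<close>

definition semifinite :: "'a measure \<Rightarrow> bool" where
  "semifinite M \<longleftrightarrow> (\<forall>A\<in>sets M. emeasure M A = \<infinity> \<longrightarrow>
     (\<exists>B\<in>sets M. B \<subseteq> A \<and> 0 < emeasure M B \<and> emeasure M B < \<infinity>))"

lemma semifinite_obtain:
  assumes "semifinite M" "A \<in> sets M" "0 < emeasure M A"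
  obtains B where "B \<in> sets M" "B \<subseteq> A" "0 < emeasure M B" "emeasure M B < \<infinity>"
  using assms unfolding semifinite_def by (cases "emeasure M A = \<infinity>") (auto simp: less_top)

lemma mult_cnj_sgn: "z * cnj (sgn z) = complex_of_real (cmod z)"
  by (simp add: sgn_eq complex_norm_square[symmetric] power2_eq_square)

lemma borel_measurable_cnj_sgn [measurable]:
  assumes [measurable]: "f \<in> borel_measurable M"
  shows "(\<lambda>x. cnj (sgn (f x))) \<in> borel_measurable M"
proof -
  have "(\<lambda>x. cnj (f x)) \<in> borel_measurable M"
    by (rule borel_measurable_continuous_on[OF _ assms]) (intro continuous_intros)
  then show ?thesis by (simp add: sgn_eq)
qed

text \<open>If |G| exceeded K + 1/(n+1) on a set of positive measure, semi-finiteness would give a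
  part B of finite positive measure, and the normalized conjugate phase of G on B would be a unit
  vector of L^1 violating the bound.\<close>

lemma Lp_bound_dual_top:
  assumes sf: "semifinite M" and G: "G \<in> vecs (Lp \<infinity> M)" and K: "0 \<le> K"
    and le: "\<And>k. Lp_bound 1 M k 1 \<Longrightarrow> cmod (LINT x|M. G x * k x) \<le> K"
  shows "Lp_bound \<infinity> M G K"
proof -
  have [measurable]: "G \<in> borel_measurable M" using G by (simp add: Lp_def)
  have "AE x in M. cmod (G x) \<le> K + 1 / Suc n" for n
  proof (rule ccontr)
    let ?c = "K + 1 / Suc n"
    define A where "A = {x \<in> space M. \<not> cmod (G x) \<le> ?c}"
    assume "\<not> (AE x in M. cmod (G x) \<le> ?c)"
    moreover have "A \<in> sets M" unfolding A_def by measurable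
    ultimately have "0 < emeasure M A"
      using AE_iff_measurable[of A M "\<lambda>x. cmod (G x) \<le> ?c"] by (auto simp: A_def zero_less_iff_neq_zero)
    then obtain B where B[measurable]: "B \<in> sets M" and "B \<subseteq> A" "0 < emeasure M B" "emeasure M B < \<infinity>"
      using semifinite_obtain[OF sf \<open>A \<in> sets M\<close>] by blast
    then have pos: "0 < measure M B"
      by (simp add: emeasure_eq_ennreal_measure zero_less_measure_iff)
    define k where "k x = indicator B x * cnj (sgn (G x)) / measure M B" for x
    have "x \<in> B \<Longrightarrow> G x \<noteq> 0" for x using \<open>B \<subseteq> A\<close> K by (auto simp: A_def)
    then have ck: "cmod (k x) = indicator B x / measure M B" for x
      using pos by (auto simp: k_def norm_mult norm_divide norm_sgn indicator_def)
    have ii: "integrable M (\<lambda>x. indicator B x :: real)"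
      using \<open>emeasure M B < \<infinity>\<close> by (simp add: integrable_indicator_iff)
    have m[measurable]: "k \<in> borel_measurable M" unfolding k_def
      by (intro borel_measurable_divide borel_measurable_times borel_measurable_cnj_sgn borel_measurable_const) simp_all
    have kb: "Lp_bound 1 M k 1" using pos ii m
      by (simp add: Lp_bound_def ck)
    have "integrable M (\<lambda>x. G x * k x)"
      using Holder(1)[of 1 M G "nrm (Lp \<infinity> M) G" k 1] Lp_bound_nrm[OF _ G] kb
      by (simp add: conj_exp_def)
    moreover have Gk: "G x * k x = complex_of_real (indicator B x * cmod (G x) / measure M B)" for x
      using mult_cnj_sgn[of "G x"] by (simp add: k_def indicator_def)
    ultimately have i: "integrable M (\<lambda>x. indicator B x * cmod (G x) / measure M B)"
      by (subst (asm) Gk) (simp only: complex_of_real_integrable_eq)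
    have "?c = (LINT x|M. indicator B x * ?c / measure M B)"
      using pos by simp
    also have "\<dots> \<le> (LINT x|M. indicator B x * cmod (G x) / measure M B)"
    proof (rule integral_mono[OF _ i])
      show "integrable M (\<lambda>x. indicator B x * ?c / measure M B)"
        using ii by simp
      show "indicator B x * ?c / measure M B \<le> indicator B x * cmod (G x) / measure M B" for x
        using pos \<open>B \<subseteq> A\<close> by (auto simp: A_def indicator_def intro!: divide_right_mono)
    qed
    also have "\<dots> \<le> cmod (LINT x|M. G x * k x)"
      using pos unfolding Gk integral_complex_of_real by (simp add: norm_divide divide_right_mono)
    also have "\<dots> \<le> K" by (rule le[OF kb])
    finally show False by simp
  qed
  then have "AE x in M. \<forall>n. cmod (G x) \<le> K + 1 / Suc n" by (simp add: AE_all_countable)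
  then have "AE x in M. cmod (G x) \<le> K"
  proof eventually_elim
    case (elim x)
    have "(\<lambda>n. K + 1 / Suc n) \<longlonglongrightarrow> K + 0"
      by (intro tendsto_intros LIMSEQ_Suc[OF lim_1_over_n])
    then show ?case using elim by (intro LIMSEQ_le_const) auto
  qed
  then show ?thesis using K by (simp add: Lp_bound_def)
qed

text \<open>For finite q, let N be the norm of G. As G is known to lie in L^q, the extremal function
  of Hoelder's inequality, the conjugate phase of G times (|G| / N)^(q-1), is itself a test
  function, and its pairing with G equals N.\<close>

lemma Lp_bound_dual:
  assumes sf: "semifinite M" and q: "1 \<le> q" and G: "G \<in> vecs (Lp q M)" and K: "0 \<le> K"
    and le: "\<And>k. Lp_bound (conj_exp q) M k 1 \<Longrightarrow> cmod (LINT x|M. G x * k x) \<le> K"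
  shows "Lp_bound q M G K"
proof (cases "q = \<infinity>")
  case True
  then show ?thesis using Lp_bound_dual_top[OF sf _ K] G le by simp
next
  case False
  then have fin: "q \<noteq> \<infinity>" "q \<noteq> top" by auto
  define r where "r = enn2real q"
  have r: "1 \<le> r" using q fin(1) enn2real_ge_1 r_def by blast
  have [measurable]: "G \<in> borel_measurable M" using G by (simp add: Lp_def fin)
  have i: "integrable M (\<lambda>x. cmod (G x) powr r)" using G by (simp add: Lp_def fin r_def)
  define S where "S = (LINT x|M. cmod (G x) powr r)"
  have S0: "0 \<le> S" unfolding S_def by simp
  have "S \<le> K powr r"
  proof (cases "S = 0")
    case False
    then have S: "0 < S" using S0 by simp
    define N where "N = S powr (1 / r)"
    have N: "0 < N" using S by (simp add: N_def)
    have SN: "S = N powr r" using r S by (simp add: N_def powr_powr)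
    define k where "k x = cnj (sgn (G x)) * complex_of_real (cmod (G x) powr (r - 1) / N powr (r - 1))" for x
    have m[measurable]: "k \<in> borel_measurable M" unfolding k_def by measurable
    have ck: "cmod (k x) = (if G x = 0 then 0 else (cmod (G x) / N) powr (r - 1))" for x
      using N by (simp add: k_def norm_mult norm_divide norm_sgn powr_divide)
    have "Lp_bound (conj_exp q) M k 1"
    \<comment> \<open>For q = 1 the conjugate exponent is infinite and k is a phase, so a pointwise
      bound takes the place of the integral.\<close>
    proof (cases "q = 1")
      case True
      then show ?thesis using m by (auto simp: Lp_bound_def ck r_def conj_exp_def)
    next
      case False
      note e = enn2real_conj_exp[OF q fin(1) False, folded r_def]
      have "cmod (k x) powr enn2real (conj_exp q) = cmod (G x) powr r / S" for x
        using e(3) N unfolding e(2) ck by (auto simp: powr_powr powr_divide SN)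
      then show ?thesis using m i S e(1) by (simp add: Lp_bound_def S_def[symmetric])
    qed
    then have "cmod (LINT x|M. G x * k x) \<le> K" by (rule le)
    moreover have "G x * k x = complex_of_real (cmod (G x) powr r / N powr (r - 1))" for x
    proof -
      have "G x * k x = complex_of_real (cmod (G x) * cmod (G x) powr (r - 1) / N powr (r - 1))"
        using mult_cnj_sgn[of "G x"] by (simp add: k_def)
      also have "cmod (G x) * cmod (G x) powr (r - 1) = cmod (G x) powr r"
        by (metis add.commute diff_add_cancel norm_ge_zero powr_mult_base)
      finally show ?thesis .
    qed
    ultimately have "S / N powr (r - 1) \<le> K"
      using S N by (simp add: integral_complex_of_real S_def[symmetric] norm_divide)
    moreover have "S / N powr (r - 1) = N" using N by (simp add: SN powr_diff)
    ultimately have "N \<le> K" by simp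
    then show ?thesis unfolding SN using N r by (intro powr_mono2) auto
  qed simp
  then show ?thesis using i K fin by (simp add: Lp_bound_def S_def r_def)
qed

section \<open>Finite lists as functions on a counting measure\<close>

lemma lnorm_nonneg: "0 \<le> lnorm s cs"
  by (simp add: lnorm_def)

lemma semifinite_count_space: "finite A \<Longrightarrow> semifinite (count_space A)"
  unfolding semifinite_def by (auto simp: emeasure_count_space finite_subset split: if_splits)

text \<open>This transfers Hoelder's inequality and duality to \<open>lnorm\<close>. Indexing by
  positions lets repeated entries count with multiplicity.\<close>

lemma lnorm_le_iff:
  assumes "1 \<le> s" "0 \<le> K"
  shows "lnorm s (map f [0..<n]) \<le> K \<longleftrightarrow> Lp_bound s (count_space {..<n}) f K"
proof (cases "s = \<infinity>")
  case True
  then show ?thesis using assms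
    by (auto simp: lnorm_def Lp_bound_def AE_count_space)
next
  case False
  have "(\<Sum>c\<leftarrow>map f [0..<n]. cmod c powr enn2real s) = (LINT i|count_space {..<n}. cmod (f i) powr enn2real s)"
    unfolding map_map comp_def interv_sum_list_conv_sum_set_nat
    by (simp add: lebesgue_integral_count_space_finite atLeast0LessThan)
  then show ?thesis
    using assms False enn2real_ge_1[OF assms(1) False]
    by (auto simp: lnorm_def Lp_bound_def powr_inverse_le_iff integrable_count_space)
qed

lemma lnorm_dual:
  assumes s: "1 \<le> s" and K: "0 \<le> K"
    and le: "\<And>k. lnorm (conj_exp s) (map k [0..<n]) \<le> 1 \<Longrightarrow> cmod (\<Sum>i<n. f i * k i) \<le> K"
  shows "lnorm s (map f [0..<n]) \<le> K"
proof -
  have "Lp_bound s (count_space {..<n}) f (lnorm s (map f [0..<n]))"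
    using lnorm_le_iff[OF s lnorm_nonneg] by blast
  then have "f \<in> vecs (Lp s (count_space {..<n}))" using s vecs_Lp_iff by blast
  then have "Lp_bound s (count_space {..<n}) f K"
  proof (intro Lp_bound_dual semifinite_count_space s K)
    fix k assume "Lp_bound (conj_exp s) (count_space {..<n}) k 1"
    then have "cmod (\<Sum>i<n. f i * k i) \<le> K"
      by (intro le) (simp add: lnorm_le_iff conj_exp_ge_1 s)
    then show "cmod (LINT x|count_space {..<n}. f x * k x) \<le> K"
      by (simp add: lebesgue_integral_count_space_finite)
  qed auto
  then show ?thesis using lnorm_le_iff s K by blast
qed

lemma Holder3_list:
  assumes pqr: "1 \<le> p" "1 \<le> q" "1 \<le> r" "iexp p + iexp q + iexp r = 1"
  shows "(\<Sum>t\<leftarrow>ts. cmod (f t * g t * h t)) \<le> lnorm p (map f ts) * lnorm q (map g ts) * lnorm r (map h ts)"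
proof -
  let ?n = "length ts" let ?M = "count_space {..<?n}"
  have *: "Lp_bound s ?M (\<lambda>i. u (ts ! i)) (lnorm s (map u ts))" if "1 \<le> s" for s u
  proof -
    have "map u ts = map (\<lambda>i. u (ts ! i)) [0..<?n]" by (rule nth_equalityI) auto
    then show ?thesis using lnorm_le_iff[OF that lnorm_nonneg] by (metis order_refl)
  qed
  have "(\<Sum>t\<leftarrow>ts. cmod (f t * g t * h t)) = (LINT i|?M. cmod (f (ts ! i) * g (ts ! i) * h (ts ! i)))"
    by (simp add: sum_list_sum_nth atLeast0LessThan lebesgue_integral_count_space_finite)
  also have "\<dots> \<le> lnorm p (map f ts) * lnorm q (map g ts) * lnorm r (map h ts)"
    by (intro Holder3(2)[OF pqr] * pqr)
  finally show ?thesis .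
qed

lemma lnorm_le_iff_sum:
  assumes "1 \<le> p" "0 \<le> K"
  shows "lnorm p (map f [0..<n]) \<le> K \<longleftrightarrow>
    (if p = \<infinity> then \<forall>k<n. cmod (f k) \<le> K else (\<Sum>k<n. cmod (f k) powr enn2real p) \<le> K powr enn2real p)"
  using assms by (auto simp: lnorm_le_iff Lp_bound_def AE_count_space lebesgue_integral_count_space_finite
    integrable_count_space)

section \<open>The kernel operator\<close>

text \<open>f differs from g only inside a null set, all of whose subsets are measurable for the
  completion.\<close>

lemma borel_measurable_completion_AE:
  assumes g: "g \<in> borel_measurable M" and ae: "AE x in M. f x = g x"
  shows "f \<in> borel_measurable (completion M)"
proof (rule measurableI)
  fix A :: "'b set" assume A: "A \<in> sets borel"
  obtain N where N: "N \<in> null_sets M" "{x\<in>space M. f x \<noteq> g x} \<subseteq> N"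
    using ae by (auto simp: eventually_ae_filter)
  have "f -` A \<inter> space M = (g -` A \<inter> space M - N) \<union> (f -` A \<inter> space M \<inter> N)"
    using N by auto
  moreover have "g -` A \<inter> space M - N \<in> sets M"
    using measurable_sets[OF g A] N by auto
  ultimately show "f -` A \<inter> space (completion M) \<in> sets (completion M)"
    using N by (intro sets_completionI[of _ "g -` A \<inter> space M - N" "f -` A \<inter> space M \<inter> N" N M]) auto
qed simp

lemma completion_ex_borel_measurable_complex:
  fixes f :: "'a \<Rightarrow> complex"
  assumes f: "f \<in> borel_measurable (completion M)"
  shows "\<exists>g\<in>borel_measurable M. AE x in M. f x = g x"
proof -
  obtain a where a: "a \<in> borel_measurable M" "AE x in M. Re (f x) = a x"
    using completion_ex_borel_measurable_real[of "\<lambda>x. Re (f x)" M] f by auto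
  obtain b where b: "b \<in> borel_measurable M" "AE x in M. Im (f x) = b x"
    using completion_ex_borel_measurable_real[of "\<lambda>x. Im (f x)" M] f by auto
  have "(\<lambda>x. Complex (a x) (b x)) \<in> borel_measurable M"
    using a(1) b(1) unfolding borel_measurable_complex_iff complex.sel by simp
  moreover have "AE x in M. f x = Complex (a x) (b x)"
    using a(2) b(2) by eventually_elim (simp add: complex_eq_iff)
  ultimately show ?thesis by (intro bexI[of _ "\<lambda>x. Complex (a x) (b x)"])
qed

lemma finite_measure_restrict:
  assumes "E \<in> sets M" "emeasure M E < \<infinity>" shows "finite_measure (restrict_space M E)"
  using assms by (intro finite_measureI) (simp add: emeasure_restrict_space space_restrict_space2)

text \<open>A function measurable for the completed product may have nonmeasurable sections. On a
  rectangle of finite measure it is replaced by a product-measurable \<psi>, truncated at C so that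
  the bound holds everywhere; Fubini for null sets compares almost all sections.\<close>

lemma rectangle_kernel:
  fixes \<phi> :: "'a \<times> 'b \<Rightarrow> complex"
  assumes E: "E \<in> sets M" "emeasure M E < \<infinity>" and F: "F \<in> sets N" "emeasure N F < \<infinity>"
    and m: "\<phi> \<in> borel_measurable (completion (restrict_space M E \<Otimes>\<^sub>M restrict_space N F))"
    and b: "AE z in completion (restrict_space M E \<Otimes>\<^sub>M restrict_space N F). cmod (\<phi> z) \<le> C" and C: "0 \<le> C"
  shows "\<exists>\<psi>\<in>borel_measurable (restrict_space M E \<Otimes>\<^sub>M restrict_space N F). (\<forall>z. cmod (\<psi> z) \<le> C) \<and>
    (AE t in N. t \<in> F \<longrightarrow> (AE s in M. s \<in> E \<longrightarrow> \<phi> (s, t) = \<psi> (s, t)))"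
proof -
  let ?M = "restrict_space M E" and ?N = "restrict_space N F"
  interpret EM: finite_measure ?M using finite_measure_restrict E by blast
  interpret FN: finite_measure ?N using finite_measure_restrict F by blast
  interpret P: pair_sigma_finite ?M ?N ..
  interpret Q: pair_sigma_finite ?N ?M ..
  obtain g where [measurable]: "g \<in> borel_measurable (?M \<Otimes>\<^sub>M ?N)" and g: "AE z in ?M \<Otimes>\<^sub>M ?N. \<phi> z = g z"
    using completion_ex_borel_measurable_complex[OF m] by blast
  define \<psi> where "\<psi> z = (if cmod (g z) \<le> C then g z else 0)" for z
  have [measurable]: "\<psi> \<in> borel_measurable (?M \<Otimes>\<^sub>M ?N)" unfolding \<psi>_def by measurable
  have "AE z in ?M \<Otimes>\<^sub>M ?N. \<phi> z = \<psi> z"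
    using g b unfolding AE_completion_iff by eventually_elim (auto simp: \<psi>_def)
  \<comment> \<open>The coordinates are swapped because \<open>AE_pair\<close> fixes the first one,
    while here t is the fixed one.\<close>
  then have "AE z in distr (?N \<Otimes>\<^sub>M ?M) (?M \<Otimes>\<^sub>M ?N) (\<lambda>(x, y). (y, x)). \<phi> z = \<psi> z"
    by (subst P.distr_pair_swap[symmetric])
  from AE_distrD[OF measurable_pair_swap' this]
  have "AE z in ?N \<Otimes>\<^sub>M ?M. \<phi> (snd z, fst z) = \<psi> (snd z, fst z)"
    by (simp add: case_prod_beta)
  from Q.AE_pair[OF this] have "AE t in ?N. AE s in ?M. \<phi> (s, t) = \<psi> (s, t)" by simp
  then have "AE t in N. t \<in> F \<longrightarrow> (AE s in M. s \<in> E \<longrightarrow> \<phi> (s, t) = \<psi> (s, t))"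
    using E F by (simp add: AE_restrict_space_iff sets.Int_space_eq2)
  moreover have "\<forall>z. cmod (\<psi> z) \<le> C" using C by (auto simp: \<psi>_def)
  ultimately show ?thesis by (intro bexI[of _ \<psi>]) auto
qed

lemma Lp_1_iff: "f \<in> vecs (Lp 1 M) \<longleftrightarrow> integrable M f"
  using integrable_norm_iff[of f M] by (auto simp: Lp_def)

lemma nrm_Lp_1: "nrm (Lp 1 M) f = (LINT x|M. cmod (f x))"
  by (simp add: Lp_def)

text \<open>An integrable w vanishes off a countable union of sets \<open>E n\<close> of finite
  measure, whatever the size of the space. On each \<open>E n\<close> the kernel has a measurable
  version, and dominated convergence with majorant C |w| passes to the limit.\<close>

lemma kernel_sections:
  fixes \<phi> :: "'a \<times> 'b \<Rightarrow> complex" and w :: "'a \<Rightarrow> complex"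
  assumes \<phi>: "\<And>E F. E \<in> sets M \<Longrightarrow> F \<in> sets N \<Longrightarrow> emeasure M E < \<infinity> \<Longrightarrow> emeasure N F < \<infinity> \<Longrightarrow>
        \<phi> \<in> borel_measurable (completion (restrict_space M E \<Otimes>\<^sub>M restrict_space N F)) \<and>
        (AE z in completion (restrict_space M E \<Otimes>\<^sub>M restrict_space N F). cmod (\<phi> z) \<le> C)"
    and C: "0 \<le> C" and w: "integrable M w" and F: "F \<in> sets N" "emeasure N F < \<infinity>"
  shows "AE t in N. t \<in> F \<longrightarrow> integrable (completion M) (\<lambda>s. \<phi> (s, t) * w s)"
    and "AE t in N. t \<in> F \<longrightarrow> cmod (LINT s|completion M. \<phi> (s, t) * w s) \<le> C * (LINT s|M. cmod (w s))"
    and "\<exists>g\<in>borel_measurable N. AE t in N. t \<in> F \<longrightarrow> g t = (LINT s|completion M. \<phi> (s, t) * w s)"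
proof -
  have [measurable]: "w \<in> borel_measurable M" using w by simp
  define E where "E n = {s \<in> space M. 1 / Suc n \<le> cmod (w s)}" for n :: nat
  have E[measurable]: "E n \<in> sets M" for n unfolding E_def by measurable
  have Efin: "emeasure M (E n) < \<infinity>" for n
  proof -
    have "integrable M (\<lambda>s. indicator (E n) s :: real)"
    proof (rule Bochner_Integration.integrable_bound)
      show "integrable M (\<lambda>s. Suc n * cmod (w s))" using w by auto
      show "AE s in M. norm (indicator (E n) s :: real) \<le> norm (Suc n * cmod (w s))"
        by (auto simp: E_def indicator_def field_simps)
    qed measurable
    then show ?thesis using E by (simp add: integrable_indicator_iff)
  qed
  have "\<forall>n. \<exists>\<psi>. \<psi> \<in> borel_measurable (restrict_space M (E n) \<Otimes>\<^sub>M restrict_space N F) \<and> (\<forall>z. cmod (\<psi> z) \<le> C) \<and>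
    (AE t in N. t \<in> F \<longrightarrow> (AE s in M. s \<in> E n \<longrightarrow> \<phi> (s, t) = \<psi> (s, t)))"
    using rectangle_kernel[OF E Efin F _ _ C] \<phi>[OF E F(1) Efin F(2)] by blast
  from choice[OF this] obtain \<psi> where \<psi>[measurable]: "\<And>n. \<psi> n \<in> borel_measurable (restrict_space M (E n) \<Otimes>\<^sub>M restrict_space N F)"
    and \<psi>C: "\<And>n z. cmod (\<psi> n z) \<le> C"
    and "\<And>n. AE t in N. t \<in> F \<longrightarrow> (AE s in M. s \<in> E n \<longrightarrow> \<phi> (s, t) = \<psi> n (s, t))"
    by blast
  then have "AE t in N. \<forall>n. t \<in> F \<longrightarrow> (AE s in M. s \<in> E n \<longrightarrow> \<phi> (s, t) = \<psi> n (s, t))"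
    unfolding AE_all_countable by blast
  then have ae: "AE t in N. t \<in> F \<longrightarrow> (AE s in M. \<forall>n. s \<in> E n \<longrightarrow> \<phi> (s, t) = \<psi> n (s, t))"
    by eventually_elim (simp add: AE_all_countable)
  define \<rho> where "\<rho> n t s = indicator (E n) s *\<^sub>R (\<psi> n (s, t) * w s)" for n t s
  define I where "I n t = (LINT s|M. \<rho> n t s)" for n t
  have \<rho>m: "\<rho> n t \<in> borel_measurable M" if t: "t \<in> F" for n t
  proof -
    have "t \<in> space (restrict_space N F)" using t F by (simp add: space_restrict_space2)
    then have "(\<lambda>s. \<psi> n (s, t)) \<in> borel_measurable (restrict_space M (E n))"
      by measurable
    moreover have "w \<in> borel_measurable (restrict_space M (E n))"
      by (rule measurable_restrict_space1) measurable
    ultimately have "(\<lambda>s. \<psi> n (s, t) * w s) \<in> borel_measurable (restrict_space M (E n))" by simp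
    then show ?thesis unfolding \<rho>_def
      by (subst borel_measurable_restrict_space_iff[symmetric]) (auto simp: E)
  qed
  have key: "integrable (completion M) (\<lambda>s. \<phi> (s, t) * w s) \<and>
      cmod (LINT s|completion M. \<phi> (s, t) * w s) \<le> C * (LINT s|M. cmod (w s)) \<and>
      (\<lambda>n. I n t) \<longlonglongrightarrow> (LINT s|completion M. \<phi> (s, t) * w s)"
    if t: "t \<in> F" and ae: "AE s in M. \<forall>n. s \<in> E n \<longrightarrow> \<phi> (s, t) = \<psi> n (s, t)" for t
  proof -
    \<comment> \<open>A measurable version of the section times w, which itself is measurable only
      for the completion.\<close>
    define \<sigma> where "\<sigma> s = lim (\<lambda>n. \<rho> n t s)" for s
    have \<sigma>m: "\<sigma> \<in> borel_measurable M" unfolding \<sigma>_def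
      using \<rho>m[OF t] by (rule borel_measurable_lim_metric)
    have conv: "AE s in M. (\<lambda>n. \<rho> n t s) \<longlonglongrightarrow> \<phi> (s, t) * w s"
      using ae AE_space
    proof eventually_elim
      case (elim s)
      show ?case
      proof (cases "w s = 0")
        case True then show ?thesis by (simp add: \<rho>_def)
      next
        case False
        then obtain m :: nat where m: "inverse (Suc m) < cmod (w s)"
          using reals_Archimedean by (metis zero_less_norm_iff)
        have "\<rho> n t s = \<phi> (s, t) * w s" if "n \<ge> m" for n
        proof -
          have "1 / Suc n \<le> 1 / Suc m" using that by (simp add: field_simps)
          then have "s \<in> E n" using m elim by (simp add: E_def inverse_eq_divide)
          then show ?thesis using elim by (simp add: \<rho>_def)
        qed
        then have "eventually (\<lambda>n. \<rho> n t s = \<phi> (s, t) * w s) sequentially"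
          unfolding eventually_sequentially by blast
        then show ?thesis by (rule tendsto_eventually)
      qed
    qed
    then have \<sigma>: "AE s in M. \<phi> (s, t) * w s = \<sigma> s"
      by eventually_elim (simp add: \<sigma>_def limI)
    have fm: "(\<lambda>s. \<phi> (s, t) * w s) \<in> borel_measurable (completion M)"
      by (rule borel_measurable_completion_AE[OF \<sigma>m \<sigma>])
    have conv': "AE s in M. (\<lambda>n. \<rho> n t s) \<longlonglongrightarrow> \<sigma> s"
      using conv \<sigma> by eventually_elim simp
    have bd: "AE s in M. cmod (\<rho> n t s) \<le> C * cmod (w s)" for n
      using \<psi>C C by (auto simp: \<rho>_def norm_mult indicator_def intro!: mult_right_mono)
    have iw: "integrable M (\<lambda>s. C * cmod (w s))" using w by auto
    have i\<sigma>: "integrable M \<sigma>"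
      by (rule integrable_dominated_convergence[OF \<sigma>m \<rho>m[OF t] iw conv' bd])
    have lim: "(\<lambda>n. LINT s|M. \<rho> n t s) \<longlonglongrightarrow> (LINT s|M. \<sigma> s)"
      by (rule integral_dominated_convergence[OF \<sigma>m \<rho>m[OF t] iw conv' bd])
    have eq: "(LINT s|completion M. \<phi> (s, t) * w s) = (LINT s|M. \<sigma> s)"
      using \<sigma> \<sigma>m fm
      by (subst integral_completion[OF \<sigma>m, symmetric])
        (intro integral_cong_AE, auto simp: AE_completion_iff intro: measurable_completion)
    have "integrable (completion M) \<sigma>" using i\<sigma> \<sigma>m by (simp add: integrable_completion)
    then have 1: "integrable (completion M) (\<lambda>s. \<phi> (s, t) * w s)"
      using \<sigma> \<sigma>m fm
      by (subst integrable_cong_AE[where g=\<sigma>]) (auto simp: AE_completion_iff intro: measurable_completion)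
    have "cmod (LINT s|M. \<rho> n t s) \<le> C * (LINT s|M. cmod (w s))" for n
    proof -
      have "integrable M (\<rho> n t)"
        by (rule Bochner_Integration.integrable_bound[OF iw \<rho>m[OF t]])
          (use bd[of n] in eventually_elim, simp add: C)
      then have "(LINT s|M. cmod (\<rho> n t s)) \<le> (LINT s|M. C * cmod (w s))"
        using bd iw by (intro integral_mono_AE) auto
      then have "(LINT s|M. cmod (\<rho> n t s)) \<le> C * (LINT s|M. cmod (w s))" by simp
      then show ?thesis by (rule order_trans[OF integral_norm_bound])
    qed
    then have 2: "cmod (LINT s|M. \<sigma> s) \<le> C * (LINT s|M. cmod (w s))"
      by (intro LIMSEQ_le_const2[OF tendsto_norm[OF lim]]) auto
    show ?thesis using 1 2 lim unfolding eq I_def by blast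
  qed
  show "AE t in N. t \<in> F \<longrightarrow> integrable (completion M) (\<lambda>s. \<phi> (s, t) * w s)"
    using ae by eventually_elim (use key in auto)
  show "AE t in N. t \<in> F \<longrightarrow> cmod (LINT s|completion M. \<phi> (s, t) * w s) \<le> C * (LINT s|M. cmod (w s))"
    using ae by eventually_elim (use key in auto)
  \<comment> \<open>Cut off to F, since \<open>I n\<close> is measurable only there.\<close>
  define J where "J n t = indicator F t *\<^sub>R I n t" for n t
  have Jm: "J n \<in> borel_measurable N" for n
  proof -
    let ?M = "restrict_space M (E n)" and ?N = "restrict_space N F"
    interpret finite_measure ?M using finite_measure_restrict E Efin by blast
    have "w \<in> borel_measurable ?M" by (rule measurable_restrict_space1) measurable
    then have "(\<lambda>(t, s). \<psi> n (s, t) * w s) \<in> borel_measurable (?N \<Otimes>\<^sub>M ?M)" by measurable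
    then have "(\<lambda>t. LINT s|?M. \<psi> n (s, t) * w s) \<in> borel_measurable ?N"
      by (rule borel_measurable_lebesgue_integral)
    moreover have "(\<lambda>t. LINT s|?M. \<psi> n (s, t) * w s) = I n"
      by (simp add: I_def \<rho>_def integral_restrict_space E fun_eq_iff)
    ultimately show ?thesis unfolding J_def
      using F by (subst borel_measurable_restrict_space_iff[symmetric]) auto
  qed
  show "\<exists>g\<in>borel_measurable N. AE t in N. t \<in> F \<longrightarrow> g t = (LINT s|completion M. \<phi> (s, t) * w s)"
  proof (rule bexI)
    show "(\<lambda>t. lim (\<lambda>n. J n t)) \<in> borel_measurable N"
      using Jm by (rule borel_measurable_lim_metric)
    show "AE t in N. t \<in> F \<longrightarrow> lim (\<lambda>n. J n t) = (LINT s|completion M. \<phi> (s, t) * w s)"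
      using ae
    proof eventually_elim
      case (elim t)
      show ?case
      proof
        assume t: "t \<in> F"
        then have "(\<lambda>n. J n t) \<longlonglongrightarrow> (LINT s|completion M. \<phi> (s, t) * w s)"
          using key elim by (simp add: J_def)
        then show "lim (\<lambda>n. J n t) = (LINT s|completion M. \<phi> (s, t) * w s)" by (rule limI)
      qed
    qed
  qed
qed

text \<open>G agrees with measurable functions only piecewise. The level sets G > q are glued
  instead, as essential suprema \<open>H q\<close> of their parts of finite measure, and the
  function is recovered as the supremum of the rational q with t in \<open>H q\<close>.\<close>

lemma localizable_patch_real:
  fixes G :: "'b \<Rightarrow> real"
  assumes loc: "localizable N"
    and ex: "\<And>F. F \<in> sets N \<Longrightarrow> emeasure N F < \<infinity> \<Longrightarrow> \<exists>g\<in>borel_measurable N. AE t in N. t \<in> F \<longrightarrow> g t = G t"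
  shows "\<exists>g\<in>borel_measurable N. \<forall>F\<in>sets N. emeasure N F < \<infinity> \<longrightarrow> (AE t in N. t \<in> F \<longrightarrow> g t = G t)"
proof -
  define \<E> where "\<E> q = {E \<in> sets N. emeasure N E < \<infinity> \<and> (AE t in N. t \<in> E \<longrightarrow> G t > q)}" for q
  have "\<exists>H\<in>sets N. (\<forall>E\<in>\<E> q. E - H \<in> null_sets N) \<and>
           (\<forall>G\<in>sets N. (\<forall>E\<in>\<E> q. E - G \<in> null_sets N) \<longrightarrow> H - G \<in> null_sets N)" for q
  proof -
    have "\<E> q \<subseteq> sets N" by (auto simp: \<E>_def)
    then show ?thesis using loc unfolding localizable_def by blast
  qed
  then obtain H where Hm[measurable]: "\<And>q. H q \<in> sets N"
    and H1: "\<And>q E. E \<in> \<E> q \<Longrightarrow> E - H q \<in> null_sets N"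
    and H2: "\<And>q G. G \<in> sets N \<Longrightarrow> (\<And>E. E \<in> \<E> q \<Longrightarrow> E - G \<in> null_sets N) \<Longrightarrow> H q - G \<in> null_sets N"
    by metis
  \<comment> \<open>Minimality of the essential supremum \<open>H q\<close> is used against the competitor that omits \<open>{t \<in> F. G t \<le> q}\<close>.\<close>
  have HG: "AE t in N. t \<in> F \<longrightarrow> (t \<in> H q \<longleftrightarrow> G t > q)"
    if F: "F \<in> sets N" "emeasure N F < \<infinity>" for F and q :: real
  proof -
    obtain g where [measurable]: "g \<in> borel_measurable N" and g: "AE t in N. t \<in> F \<longrightarrow> g t = G t"
      using ex[OF F] by blast
    note F(1)[measurable]
    define A where "A = {t \<in> space N. t \<in> F \<and> g t > q}"
    define B where "B = {t \<in> space N. t \<in> F \<and> \<not> g t > q}"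
    have m[measurable]: "A \<in> sets N" "B \<in> sets N" unfolding A_def B_def by measurable
    have "emeasure N A \<le> emeasure N F" using F m by (intro emeasure_mono) (auto simp: A_def)
    then have "A \<in> \<E> q" using F m g by (auto simp: \<E>_def A_def elim!: eventually_mono)
    then have a: "A - H q \<in> null_sets N" by (rule H1)
    have b: "H q - (space N - B) \<in> null_sets N"
    proof (rule H2)
      fix E assume E: "E \<in> \<E> q"
      have "AE t in N. t \<notin> E - (space N - B)"
        using g E unfolding \<E>_def by (auto elim!: eventually_elim2 simp: B_def)
      then show "E - (space N - B) \<in> null_sets N"
        using E by (subst AE_iff_null_sets) (auto simp: \<E>_def)
    qed measurable
    show ?thesis using AE_not_in[OF a] AE_not_in[OF b] g AE_space
      by eventually_elim (auto simp: A_def B_def)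
  qed
  \<comment> \<open>Extended reals, because off the sets of finite measure the levels are
    uncontrolled; \<open>real_of_ereal\<close> sends infinite values to 0.\<close>
  define s where "s t = (SUP q\<in>\<rat>. if t \<in> H q then ereal q else -\<infinity>)" for t
  have [measurable]: "s \<in> borel_measurable N" unfolding s_def
    by (intro borel_measurable_SUP countable_rat) measurable
  show ?thesis
  proof (intro bexI ballI impI)
    show "(\<lambda>t. real_of_ereal (s t)) \<in> borel_measurable N" by measurable
    fix F assume F: "F \<in> sets N" "emeasure N F < \<infinity>"
    have "AE t in N. \<forall>q\<in>\<rat>. t \<in> F \<longrightarrow> (t \<in> H q \<longleftrightarrow> G t > q)"
      unfolding AE_ball_countable[OF countable_rat] using HG[OF F] by blast
    then show "AE t in N. t \<in> F \<longrightarrow> real_of_ereal (s t) = G t"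
    proof eventually_elim
      case (elim t)
      show ?case
      proof
        assume t: "t \<in> F"
        have "s t = ereal (G t)" unfolding s_def
        proof (rule antisym)
          show "(SUP q\<in>\<rat>. if t \<in> H q then ereal q else -\<infinity>) \<le> ereal (G t)"
            using elim t by (intro SUP_least) auto
          show "ereal (G t) \<le> (SUP q\<in>\<rat>. if t \<in> H q then ereal q else -\<infinity>)"
          proof (rule dense_le)
            fix y assume "y < ereal (G t)"
            then obtain q where q: "q \<in> \<rat>" "y < ereal q" "q < G t"
            proof (cases y)
              case (real r)
              then show ?thesis using \<open>y < ereal (G t)\<close> Rats_dense_in_real[of r "G t"] that by auto
            next
              case MInf
              then show ?thesis using Rats_dense_in_real[of "G t - 1" "G t"] that by auto
            qed auto
            then have "(if t \<in> H q then ereal q else -\<infinity>) \<le> (SUP q\<in>\<rat>. if t \<in> H q then ereal q else -\<infinity>)"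
              by (intro SUP_upper)
            then show "y \<le> (SUP q\<in>\<rat>. if t \<in> H q then ereal q else -\<infinity>)"
              using q elim t by auto
          qed
        qed
        then show "real_of_ereal (s t) = G t" by simp
      qed
    qed
  qed
qed

lemma localizable_semifinite: "localizable M \<Longrightarrow> semifinite M"
  by (simp add: localizable_def semifinite_def)

text \<open>An exceptional set that is not null would contain a set of finite positive measure. This
  turns relations known on sets of finite measure into global ones.\<close>

lemma AE_semifinite:
  assumes sf: "semifinite N" and [measurable]: "Measurable.pred N P"
    and F: "\<And>F. F \<in> sets N \<Longrightarrow> emeasure N F < \<infinity> \<Longrightarrow> AE t in N. t \<in> F \<longrightarrow> P t"
  shows "AE t in N. P t"
proof -
  let ?A = "{t \<in> space N. \<not> P t}"
  have A: "?A \<in> sets N" by measurable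
  have "emeasure N ?A = 0"
  proof (rule ccontr)
    assume "emeasure N ?A \<noteq> 0"
    then obtain B where B: "B \<in> sets N" "B \<subseteq> ?A" "0 < emeasure N B" "emeasure N B < \<infinity>"
      using semifinite_obtain[OF sf A] by (auto simp: zero_less_iff_neq_zero)
    then have "AE t in N. t \<notin> B" using F[OF B(1,4)] by (auto elim!: eventually_mono)
    then have "emeasure N B = 0" using B(1) by (simp add: AE_iff_null_sets null_setsD1)
    then show False using B(3) by simp
  qed
  then show ?thesis using A by (subst AE_iff_measurable[OF _ refl]) auto
qed

lemma localizable_patch_complex:
  fixes G :: "'b \<Rightarrow> complex"
  assumes loc: "localizable N"
    and ex: "\<And>F. F \<in> sets N \<Longrightarrow> emeasure N F < \<infinity> \<Longrightarrow> \<exists>g\<in>borel_measurable N. AE t in N. t \<in> F \<longrightarrow> g t = G t"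
  shows "\<exists>g\<in>borel_measurable N. \<forall>F\<in>sets N. emeasure N F < \<infinity> \<longrightarrow> (AE t in N. t \<in> F \<longrightarrow> g t = G t)"
proof -
  have "\<exists>g\<in>borel_measurable N. AE t in N. t \<in> F \<longrightarrow> g t = Re (G t)"
    "\<exists>g\<in>borel_measurable N. AE t in N. t \<in> F \<longrightarrow> g t = Im (G t)"
    if F: "F \<in> sets N" "emeasure N F < \<infinity>" for F
  proof -
    obtain g where g: "g \<in> borel_measurable N" "AE t in N. t \<in> F \<longrightarrow> g t = G t" using ex[OF F] by blast
    have "(\<lambda>t. Re (g t)) \<in> borel_measurable N" "(\<lambda>t. Im (g t)) \<in> borel_measurable N"
      using g(1) by measurable
    moreover have "AE t in N. t \<in> F \<longrightarrow> Re (g t) = Re (G t)" "AE t in N. t \<in> F \<longrightarrow> Im (g t) = Im (G t)"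
      using g(2) by (auto elim!: eventually_mono)
    ultimately show "\<exists>g\<in>borel_measurable N. AE t in N. t \<in> F \<longrightarrow> g t = Re (G t)"
      "\<exists>g\<in>borel_measurable N. AE t in N. t \<in> F \<longrightarrow> g t = Im (G t)" by (auto intro: bexI[rotated])
  qed
  from localizable_patch_real[OF loc this(1)] localizable_patch_real[OF loc this(2)]
  obtain a b where a: "a \<in> borel_measurable N" "\<And>F. F\<in>sets N \<Longrightarrow> emeasure N F < \<infinity> \<Longrightarrow> AE t in N. t \<in> F \<longrightarrow> a t = Re (G t)"
    and b: "b \<in> borel_measurable N" "\<And>F. F\<in>sets N \<Longrightarrow> emeasure N F < \<infinity> \<Longrightarrow> AE t in N. t \<in> F \<longrightarrow> b t = Im (G t)"
    by auto
  have "(\<lambda>t. Complex (a t) (b t)) \<in> borel_measurable N"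
    using a(1) b(1) unfolding borel_measurable_complex_iff complex.sel by simp
  moreover have "\<forall>F\<in>sets N. emeasure N F < \<infinity> \<longrightarrow> (AE t in N. t \<in> F \<longrightarrow> Complex (a t) (b t) = G t)"
  proof (intro ballI impI)
    fix F assume "F \<in> sets N" "emeasure N F < \<infinity>"
    from a(2)[OF this] b(2)[OF this] show "AE t in N. t \<in> F \<longrightarrow> Complex (a t) (b t) = G t"
      by eventually_elim (simp add: complex_eq_iff)
  qed
  ultimately show ?thesis by (intro bexI[of _ "\<lambda>t. Complex (a t) (b t)"])
qed

locale bounded_kernel =
  fixes M :: "'a measure" and N :: "'b measure" and \<phi> :: "'a \<times> 'b \<Rightarrow> complex"
  assumes loc: "localizable N" and Linf: "\<phi> \<in> Linf_prod M N"
begin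

text \<open>Some uniform bound for |\<phi>|, chosen once. It enters boundedness and approximation
  arguments only, never the multiplier constants.\<close>

definition kernel_norm :: real where
  "kernel_norm = (SOME C. 0 \<le> C \<and> (\<forall>E\<in>sets M. \<forall>F\<in>sets N. emeasure M E < \<infinity> \<longrightarrow> emeasure N F < \<infinity> \<longrightarrow>
        \<phi> \<in> borel_measurable (completion (restrict_space M E \<Otimes>\<^sub>M restrict_space N F)) \<and>
        (AE z in completion (restrict_space M E \<Otimes>\<^sub>M restrict_space N F). cmod (\<phi> z) \<le> C)))"

lemma kernel_norm_props:
  "0 \<le> kernel_norm \<and> (\<forall>E\<in>sets M. \<forall>F\<in>sets N. emeasure M E < \<infinity> \<longrightarrow> emeasure N F < \<infinity> \<longrightarrow>
        \<phi> \<in> borel_measurable (completion (restrict_space M E \<Otimes>\<^sub>M restrict_space N F)) \<and>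
        (AE z in completion (restrict_space M E \<Otimes>\<^sub>M restrict_space N F). cmod (\<phi> z) \<le> kernel_norm))"
proof -
  obtain C where C: "\<forall>E\<in>sets M. \<forall>F\<in>sets N. emeasure M E < \<infinity> \<longrightarrow> emeasure N F < \<infinity> \<longrightarrow>
        \<phi> \<in> borel_measurable (completion (restrict_space M E \<Otimes>\<^sub>M restrict_space N F)) \<and>
        (AE z in completion (restrict_space M E \<Otimes>\<^sub>M restrict_space N F). cmod (\<phi> z) \<le> C)"
    using Linf unfolding Linf_prod_def by blast
  show ?thesis unfolding kernel_norm_def
  proof (rule someI[of _ "max C 0"], intro conjI ballI impI)
    fix E F assume EF: "E \<in> sets M" "F \<in> sets N" "emeasure M E < \<infinity>" "emeasure N F < \<infinity>"
    then show "\<phi> \<in> borel_measurable (completion (restrict_space M E \<Otimes>\<^sub>M restrict_space N F))"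
      using C by blast
    have "AE z in completion (restrict_space M E \<Otimes>\<^sub>M restrict_space N F). cmod (\<phi> z) \<le> C"
      using C EF by blast
    then show "AE z in completion (restrict_space M E \<Otimes>\<^sub>M restrict_space N F). cmod (\<phi> z) \<le> max C 0"
      by eventually_elim simp
  qed simp
qed

lemma kernel_norm_nonneg: "0 \<le> kernel_norm"
  using kernel_norm_props by blast

lemma sections:
  assumes "integrable M w" "F \<in> sets N" "emeasure N F < \<infinity>"
  shows "AE t in N. t \<in> F \<longrightarrow> integrable (completion M) (\<lambda>s. \<phi> (s, t) * w s)"
    and "AE t in N. t \<in> F \<longrightarrow> cmod (LINT s|completion M. \<phi> (s, t) * w s) \<le> kernel_norm * (LINT s|M. cmod (w s))"
    and "\<exists>g\<in>borel_measurable N. AE t in N. t \<in> F \<longrightarrow> g t = (LINT s|completion M. \<phi> (s, t) * w s)"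
  by (rule kernel_sections[of M N \<phi> kernel_norm, OF _ kernel_norm_nonneg assms], use kernel_norm_props in blast)+

lemma kernel_int_spec:
  assumes w: "integrable M w"
  shows "kernel_int M N \<phi> w \<in> vecs (Lp \<infinity> N)"
    and "\<And>F. F \<in> sets N \<Longrightarrow> emeasure N F < \<infinity> \<Longrightarrow>
      AE t in N. t \<in> F \<longrightarrow> kernel_int M N \<phi> w t = (LINT s|completion M. \<phi> (s, t) * w s)"
proof -
  let ?G = "\<lambda>t. LINT s|completion M. \<phi> (s, t) * w s" and ?K = "kernel_norm * (LINT s|M. cmod (w s))"
  obtain g where [measurable]: "g \<in> borel_measurable N"
    and g: "\<And>F. F \<in> sets N \<Longrightarrow> emeasure N F < \<infinity> \<Longrightarrow> AE t in N. t \<in> F \<longrightarrow> g t = ?G t"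
    using localizable_patch_complex[OF loc sections(3)[OF w]] by blast
  \<comment> \<open>Truncation at the bound of the sections makes g' bounded everywhere and, on each
    set of finite measure, changes g only on a null set.\<close>
  define g' where "g' t = (if cmod (g t) \<le> ?K then g t else 0)" for t
  have "0 \<le> ?K" using kernel_norm_nonneg by (intro mult_nonneg_nonneg) auto
  moreover have "g' \<in> borel_measurable N" unfolding g'_def by measurable
  ultimately have "Lp_bound \<infinity> N g' ?K" unfolding Lp_bound_def by (auto simp: g'_def)
  then have "g' \<in> vecs (Lp \<infinity> N)" by (subst vecs_Lp_iff) auto
  moreover have "\<forall>F\<in>sets N. emeasure N F < \<infinity> \<longrightarrow> (AE t in N. t \<in> F \<longrightarrow> g' t = ?G t)"
  proof (intro ballI impI)
    fix F assume F: "F \<in> sets N" "emeasure N F < \<infinity>"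
    from g[OF F] sections(2)[OF w F] show "AE t in N. t \<in> F \<longrightarrow> g' t = ?G t"
      by eventually_elim (auto simp: g'_def)
  qed
  ultimately have *: "\<exists>g. g \<in> vecs (Lp \<infinity> N) \<and> (\<forall>F\<in>sets N. emeasure N F < \<infinity> \<longrightarrow> (AE t in N. t \<in> F \<longrightarrow> g t = ?G t))"
    by (intro exI conjI)
  from someI_ex[OF this]
  show "kernel_int M N \<phi> w \<in> vecs (Lp \<infinity> N)"
    "\<And>F. F \<in> sets N \<Longrightarrow> emeasure N F < \<infinity> \<Longrightarrow> AE t in N. t \<in> F \<longrightarrow> kernel_int M N \<phi> w t = ?G t"
    unfolding kernel_int_def by auto
qed

lemma kernel_int_measurable: "integrable M w \<Longrightarrow> kernel_int M N \<phi> w \<in> borel_measurable N"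
  using kernel_int_spec(1) by (auto simp: Lp_def)

lemma kernel_int_bound:
  assumes w: "integrable M w"
  shows "Lp_bound \<infinity> N (kernel_int M N \<phi> w) (kernel_norm * (LINT s|M. cmod (w s)))"
proof -
  note [measurable] = kernel_int_measurable[OF w]
  have "AE t in N. cmod (kernel_int M N \<phi> w t) \<le> kernel_norm * (LINT s|M. cmod (w s))"
  proof (rule AE_semifinite[OF localizable_semifinite[OF loc]])
    fix F assume F: "F \<in> sets N" "emeasure N F < \<infinity>"
    from kernel_int_spec(2)[OF w F] sections(2)[OF w F]
    show "AE t in N. t \<in> F \<longrightarrow> cmod (kernel_int M N \<phi> w t) \<le> kernel_norm * (LINT s|M. cmod (w s))"
      by eventually_elim auto
  qed measurable
  then show ?thesis using kernel_norm_nonneg kernel_int_measurable[OF w] by (auto simp: Lp_bound_def)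
qed

text \<open>\<open>kernel_int\<close> is a chosen representative, so linearity holds only up to null
  sets. It is checked on sets of finite measure, where the representative is the actual
  integral.\<close>

lemma kernel_int_add:
  assumes w: "integrable M w" and v: "integrable M v"
  shows "AE t in N. kernel_int M N \<phi> (\<lambda>s. w s + v s) t = kernel_int M N \<phi> w t + kernel_int M N \<phi> v t"
proof (rule AE_semifinite[OF localizable_semifinite[OF loc]])
  have wv: "integrable M (\<lambda>s. w s + v s)" using w v by simp
  note [measurable] = kernel_int_measurable[OF w] kernel_int_measurable[OF v] kernel_int_measurable[OF wv]
  show "Measurable.pred N (\<lambda>t. kernel_int M N \<phi> (\<lambda>s. w s + v s) t = kernel_int M N \<phi> w t + kernel_int M N \<phi> v t)"
    by measurable
  fix F assume F: "F \<in> sets N" "emeasure N F < \<infinity>"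
  from kernel_int_spec(2)[OF w F] kernel_int_spec(2)[OF v F] kernel_int_spec(2)[OF wv F]
    sections(1)[OF w F] sections(1)[OF v F]
  show "AE t in N. t \<in> F \<longrightarrow> kernel_int M N \<phi> (\<lambda>s. w s + v s) t = kernel_int M N \<phi> w t + kernel_int M N \<phi> v t"
    by eventually_elim (auto simp: distrib_left)
qed

lemma kernel_int_scale:
  assumes w: "integrable M w"
  shows "AE t in N. kernel_int M N \<phi> (\<lambda>s. c * w s) t = c * kernel_int M N \<phi> w t"
proof (rule AE_semifinite[OF localizable_semifinite[OF loc]])
  have cw: "integrable M (\<lambda>s. c * w s)" using w by simp
  note [measurable] = kernel_int_measurable[OF w] kernel_int_measurable[OF cw]
  show "Measurable.pred N (\<lambda>t. kernel_int M N \<phi> (\<lambda>s. c * w s) t = c * kernel_int M N \<phi> w t)"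
    by measurable
  fix F assume F: "F \<in> sets N" "emeasure N F < \<infinity>"
  have "(LINT s|completion M. \<phi> (s, t) * (c * w s)) = c * (LINT s|completion M. \<phi> (s, t) * w s)" for t
    by (simp add: mult.left_commute flip: integral_mult_right_zero)
  with kernel_int_spec(2)[OF w F] kernel_int_spec(2)[OF cw F]
  show "AE t in N. t \<in> F \<longrightarrow> kernel_int M N \<phi> (\<lambda>s. c * w s) t = c * kernel_int M N \<phi> w t"
    by (auto elim!: eventually_elim2)
qed

section \<open>The bounded bilinear form of the kernel\<close>

abbreviation \<beta> :: "('a \<Rightarrow> complex) \<Rightarrow> ('b \<Rightarrow> complex) \<Rightarrow> complex" where
  "\<beta> \<equiv> u_op M N \<phi>"

lemma \<beta>_eq: "\<beta> x y = (LINT t|N. kernel_int M N \<phi> x t * y t)"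
  by (simp add: u_op_def Linf_functional_def)

lemma integrable_\<beta>:
  assumes x: "integrable M x" and y: "integrable N y"
  shows "integrable N (\<lambda>t. kernel_int M N \<phi> x t * y t)"
    and "cmod (\<beta> x y) \<le> kernel_norm * (LINT s|M. cmod (x s)) * (LINT t|N. cmod (y t))"
proof -
  have "Lp_bound 1 N y (LINT t|N. cmod (y t))"
    using Lp_bound_nrm[of 1 y N] y by (simp add: Lp_1_iff nrm_Lp_1)
  moreover have "Lp_bound (conj_exp 1) N (kernel_int M N \<phi> x) (kernel_norm * (LINT s|M. cmod (x s)))"
    using kernel_int_bound[OF x] by (simp add: conj_exp_def)
  ultimately show "integrable N (\<lambda>t. kernel_int M N \<phi> x t * y t)"
    "cmod (\<beta> x y) \<le> kernel_norm * (LINT s|M. cmod (x s)) * (LINT t|N. cmod (y t))"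
    unfolding \<beta>_eq using Holder[of 1 N "kernel_int M N \<phi> x" _ y] by simp_all
qed

lemma \<beta>_add_right:
  "integrable M x \<Longrightarrow> integrable N y \<Longrightarrow> integrable N z \<Longrightarrow> \<beta> x (\<lambda>t. y t + z t) = \<beta> x y + \<beta> x z"
  using integrable_\<beta>(1)[of x y] integrable_\<beta>(1)[of x z] by (simp add: \<beta>_eq distrib_left)

lemma \<beta>_scale_right: "\<beta> x (\<lambda>t. c * y t) = c * \<beta> x y"
  by (simp add: \<beta>_eq mult.left_commute flip: integral_mult_right_zero)

lemma \<beta>_add_left:
  assumes "integrable M x" "integrable M y" "integrable N z"
  shows "\<beta> (\<lambda>s. x s + y s) z = \<beta> x z + \<beta> y z"
proof -
  have xy: "integrable M (\<lambda>s. x s + y s)" using assms by simp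
  note i = integrable_\<beta>(1)[OF assms(1,3)] integrable_\<beta>(1)[OF assms(2,3)] integrable_\<beta>(1)[OF xy assms(3)]
  have "\<beta> (\<lambda>s. x s + y s) z = (LINT t|N. kernel_int M N \<phi> x t * z t + kernel_int M N \<phi> y t * z t)"
    unfolding \<beta>_eq
  proof (rule integral_cong_AE)
    show "(\<lambda>t. kernel_int M N \<phi> (\<lambda>s. x s + y s) t * z t) \<in> borel_measurable N" using i by auto
    show "(\<lambda>t. kernel_int M N \<phi> x t * z t + kernel_int M N \<phi> y t * z t) \<in> borel_measurable N" using i by auto
    show "AE t in N. kernel_int M N \<phi> (\<lambda>s. x s + y s) t * z t = kernel_int M N \<phi> x t * z t + kernel_int M N \<phi> y t * z t"
      using kernel_int_add[OF assms(1,2)] by eventually_elim (simp add: distrib_right)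
  qed
  then show ?thesis using i by (simp add: \<beta>_eq)
qed

lemma \<beta>_scale_left:
  assumes "integrable M x" "integrable N z"
  shows "\<beta> (\<lambda>s. c * x s) z = c * \<beta> x z"
proof -
  have cx: "integrable M (\<lambda>s. c * x s)" using assms by simp
  note i = integrable_\<beta>(1)[OF assms] integrable_\<beta>(1)[OF cx assms(2)]
  have "\<beta> (\<lambda>s. c * x s) z = (LINT t|N. c * (kernel_int M N \<phi> x t * z t))"
    unfolding \<beta>_eq
  proof (rule integral_cong_AE)
    show "(\<lambda>t. kernel_int M N \<phi> (\<lambda>s. c * x s) t * z t) \<in> borel_measurable N" using i by auto
    show "(\<lambda>t. c * (kernel_int M N \<phi> x t * z t)) \<in> borel_measurable N" using i by auto
    show "AE t in N. kernel_int M N \<phi> (\<lambda>s. c * x s) t * z t = c * (kernel_int M N \<phi> x t * z t)"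
      using kernel_int_scale[OF assms(1), of c] by eventually_elim simp
  qed
  then show ?thesis by (simp add: \<beta>_eq)
qed

end

section \<open>Averaging over finite partitions\<close>

text \<open>Positive finite measure makes the normalized indicators unit vectors of L^1. The union
  may be smaller than the space: up to null sets it has to cover only the supports of finitely many
  simple functions.\<close>

definition finite_partition :: "'a measure \<Rightarrow> 'a set set \<Rightarrow> bool" where
  "finite_partition M \<A> \<longleftrightarrow> finite \<A> \<and> disjoint \<A> \<and>
     (\<forall>A\<in>\<A>. A \<in> sets M \<and> 0 < emeasure M A \<and> emeasure M A < \<infinity>)"

definition mass :: "'a measure \<Rightarrow> 'a set \<Rightarrow> ('a \<Rightarrow> complex) \<Rightarrow> complex" where
  "mass M A x = (LINT s|M. indicator A s * x s)"

text \<open>Scaled to norm 1 in L^1, so that the span over a partition is an isometric copy of ell^1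
  whose coordinates are the masses.\<close>

definition unit_ind :: "'a measure \<Rightarrow> 'a set \<Rightarrow> 'a \<Rightarrow> complex" where
  "unit_ind M A = (\<lambda>s. indicator A s / complex_of_real (measure M A))"

text \<open>The conditional expectation with respect to the partition, set to zero off its
  union.\<close>

definition avg_proj :: "'a measure \<Rightarrow> 'a set set \<Rightarrow> ('a \<Rightarrow> complex) \<Rightarrow> 'a \<Rightarrow> complex" where
  "avg_proj M \<A> x = (\<lambda>s. \<Sum>A\<in>\<A>. mass M A x * unit_ind M A s)"

lemma finite_partition_sets:
  assumes "finite_partition M \<A>" "A \<in> \<A>"
  shows "A \<in> sets M" "emeasure M A < \<infinity>" "0 < measure M A"
  using assms by (auto simp: finite_partition_def measure_def enn2real_positive_iff)

lemma finite_partition_finite: "finite_partition M \<A> \<Longrightarrow> finite \<A>"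
  by (simp add: finite_partition_def)

lemma finite_partition_unique:
  "finite_partition M \<A> \<Longrightarrow> A \<in> \<A> \<Longrightarrow> B \<in> \<A> \<Longrightarrow> s \<in> A \<Longrightarrow> s \<in> B \<Longrightarrow> A = B"
  unfolding finite_partition_def disjoint_def by blast

lemma sum_indicator_partition:
  fixes c :: "'a set \<Rightarrow> 'b::{semiring_1}"
  assumes "finite_partition M \<A>"
  shows "s \<in> A \<Longrightarrow> A \<in> \<A> \<Longrightarrow> (\<Sum>B\<in>\<A>. c B * indicator B s) = c A"
    and "s \<notin> \<Union>\<A> \<Longrightarrow> (\<Sum>B\<in>\<A>. c B * indicator B s) = 0"
proof -
  assume s: "s \<in> A" "A \<in> \<A>"
  have "c B * indicator B s = (if B = A then c B else 0)" if "B \<in> \<A>" for B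
  proof (cases "s \<in> B")
    case True
    then have "A = B" using finite_partition_unique[OF assms s(2) that s(1)] by blast
    then show ?thesis using s by simp
  next
    case False
    then show ?thesis using s by (auto simp: indicator_def)
  qed
  then have "(\<Sum>B\<in>\<A>. c B * indicator B s) = (\<Sum>B\<in>\<A>. if B = A then c B else 0)"
    by (intro sum.cong) auto
  then show "(\<Sum>B\<in>\<A>. c B * indicator B s) = c A"
    using s finite_partition_finite[OF assms] by simp
next
  assume "s \<notin> \<Union>\<A>"
  then show "(\<Sum>B\<in>\<A>. c B * indicator B s) = 0"
    by (intro sum.neutral) (auto simp: indicator_def)
qed

lemma sum_indicator_le_1:
  assumes "finite_partition M \<A>"
  shows "(\<Sum>B\<in>\<A>. indicator B s) \<le> (1::real)"
  using sum_indicator_partition[OF assms, where c="\<lambda>_. 1::real" and s=s]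
  by (cases "s \<in> \<Union>\<A>") auto

lemma integrable_indicator_mult:
  fixes x :: "'a \<Rightarrow> 'b::{banach, second_countable_topology, real_normed_field}"
  assumes "integrable M x" "A \<in> sets M"
  shows "integrable M (\<lambda>s. indicator A s * x s)"
  by (rule Bochner_Integration.integrable_bound[OF assms(1)])
     (use assms in \<open>auto simp: indicator_def\<close>)

lemma integrable_unit_ind:
  assumes "A \<in> sets M" "emeasure M A < \<infinity>"
  shows "integrable M (unit_ind M A)"
proof -
  have "integrable M (\<lambda>s. complex_of_real (indicator A s) / complex_of_real (measure M A))"
    using assms by (intro integrable_divide_zero integrable_of_real) (simp add: integrable_indicator_iff)
  then show ?thesis by (simp add: unit_ind_def of_real_indicator)
qed

lemma norm_unit_ind:
  assumes "A \<in> sets M" "emeasure M A < \<infinity>" "0 < measure M A"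
  shows "(LINT s|M. cmod (unit_ind M A s)) = 1"
proof -
  have "cmod (unit_ind M A s) = indicator A s / measure M A" for s
    using assms by (simp add: unit_ind_def norm_divide indicator_def)
  then show ?thesis using assms by simp
qed

lemma mass_add: "integrable M x \<Longrightarrow> integrable M y \<Longrightarrow> A \<in> sets M \<Longrightarrow> mass M A (\<lambda>s. x s + y s) = mass M A x + mass M A y"
  by (simp add: mass_def distrib_left integrable_indicator_mult)

lemma mass_diff: "integrable M x \<Longrightarrow> integrable M y \<Longrightarrow> A \<in> sets M \<Longrightarrow> mass M A (\<lambda>s. x s - y s) = mass M A x - mass M A y"
  by (simp add: mass_def right_diff_distrib integrable_indicator_mult)

lemma mass_scale: "mass M A (\<lambda>s. c * x s) = c * mass M A x"
  by (simp add: mass_def mult.left_commute flip: integral_mult_right_zero)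

lemma norm_indicator_eq: "cmod (indicator A s) = indicator A s"
  by (simp add: indicator_def)

text \<open>Disjoint indicators sum to at most 1. Thus the masses define a contraction from L^1 to
  ell^1.\<close>

lemma sum_mass_le:
  assumes P: "finite_partition M \<A>" and x: "integrable M x"
  shows "(\<Sum>A\<in>\<A>. cmod (mass M A x)) \<le> (LINT s|M. cmod (x s))"
proof -
  have i: "integrable M (\<lambda>s. indicator A s * cmod (x s))" if "A \<in> \<A>" for A
    using finite_partition_sets(1)[OF P that] x by (intro integrable_indicator_mult) auto
  have "(\<Sum>A\<in>\<A>. cmod (mass M A x)) \<le> (\<Sum>A\<in>\<A>. LINT s|M. indicator A s * cmod (x s))"
    unfolding mass_def
    by (intro sum_mono order_trans[OF integral_norm_bound]) (simp add: norm_mult norm_indicator_eq)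
  also have "\<dots> = (LINT s|M. (\<Sum>A\<in>\<A>. indicator A s * cmod (x s)))"
    by (rule Bochner_Integration.integral_sum[symmetric]) (rule i)
  also have "\<dots> \<le> (LINT s|M. cmod (x s))"
  proof (rule integral_mono)
    show "integrable M (\<lambda>s. \<Sum>A\<in>\<A>. indicator A s * cmod (x s))" using i by auto
    show "integrable M (\<lambda>s. cmod (x s))" using x by auto
    show "(\<Sum>A\<in>\<A>. indicator A s * cmod (x s)) \<le> cmod (x s)" for s
      using mult_right_mono[OF sum_indicator_le_1[OF P, of s], of "cmod (x s)"]
      by (simp add: sum_distrib_right)
  qed
  finally show ?thesis .
qed

lemma integrable_avg_proj:
  assumes "finite_partition M \<A>" shows "integrable M (avg_proj M \<A> x)"
  unfolding avg_proj_def
  using finite_partition_sets[OF assms] by (intro Bochner_Integration.integrable_sum integrable_mult_right integrable_unit_ind) auto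

lemma norm_sum_unit_ind_le:
  assumes P: "finite_partition M \<A>"
  shows "(LINT s|M. cmod (\<Sum>A\<in>\<A>. c A * unit_ind M A s)) \<le> (\<Sum>A\<in>\<A>. cmod (c A))"
proof -
  have i: "integrable M (\<lambda>s. c A * unit_ind M A s)" if "A \<in> \<A>" for A
    using finite_partition_sets[OF P that] by (intro integrable_mult_right integrable_unit_ind) auto
  have "(LINT s|M. cmod (\<Sum>A\<in>\<A>. c A * unit_ind M A s)) \<le> (LINT s|M. (\<Sum>A\<in>\<A>. cmod (c A * unit_ind M A s)))"
    using i by (intro integral_mono norm_sum) auto
  also have "\<dots> = (\<Sum>A\<in>\<A>. LINT s|M. cmod (c A * unit_ind M A s))"
    using i by (intro Bochner_Integration.integral_sum) auto
  also have "\<dots> = (\<Sum>A\<in>\<A>. cmod (c A))"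
    using finite_partition_sets[OF P] by (intro sum.cong) (auto simp: norm_mult norm_unit_ind)
  finally show ?thesis .
qed

lemma norm_avg_proj_le:
  assumes "finite_partition M \<A>" "integrable M x"
  shows "(LINT s|M. cmod (avg_proj M \<A> x s)) \<le> (LINT s|M. cmod (x s))"
  unfolding avg_proj_def
  using norm_sum_unit_ind_le[OF assms(1)] sum_mass_le[OF assms] by (rule order_trans)

text \<open>Averaging P fixes S, which is constant on the sets, and contracts. The L^1 norm of x - P
  x is at most that of x - S plus that of P (S - x), hence the factor 2.\<close>

lemma avg_proj_error:
  assumes P: "finite_partition M \<A>" and x: "integrable M x" and S: "integrable M S"
    and const: "\<And>A. A \<in> \<A> \<Longrightarrow> \<exists>c. \<forall>s\<in>A. S s = c"
    and out: "AE s in M. s \<notin> \<Union>\<A> \<longrightarrow> S s = 0"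
  shows "(LINT s|M. cmod (x s - avg_proj M \<A> x s)) \<le> 2 * (LINT s|M. cmod (x s - S s))"
proof -
  let ?P = "avg_proj M \<A> x" and ?d = "LINT s|M. cmod (x s - S s)"
  have iP: "integrable M ?P" by (rule integrable_avg_proj[OF P])
  obtain c where c: "\<And>A s. A \<in> \<A> \<Longrightarrow> s \<in> A \<Longrightarrow> S s = c A" using const by metis
  have mS: "mass M A S = c A * measure M A" if "A \<in> \<A>" for A
  proof -
    have "mass M A S = (LINT s|M. c A * complex_of_real (indicator A s))"
      unfolding mass_def using c[OF that] by (intro Bochner_Integration.integral_cong) (auto simp: indicator_def)
    also have "\<dots> = c A * complex_of_real (LINT s|M. indicator A s)"
      by (simp only: integral_mult_right_zero integral_complex_of_real)
    finally show ?thesis using finite_partition_sets[OF P that] by simp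
  qed
  have ae: "AE s in M. S s - ?P s = (\<Sum>A\<in>\<A>. mass M A (\<lambda>s. S s - x s) * unit_ind M A s)"
    using out
  proof eventually_elim
    case (elim s)
    have "S s = (\<Sum>A\<in>\<A>. c A * indicator A s)"
    proof (cases "s \<in> \<Union>\<A>")
      case True
      then show ?thesis using sum_indicator_partition(1)[OF P, of s _ c] c by auto
    next
      case False
      then show ?thesis using sum_indicator_partition(2)[OF P, of s c] elim by auto
    qed
    also have "\<dots> = (\<Sum>A\<in>\<A>. mass M A S * unit_ind M A s)"
      using finite_partition_sets(3)[OF P] by (intro sum.cong) (force simp: mS unit_ind_def)+
    finally have "S s - ?P s = (\<Sum>A\<in>\<A>. (mass M A S - mass M A x) * unit_ind M A s)"
      by (simp add: avg_proj_def sum_subtractf left_diff_distrib)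
    also have "\<dots> = (\<Sum>A\<in>\<A>. mass M A (\<lambda>s. S s - x s) * unit_ind M A s)"
      using finite_partition_sets(1)[OF P] x S by (intro sum.cong) (auto simp: mass_diff)
    finally show ?case .
  qed
  have "(LINT s|M. cmod (S s - ?P s)) = (LINT s|M. cmod (\<Sum>A\<in>\<A>. mass M A (\<lambda>s. S s - x s) * unit_ind M A s))"
  proof (rule integral_cong_AE)
    show "(\<lambda>s. cmod (S s - ?P s)) \<in> borel_measurable M" using S iP by auto
    have "integrable M (\<lambda>s. \<Sum>A\<in>\<A>. mass M A (\<lambda>s. S s - x s) * unit_ind M A s)"
      using finite_partition_sets[OF P] by (intro Bochner_Integration.integrable_sum integrable_mult_right integrable_unit_ind) auto
    then show "(\<lambda>s. cmod (\<Sum>A\<in>\<A>. mass M A (\<lambda>s. S s - x s) * unit_ind M A s)) \<in> borel_measurable M" by auto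
    show "AE s in M. cmod (S s - ?P s) = cmod (\<Sum>A\<in>\<A>. mass M A (\<lambda>s. S s - x s) * unit_ind M A s)"
      using ae by eventually_elim simp
  qed
  also have "\<dots> \<le> (\<Sum>A\<in>\<A>. cmod (mass M A (\<lambda>s. S s - x s)))" by (rule norm_sum_unit_ind_le[OF P])
  also have "\<dots> \<le> (LINT s|M. cmod (S s - x s))"
    using x S by (intro sum_mass_le[OF P]) auto
  finally have 1: "(LINT s|M. cmod (S s - ?P s)) \<le> ?d" by (simp add: norm_minus_commute[of "S _" "x _"])
  have "(LINT s|M. cmod (x s - ?P s)) \<le> (LINT s|M. cmod (x s - S s) + cmod (S s - ?P s))"
  proof (rule integral_mono)
    show "cmod (x s - ?P s) \<le> cmod (x s - S s) + cmod (S s - ?P s)" for s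
      using norm_triangle_ineq[of "x s - S s" "S s - ?P s"] by simp
  qed (use x S iP in auto)
  also have "\<dots> = ?d + (LINT s|M. cmod (S s - ?P s))"
    using x S iP by (intro Bochner_Integration.integral_add) auto
  finally show ?thesis using 1 by simp
qed

lemma integrable_simple_approx:
  fixes x :: "'a \<Rightarrow> complex"
  assumes x: "integrable M x" and e: "0 < e"
  shows "\<exists>S. Bochner_Integration.simple_bochner_integrable M S \<and> (LINT s|M. cmod (x s - S s)) < e"
proof -
  obtain I where "has_bochner_integral M x I" using x by (auto simp: integrable.simps)
  then obtain S where S: "\<And>i. Bochner_Integration.simple_bochner_integrable M (S i)"
    and lim: "(\<lambda>i. \<integral>\<^sup>+ s. ennreal (norm (x s - S i s)) \<partial>M) \<longlonglongrightarrow> 0"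
    by (auto elim!: has_bochner_integral.cases)
  have "eventually (\<lambda>i. (\<integral>\<^sup>+ s. ennreal (norm (x s - S i s)) \<partial>M) < ennreal e) sequentially"
    using e by (intro order_tendstoD(2)[OF lim]) simp
  then obtain i where i: "(\<integral>\<^sup>+ s. ennreal (norm (x s - S i s)) \<partial>M) < ennreal e"
    by (auto simp: eventually_sequentially)
  have "integrable M (S i)"
    using has_bochner_integral_simple_bochner_integrable[OF S] by (auto simp: integrable.simps)
  then have "integrable M (\<lambda>s. norm (x s - S i s))" using x by auto
  then have "(\<integral>\<^sup>+ s. ennreal (norm (x s - S i s)) \<partial>M) = ennreal (LINT s|M. cmod (x s - S i s))"
    by (intro nn_integral_eq_integral) auto
  with i have "(LINT s|M. cmod (x s - S i s)) < e"
    by (simp add: ennreal_less_iff)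
  then show ?thesis using S by blast
qed

text \<open>The sets are the atoms generated by the level sets of all \<open>S x\<close>. Null atoms
  and atoms where every \<open>S x\<close> is 0 are dropped; an atom on which some
  \<open>S x\<close> is nonzero lies in its support, which has finite measure.\<close>

lemma partition_of_simple:
  fixes S :: "'i \<Rightarrow> 'a \<Rightarrow> complex"
  assumes X: "finite X" and S: "\<And>x. x \<in> X \<Longrightarrow> Bochner_Integration.simple_bochner_integrable M (S x)"
  shows "\<exists>\<A>. finite_partition M \<A> \<and> (\<forall>x\<in>X. (\<forall>A\<in>\<A>. \<exists>c. \<forall>s\<in>A. S x s = c) \<and>
    (AE s in M. s \<notin> \<Union>\<A> \<longrightarrow> S x s = 0))"
proof -
  have sf: "simple_function M (S x)" and sfin: "emeasure M {s\<in>space M. S x s \<noteq> 0} \<noteq> \<infinity>" if "x \<in> X" for x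
    using S[OF that] by (auto elim!: Bochner_Integration.simple_bochner_integrable.cases)
  have [measurable]: "S x \<in> borel_measurable M" if "x \<in> X" for x
    using borel_measurable_simple_function[OF sf[OF that]] .
  define cl where "cl f = {s \<in> space M. \<forall>x\<in>X. S x s = f x}" for f
  define \<C> where "\<C> = cl ` (\<Pi>\<^sub>E x\<in>X. S x ` space M)"
  have fin: "finite \<C>" unfolding \<C>_def
    by (rule finite_imageI, rule finite_PiE) (use X simple_functionD(1)[OF sf] in auto)
  have meas: "A \<in> sets M" if AC: "A \<in> \<C>" for A
  proof -
    obtain f where A: "A = cl f" using AC by (auto simp: \<C>_def)
    have "{s \<in> space M. \<forall>x\<in>X. S x s = f x} \<in> sets M"
      using X by (intro sets.sets_Collect_finite_All) auto
    then show ?thesis by (simp add: A cl_def)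
  qed
  have cover: "\<exists>A\<in>\<C>. s \<in> A" if "s \<in> space M" for s
  proof
    show "cl (\<lambda>x\<in>X. S x s) \<in> \<C>" using that by (auto simp: \<C>_def)
    show "s \<in> cl (\<lambda>x\<in>X. S x s)" using that by (auto simp: cl_def)
  qed
  have const: "S x s = S x t" if "A \<in> \<C>" "s \<in> A" "t \<in> A" "x \<in> X" for A s t x
    using that by (auto simp: \<C>_def cl_def)
  have disj: "A = B" if AB: "A \<in> \<C>" "B \<in> \<C>" and s: "s \<in> A" "s \<in> B" for A B s
  proof -
    obtain f g where fg: "A = cl f" "B = cl g" using AB by (auto simp: \<C>_def)
    have "f x = g x" if "x \<in> X" for x
      using s that unfolding fg cl_def by auto
    then show ?thesis unfolding fg cl_def by simp
  qed
  define \<A> where "\<A> = {A\<in>\<C>. 0 < emeasure M A \<and> (\<exists>x\<in>X. \<exists>s\<in>A. S x s \<noteq> 0)}"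
  have "finite_partition M \<A>"
    unfolding finite_partition_def
  proof (intro conjI ballI)
    show "finite \<A>" using fin by (simp add: \<A>_def)
    show "disjoint \<A>" unfolding disjoint_def using disj by (auto simp: \<A>_def)
    fix A assume A: "A \<in> \<A>"
    then show "A \<in> sets M" "0 < emeasure M A" using meas by (auto simp: \<A>_def)
    obtain x s where x: "x \<in> X" "s \<in> A" "S x s \<noteq> 0" using A by (auto simp: \<A>_def)
    have "A \<subseteq> space M" using A by (auto simp: \<A>_def \<C>_def cl_def)
    moreover have "S x t \<noteq> 0" if "t \<in> A" for t
      using const[of A t s x] A x that by (simp add: \<A>_def)
    ultimately have "A \<subseteq> {s\<in>space M. S x s \<noteq> 0}" by blast
    then have "emeasure M A \<le> emeasure M {s\<in>space M. S x s \<noteq> 0}"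
      using x by (intro emeasure_mono) measurable
    then show "emeasure M A < \<infinity>" using sfin[OF x(1)] by (auto simp: less_top dest: neq_top_trans)
  qed
  moreover have "\<forall>A\<in>\<A>. \<exists>c. \<forall>s\<in>A. S x s = c" if "x \<in> X" for x
  proof
    fix A assume "A \<in> \<A>"
    then have A: "A \<in> \<C>" by (simp add: \<A>_def)
    show "\<exists>c. \<forall>s\<in>A. S x s = c"
    proof (cases "A = {}")
      case False
      then obtain t where "t \<in> A" by blast
      then show ?thesis using const[OF A _ _ that] by (intro exI[of _ "S x t"] ballI)
    qed simp
  qed
  moreover have "AE s in M. s \<notin> \<Union>\<A> \<longrightarrow> S x s = 0" if "x \<in> X" for x
  proof -
    have "AE s in M. \<forall>A\<in>{A\<in>\<C>. emeasure M A = 0}. s \<notin> A"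
      using fin meas by (intro AE_finite_allI AE_not_in) auto
    then show ?thesis using AE_space
    proof eventually_elim
      case (elim s)
      obtain A where A: "A \<in> \<C>" "s \<in> A" using cover elim by blast
      then have "0 < emeasure M A" using elim by (auto simp: zero_less_iff_neq_zero)
      then show ?case using A that by (auto simp: \<A>_def)
    qed
  qed
  ultimately show ?thesis by blast
qed

lemma partition_approx:
  assumes X: "finite X" and x: "\<And>x. x \<in> X \<Longrightarrow> integrable M x" and e: "0 < e"
  shows "\<exists>\<A>. finite_partition M \<A> \<and> (\<forall>x\<in>X. (LINT s|M. cmod (x s - avg_proj M \<A> x s)) \<le> e)"
proof -
  \<comment> \<open>Half of e, to absorb the factor 2 of \<open>avg_proj_error\<close>.\<close>
  have "\<forall>x\<in>X. \<exists>S. Bochner_Integration.simple_bochner_integrable M S \<and> (LINT s|M. cmod (x s - S s)) < e / 2"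
    using integrable_simple_approx[OF x, of _ "e / 2"] e by auto
  from bchoice[OF this] obtain S where S: "\<And>x. x \<in> X \<Longrightarrow> Bochner_Integration.simple_bochner_integrable M (S x)"
    and Se: "\<And>x. x \<in> X \<Longrightarrow> (LINT s|M. cmod (x s - S x s)) < e / 2"
    by auto
  have "\<exists>\<A>. finite_partition M \<A> \<and> (\<forall>x\<in>X. (\<forall>A\<in>\<A>. \<exists>c. \<forall>s\<in>A. S x s = c) \<and>
    (AE s in M. s \<notin> \<Union>\<A> \<longrightarrow> S x s = 0))"
    by (rule partition_of_simple[OF X]) (rule S)
  then obtain \<A> where P: "finite_partition M \<A>"
    and A: "\<forall>x\<in>X. (\<forall>A\<in>\<A>. \<exists>c. \<forall>s\<in>A. S x s = c) \<and> (AE s in M. s \<notin> \<Union>\<A> \<longrightarrow> S x s = 0)"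
    by (elim exE conjE)
  have "(LINT s|M. cmod (y s - avg_proj M \<A> y s)) \<le> e" if y: "y \<in> X" for y
  proof -
    have "integrable M (S y)"
      using has_bochner_integral_simple_bochner_integrable[OF S[OF y]] by (auto simp: integrable.simps)
    from avg_proj_error[OF P x[OF y] this] A y Se[OF y] show ?thesis by fastforce
  qed
  then show ?thesis using P by blast
qed

section \<open>Pietsch domination for matrices\<close>

text \<open>Separation in finite dimension: the convex cone generated by the vectors
  \<open>g x\<close> misses the open negative orthant, so some probability vector is nonnegative on
  it. The functional is the point of least Euclidean norm in the closure of a convex set away from
  the origin.\<close>

lemma cone_separation:
  fixes g :: "'x \<Rightarrow> 'i \<Rightarrow> real"
  assumes I: "finite I" "I \<noteq> {}"
    and scale: "\<And>x t. x \<in> X \<Longrightarrow> 0 < t \<Longrightarrow> \<exists>y\<in>X. \<forall>i\<in>I. g y i = t * g x i"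
    and nonneg: "\<And>l. set l \<subseteq> X \<Longrightarrow> \<exists>i\<in>I. 0 \<le> (\<Sum>x\<leftarrow>l. g x i)"
  shows "\<exists>\<mu>. (\<forall>i\<in>I. 0 \<le> \<mu> i) \<and> (\<Sum>i\<in>I. \<mu> i) = 1 \<and> (\<forall>x\<in>X. 0 \<le> (\<Sum>i\<in>I. \<mu> i * g x i))"
proof -
  \<comment> \<open>The all-ones vector plus the cone plus the nonnegative orthant. By
    \<open>nonneg\<close> every member has a coordinate of at least 1, which keeps K at distance 1
    from the origin; the orthant will make the functional nonnegative.\<close>
  define K where "K = {w. \<exists>l. set l \<subseteq> X \<and> (\<forall>i\<in>I. 1 + (\<Sum>x\<leftarrow>l. g x i) \<le> w i)}"
  define Q where "Q w = (\<Sum>i\<in>I. (w i)\<^sup>2)" for w :: "'i \<Rightarrow> real"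
  have list_scale: "\<exists>l'. set l' \<subseteq> X \<and> (\<forall>i\<in>I. (\<Sum>x\<leftarrow>l'. g x i) = t * (\<Sum>x\<leftarrow>l. g x i))"
    if l: "set l \<subseteq> X" and t: "0 < t" for l and t :: real
    using l
  proof (induction l)
    case Nil then show ?case by (intro exI[of _ "[]"]) simp
  next
    case (Cons x l)
    then obtain l' where "set l' \<subseteq> X" "\<forall>i\<in>I. (\<Sum>x\<leftarrow>l'. g x i) = t * (\<Sum>x\<leftarrow>l. g x i)" by auto
    moreover obtain y where "y \<in> X" "\<forall>i\<in>I. g y i = t * g x i" using scale[of x t] Cons.prems t by auto
    ultimately show ?case by (intro exI[of _ "y # l'"]) (simp add: distrib_left)
  qed
  have conv: "(\<lambda>i. (1 - t) * u i + t * v i) \<in> K" if uv: "u \<in> K" "v \<in> K" and t: "0 < t" "t < 1" for u v and t :: real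
  proof -
    obtain l m where l: "set l \<subseteq> X" "\<forall>i\<in>I. 1 + (\<Sum>x\<leftarrow>l. g x i) \<le> u i"
      and m: "set m \<subseteq> X" "\<forall>i\<in>I. 1 + (\<Sum>x\<leftarrow>m. g x i) \<le> v i"
      using uv by (auto simp: K_def)
    obtain l' where l': "set l' \<subseteq> X" "\<forall>i\<in>I. (\<Sum>x\<leftarrow>l'. g x i) = (1 - t) * (\<Sum>x\<leftarrow>l. g x i)"
      using list_scale[OF l(1), of "1 - t"] t by auto
    obtain m' where m': "set m' \<subseteq> X" "\<forall>i\<in>I. (\<Sum>x\<leftarrow>m'. g x i) = t * (\<Sum>x\<leftarrow>m. g x i)"
      using list_scale[OF m(1), of t] t by auto
    have "1 + (\<Sum>x\<leftarrow>l' @ m'. g x i) \<le> (1 - t) * u i + t * v i" if "i \<in> I" for i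
    proof -
      have "(1 - t) * (1 + (\<Sum>x\<leftarrow>l. g x i)) + t * (1 + (\<Sum>x\<leftarrow>m. g x i)) \<le> (1 - t) * u i + t * v i"
        using l m t that by (intro add_mono mult_left_mono) auto
      moreover have "(1 - t) * (1 + (\<Sum>x\<leftarrow>l. g x i)) + t * (1 + (\<Sum>x\<leftarrow>m. g x i)) = 1 + (\<Sum>x\<leftarrow>l' @ m'. g x i)"
        using l' m' that by simp (simp add: algebra_simps)
      ultimately show ?thesis by simp
    qed
    then show ?thesis unfolding K_def using l' m' by (intro CollectI exI[of _ "l' @ m'"]) auto
  qed
  have Q1: "1 \<le> Q w" if "w \<in> K" for w
  proof -
    obtain l where l: "set l \<subseteq> X" "\<forall>i\<in>I. 1 + (\<Sum>x\<leftarrow>l. g x i) \<le> w i" using \<open>w \<in> K\<close> by (auto simp: K_def)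
    obtain i where i: "i \<in> I" "0 \<le> (\<Sum>x\<leftarrow>l. g x i)" using nonneg[OF l(1)] by auto
    have wi: "1 \<le> w i" using l(2) i by fastforce
    have "1 \<le> (w i)\<^sup>2" using power_mono[OF wi, of 2] by simp
    also have "\<dots> \<le> Q w" unfolding Q_def using I i by (intro member_le_sum) auto
    finally show ?thesis .
  qed
  have one: "(\<lambda>i. 1) \<in> K" unfolding K_def by (intro CollectI exI[of _ "[]"]) simp
  define d where "d = Inf (Q ` K)"
  have bdd: "bdd_below (Q ` K)" using Q1 by (intro bdd_belowI[of _ 1]) auto
  have d: "d \<le> Q w" if "w \<in> K" for w
    unfolding d_def using that bdd by (intro cInf_lower) auto
  have d1: "1 \<le> d" unfolding d_def using one Q1 by (intro cInf_greatest) auto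
  have "\<forall>n::nat. \<exists>w. w \<in> K \<and> Q w < d + 1 / Suc n"
  proof
    fix n :: nat
    have "Inf (Q ` K) < d + 1 / Suc n" by (simp add: d_def)
    then show "\<exists>w. w \<in> K \<and> Q w < d + 1 / Suc n"
      using cInf_less_iff[OF _ bdd] one by auto
  qed
  from choice[OF this] obtain w where w: "\<And>n. w n \<in> K" "\<And>n. Q (w n) < d + 1 / Suc n" by auto
  \<comment> \<open>The parallelogram law and convexity make the minimizing sequence Cauchy in every coordinate.\<close>
  have cau: "Cauchy (\<lambda>n. w n i)" if i: "i \<in> I" for i
  proof (rule metric_CauchyI)
    fix e :: real assume e: "0 < e"
    obtain m :: nat where m: "inverse (Suc m) < e\<^sup>2 / 4"
      using reals_Archimedean[of "e\<^sup>2 / 4"] e by auto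
    have "dist (w n i) (w k i) < e" if nk: "n \<ge> m" "k \<ge> m" for n k
    proof -
      have "d \<le> Q (\<lambda>i. (1 - 1/2) * w n i + 1/2 * w k i)" by (intro d conv w) auto
      also have "\<dots> = Q (w n) / 2 + Q (w k) / 2 - Q (\<lambda>i. w n i - w k i) / 4"
        unfolding Q_def sum_divide_distrib sum_subtractf[symmetric] sum.distrib[symmetric]
        by (intro sum.cong) (auto simp: power2_eq_square field_simps)
      finally have "Q (\<lambda>i. w n i - w k i) \<le> 2 * (Q (w n) - d) + 2 * (Q (w k) - d)" by simp
      also have "\<dots> < 2 * (1 / Suc n) + 2 * (1 / Suc k)" 
      proof -
        have "2 * x + 2 * y < 2 * x' + 2 * y'" if "x < x'" "y < y'" for x x' y y' :: real using that by simp
        then show ?thesis using w(2)[of n] w(2)[of k] by (metis add.commute diff_less_eq)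
      qed
      also have "\<dots> \<le> 2 * (1 / Suc m) + 2 * (1 / Suc m)"
        using nk by (intro add_mono mult_left_mono divide_left_mono) auto
      also have "\<dots> < e\<^sup>2" using m by (simp add: inverse_eq_divide)
      finally have "Q (\<lambda>i. w n i - w k i) < e\<^sup>2" .
      moreover have "(w n i - w k i)\<^sup>2 \<le> Q (\<lambda>i. w n i - w k i)"
        unfolding Q_def using I i by (intro member_le_sum) auto
      ultimately have "(w n i - w k i)\<^sup>2 < e\<^sup>2" by simp
      then have "\<bar>w n i - w k i\<bar> < \<bar>e\<bar>" 
        using power_mono[of "\<bar>e\<bar>" "\<bar>w n i - w k i\<bar>" 2] by (fastforce simp: not_less[symmetric])
      then show ?thesis using e by (simp add: dist_real_def)
    qed
    then show "\<exists>m. \<forall>n\<ge>m. \<forall>k\<ge>m. dist (w n i) (w k i) < e" by blast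
  qed
  define v where "v i = lim (\<lambda>n. w n i)" for i
  have lim: "(\<lambda>n. w n i) \<longlonglongrightarrow> v i" if "i \<in> I" for i
    using cau[OF that] unfolding v_def by (simp add: Cauchy_convergent_iff convergent_LIMSEQ_iff)
  have "(\<lambda>n. Q (w n)) \<longlonglongrightarrow> Q v" unfolding Q_def by (intro tendsto_intros lim)
  moreover have "(\<lambda>n. d + 1 / Suc n) \<longlonglongrightarrow> d + 0"
    by (intro tendsto_intros LIMSEQ_Suc[OF lim_1_over_n])
  ultimately have Qv: "Q v \<le> d"
    using w(2) by (intro LIMSEQ_le[of "\<lambda>n. Q (w n)"]) (auto intro: less_imp_le)
  \<comment> \<open>The variational inequality of the minimal point. As v is only known to be a
    limit of members of K, the segment towards u starts at \<open>w n\<close> and the limit is taken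
    afterwards.\<close>
  have sep: "d \<le> (\<Sum>i\<in>I. v i * u i)" if u: "u \<in> K" for u
  proof -
    let ?p = "(\<Sum>i\<in>I. v i * u i) - Q v" and ?q = "Q (\<lambda>i. u i - v i)"
    have tq: "0 \<le> 2 * ?p + t * ?q" if t: "0 < t" "t < 1" for t
    proof -
      have "(\<lambda>n. Q (\<lambda>i. (1 - t) * w n i + t * u i)) \<longlonglongrightarrow> Q (\<lambda>i. (1 - t) * v i + t * u i)"
        unfolding Q_def by (intro tendsto_intros lim)
      then have "d \<le> Q (\<lambda>i. (1 - t) * v i + t * u i)"
        using d[OF conv[OF w(1) u t]] by (intro LIMSEQ_le_const) auto
      also have "\<dots> = Q v + t * (2 * ?p + t * ?q)"
        unfolding Q_def sum_distrib_left sum_subtractf[symmetric] sum.distrib[symmetric]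
        by (intro sum.cong) (auto simp: power2_eq_square algebra_simps)
      finally have "0 \<le> t * (2 * ?p + t * ?q)" using Qv by simp
      then show ?thesis using t by (simp add: zero_le_mult_iff)
    qed
    have "0 \<le> ?p"
    proof (rule ccontr)
      assume n: "\<not> 0 \<le> ?p"
      have q: "0 \<le> ?q" unfolding Q_def by (intro sum_nonneg) auto
      \<comment> \<open>This t gives \<open>t * ?q\<close> at most \<open>- ?p\<close>, so the
        expression in \<open>tq\<close> is at most \<open>?p\<close>, which is negative.\<close>
      define t where "t = min (1/2) (- ?p / (?q + 1))"
      have t: "0 < t" "t < 1" using n q by (auto simp: t_def)
      have "t * ?q \<le> - ?p / (?q + 1) * ?q" using q by (intro mult_right_mono) (auto simp: t_def)
      also have "\<dots> \<le> - ?p" using n q by (simp add: divide_le_eq mult_left_mono)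
      finally show False using tq[OF t] n by simp
    qed
    moreover have "d \<le> Q v"
      using d[OF w(1)] \<open>(\<lambda>n. Q (w n)) \<longlonglongrightarrow> Q v\<close> by (intro LIMSEQ_le_const) auto
    ultimately show ?thesis by simp
  qed
  \<comment> \<open>K contains rays in the directions of the orthant and of each \<open>g x\<close>;
    a linear functional bounded below on a ray is nonnegative in its direction.\<close>
  have large: "0 \<le> b" if "\<And>T::real. 0 < T \<Longrightarrow> 0 \<le> a + T * b" for a b :: real
  proof (rule ccontr)
    assume b: "\<not> 0 \<le> b"
    have "0 \<le> a + ((\<bar>a\<bar> + 1) / (- b)) * b" using b by (intro that divide_pos_pos) auto
    moreover have "((\<bar>a\<bar> + 1) / (- b)) * b = - (\<bar>a\<bar> + 1)" using b by simp
    ultimately show False by linarith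
  qed
  have v0: "0 \<le> v i" if i: "i \<in> I" for i
  proof (rule large)
    fix T :: real assume "0 < T"
    then have "(\<lambda>k. 1 + T * (if k = i then 1 else 0)) \<in> K"
      unfolding K_def by (intro CollectI exI[of _ "[]"]) simp
    from sep[OF this] have "d \<le> (\<Sum>k\<in>I. v k) + T * (\<Sum>k\<in>I. v k * (if k = i then 1 else 0))"
      by (simp add: distrib_left sum.distrib sum_distrib_left mult.left_commute)
    also have "(\<Sum>k\<in>I. v k * (if k = i then 1 else 0)) = v i"
      using I i by (simp add: if_distrib[of "\<lambda>x. _ * x"] cong: if_cong)
    finally show "0 \<le> (\<Sum>k\<in>I. v k) + T * v i" using d1 by simp
  qed
  have vs: "1 \<le> (\<Sum>i\<in>I. v i)" using sep[OF one] d1 by simp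
  have vx: "0 \<le> (\<Sum>i\<in>I. v i * g x i)" if x: "x \<in> X" for x
  proof (rule large)
    fix T :: real assume T: "0 < T"
    then obtain y where y: "y \<in> X" "\<forall>i\<in>I. g y i = T * g x i" using scale x by blast
    then have "(\<lambda>i. 1 + T * g x i) \<in> K"
      unfolding K_def by (intro CollectI exI[of _ "[y]"]) simp
    from sep[OF this] show "0 \<le> (\<Sum>i\<in>I. v i) + T * (\<Sum>i\<in>I. v i * g x i)"
      using d1 by (simp add: distrib_left sum.distrib sum_distrib_left mult.left_commute)
  qed
  let ?s = "\<Sum>i\<in>I. v i"
  show ?thesis
  proof (intro exI[of _ "\<lambda>i. v i / ?s"] conjI ballI)
    show "0 \<le> v i / ?s" if "i \<in> I" for i using v0[OF that] vs by simp
    show "(\<Sum>i\<in>I. v i / ?s) = 1" using vs by (simp flip: sum_divide_distrib)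
    show "0 \<le> (\<Sum>i\<in>I. v i / ?s * g x i)" if "x \<in> X" for x
      using vx[OF that] vs by (simp flip: sum_divide_distrib)
  qed
qed

text \<open>The unit ball of a weighted ell^p space. For finite p a zero weight leaves its
  coordinate free, while p = infinity bounds every coordinate whatever the weight.\<close>

definition weighted_ball :: "ennreal \<Rightarrow> 'i set \<Rightarrow> ('i \<Rightarrow> real) \<Rightarrow> ('i \<Rightarrow> complex) \<Rightarrow> bool" where
  "weighted_ball p I h a \<longleftrightarrow>
     (if p = \<infinity> then \<forall>i\<in>I. cmod (a i) \<le> 1 else (\<Sum>i\<in>I. h i * cmod (a i) powr enn2real p) \<le> 1)"

lemma powr_iexp_powr:
  assumes "1 \<le> p" "p \<noteq> \<infinity>" "0 \<le> t" shows "(t powr iexp p) powr enn2real p = t"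
  using assms enn2real_ge_1[of p] by (simp add: iexp_finite powr_powr)

lemma powr_neg_iexp_powr:
  assumes "1 \<le> p" "p \<noteq> \<infinity>" "0 < t" shows "(t powr (- iexp p)) powr enn2real p = 1 / t"
proof -
  have "- iexp p * enn2real p = - 1" using assms enn2real_ge_1[of p] by (simp add: iexp_finite)
  then show ?thesis unfolding powr_powr using assms(3) by (simp only: powr_minus_divide powr_one less_imp_le)
qed

text \<open>The domination theorem of Pietsch and Kwapien for a matrix. With s conjugate to r, the
  hypothesis says that the sum of |Z|^s over test families is at most A^s. Separation over I x J
  gives a probability \<mu> under which |Z|^s is at most A^s times a convex combination of weighted
  p-th and q-th power sums, the weights being the marginals of \<mu>. In the application q is the
  conjugate exponent.\<close>

lemma Pietsch_domination:
  fixes z :: "'i \<Rightarrow> 'j \<Rightarrow> complex" and I :: "'i set" and J :: "'j set"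
  defines "Z \<equiv> \<lambda>a b. \<Sum>i\<in>I. \<Sum>j\<in>J. z i j * a i * b j"
  assumes fin: "finite I" "finite J"
    and pqr: "1 \<le> p" "1 \<le> q" "1 \<le> r" "iexp r + iexp p + iexp q = 1" and A: "0 < A"
    and dom: "\<And>n l a b. lnorm r (map l [0..<n]) \<le> 1 \<Longrightarrow>
      (\<And>i. i \<in> I \<Longrightarrow> lnorm p (map (\<lambda>k. a k i) [0..<n]) \<le> 1) \<Longrightarrow>
      (\<And>j. j \<in> J \<Longrightarrow> lnorm q (map (\<lambda>k. b k j) [0..<n]) \<le> 1) \<Longrightarrow>
      cmod (\<Sum>k<n. Z (a k) (b k) * l k) \<le> A"
  shows "\<exists>h k. (\<forall>i\<in>I. 0 \<le> h i) \<and> (\<Sum>i\<in>I. h i) \<le> (1::real) \<and> (\<forall>j\<in>J. 0 \<le> k j) \<and> (\<Sum>j\<in>J. k j) \<le> (1::real) \<and>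
    (\<forall>a b. weighted_ball p I h a \<longrightarrow> weighted_ball q J k b \<longrightarrow> cmod (Z a b) \<le> A)"
proof (cases "I = {} \<or> J = {}")
  case True
  then have "Z a b = 0" for a b by (auto simp: Z_def)
  then show ?thesis using A by (intro exI[of _ "\<lambda>_. 0"]) simp
next
  case ne: False
  define P Q \<sigma> where "P = iexp p" and "Q = iexp q" and "\<sigma> = P + Q"
  have PQ: "0 \<le> P" "0 \<le> Q" "iexp r = 1 - \<sigma>" using pqr by (auto simp: P_def Q_def \<sigma>_def)
  have Zscale: "Z (\<lambda>i. of_real s * a i) (\<lambda>j. of_real t * b j) = of_real (s * t) * Z a b" for s t a b
    by (simp add: Z_def sum_distrib_left algebra_simps)
  show ?thesis
  \<comment> \<open>Both exponents are infinite and r = 1: domination for a single pair is already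
    the claim.\<close>
  proof (cases "\<sigma> = 0")
    case True
    then have "P = 0" "Q = 0" using PQ by (auto simp: \<sigma>_def)
    then have inf: "p = \<infinity>" "q = \<infinity>" using iexp_eq_0_iff[OF pqr(1)] iexp_eq_0_iff[OF pqr(2)] by (auto simp: P_def Q_def)
    have r: "r = 1" using PQ True pqr(3) by (intro iexp_inj) (auto simp: iexp_def)
    have "cmod (Z a b) \<le> A" if "weighted_ball p I (\<lambda>_. 0) a" "weighted_ball q J (\<lambda>_. 0) b" for a b
    proof -
      have "cmod (\<Sum>k<Suc 0. Z a b * 1) \<le> A"
        using that inf by (intro dom) (auto simp: lnorm_def r weighted_ball_def)
      then show ?thesis by simp
    qed
    then show ?thesis by (intro exI[of _ "\<lambda>_. 0"]) simp
  next
    case False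
    then have \<sigma>: "0 < \<sigma>" using PQ by (simp add: \<sigma>_def)
    \<comment> \<open>s is the conjugate of r, as 1/s = 1/p + 1/q. Scaling a by t^(1/p) and b by
      t^(1/q) then multiplies |Z|^s by t, and \<theta> is the exponent at which the first factor
      enters.\<close>
    define s \<theta> where "s = 1 / \<sigma>" and "\<theta> = P / \<sigma>"
    have \<theta>: "0 \<le> \<theta>" "1 - \<theta> = Q / \<sigma>" "0 \<le> 1 - \<theta>" using \<sigma> PQ by (auto simp: \<theta>_def \<sigma>_def field_simps)
    have s: "0 < s" using \<sigma> by (simp add: s_def)
    have \<theta>p: "p = \<infinity> \<Longrightarrow> \<theta> = 0" and \<theta>q: "q = \<infinity> \<Longrightarrow> 1 - \<theta> = 0"
      unfolding \<theta>(2) by (auto simp: \<theta>_def P_def Q_def)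
    define c where "c = conj_exp r"
    have c1: "1 \<le> c" unfolding c_def by (rule conj_exp_ge_1[OF pqr(3)])
    have ic: "iexp c = \<sigma>" using PQ by (simp add: c_def iexp_conj_exp pqr(3))
    then have cinf: "c \<noteq> \<infinity>" using \<sigma> iexp_top by auto
    have ec: "enn2real c = s" using iexp_finite[OF c1 cinf] ic by (simp add: s_def)
    \<comment> \<open>Domination with the multipliers l eliminated by duality of ell^r and
      ell^s.\<close>
    have dom': "(\<Sum>k<n. cmod (Z (a k) (b k)) powr s) \<le> A powr s"
      if "\<And>i. i \<in> I \<Longrightarrow> lnorm p (map (\<lambda>k. a k i) [0..<n]) \<le> 1"
        "\<And>j. j \<in> J \<Longrightarrow> lnorm q (map (\<lambda>k. b k j) [0..<n]) \<le> 1" for n a b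
    proof -
      have "lnorm c (map (\<lambda>k. Z (a k) (b k)) [0..<n]) \<le> A"
      proof (rule lnorm_dual[OF c1])
        fix l assume "lnorm (conj_exp c) (map l [0..<n]) \<le> 1"
        then show "cmod (\<Sum>k<n. Z (a k) (b k) * l k) \<le> A"
          using that by (intro dom) (simp_all add: c_def conj_exp_conj_exp pqr(3))
      qed (use A in simp)
      then show ?thesis using A cinf c1 by (simp add: lnorm_le_iff_sum ec)
    qed
    \<comment> \<open>For an infinite exponent the coefficient \<open>\<theta>\<close> or \<open>1 - \<theta>\<close> vanishes, and the sup norm is a side condition instead.\<close>
    define X where "X = {(a, b). (p = \<infinity> \<longrightarrow> (\<forall>i\<in>I. cmod (a i) \<le> 1)) \<and> (q = \<infinity> \<longrightarrow> (\<forall>j\<in>J. cmod (b j) \<le> 1))}"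
    define g where "g = (\<lambda>(a, b) (i, j). \<theta> * cmod (a i) powr enn2real p + (1 - \<theta>) * cmod (b j) powr enn2real q
      - cmod (Z a b) powr s / A powr s)"
    have "\<exists>\<mu>. (\<forall>x\<in>I \<times> J. 0 \<le> \<mu> x) \<and> (\<Sum>x\<in>I \<times> J. \<mu> x) = 1 \<and> (\<forall>y\<in>X. 0 \<le> (\<Sum>x\<in>I \<times> J. \<mu> x * g y x))"
    proof (rule cone_separation)
      show "finite (I \<times> J)" "I \<times> J \<noteq> {}" using fin ne by auto
      fix y and t :: real assume y: "y \<in> X" and t: "0 < t"
      obtain a b where ab: "y = (a, b)" by force
      let ?a = "\<lambda>i. of_real (t powr P) * a i" and ?b = "\<lambda>j. of_real (t powr Q) * b j"
      have 1: "\<theta> * cmod (?a i) powr enn2real p = t * (\<theta> * cmod (a i) powr enn2real p)" for i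
        using t pqr \<theta>p by (cases "p = \<infinity>") (auto simp: norm_mult powr_mult P_def powr_iexp_powr)
      have 2: "(1 - \<theta>) * cmod (?b j) powr enn2real q = t * ((1 - \<theta>) * cmod (b j) powr enn2real q)" for j
        using t pqr \<theta>q by (cases "q = \<infinity>") (auto simp: norm_mult powr_mult Q_def powr_iexp_powr)
      have "t powr P * t powr Q = t powr \<sigma>" by (simp add: \<sigma>_def powr_add)
      then have 3: "cmod (Z ?a ?b) powr s / A powr s = t * (cmod (Z a b) powr s / A powr s)"
        unfolding Zscale using t \<sigma> by (simp add: norm_mult powr_mult powr_powr s_def)
      have "(?a, ?b) \<in> X" using y ab t by (auto simp: X_def norm_mult P_def Q_def)
      moreover have "\<forall>x\<in>I \<times> J. g (?a, ?b) x = t * g y x"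
      proof
        fix x assume "x \<in> I \<times> J"
        obtain i j where x: "x = (i, j)" by force
        show "g (?a, ?b) x = t * g y x"
          unfolding g_def ab x prod.case 1 2 3 by (simp only: right_diff_distrib distrib_left)
      qed
      ultimately show "\<exists>u\<in>X. \<forall>x\<in>I \<times> J. g u x = t * g y x" by blast
    next
      fix l assume l: "set l \<subseteq> X"
      define n where "n = length l"
      define a b where "a k = fst (l ! k)" and "b k = snd (l ! k)" for k
      define W where "W = (\<Sum>k<n. cmod (Z (a k) (b k)) powr s) / A powr s"
      define \<alpha> where "\<alpha> i = (\<Sum>k<n. cmod (a k i) powr enn2real p)" for i
      define \<beta> where "\<beta> j = (\<Sum>k<n. cmod (b k j) powr enn2real q)" for j
      have X: "(a k, b k) \<in> X" if "k < n" for k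
        using l that nth_mem[of k l] by (auto simp: a_def b_def n_def)
      have sum: "(\<Sum>y\<leftarrow>l. g y (i, j)) = \<theta> * \<alpha> i + (1 - \<theta>) * \<beta> j - W" for i j
      proof -
        have "(\<Sum>y\<leftarrow>l. g y (i, j)) = (\<Sum>k<n. g (a k, b k) (i, j))"
          by (simp add: sum_list_sum_nth atLeast0LessThan n_def a_def b_def)
        then show ?thesis
          by (simp add: g_def \<alpha>_def \<beta>_def W_def sum.distrib sum_subtractf sum_distrib_left sum_divide_distrib)
      qed
      show "\<exists>x\<in>I \<times> J. 0 \<le> (\<Sum>y\<leftarrow>l. g y x)"
      proof (rule ccontr)
        assume "\<not> ?thesis"
        then have neg: "\<theta> * \<alpha> i + (1 - \<theta>) * \<beta> j < W" if "i \<in> I" "j \<in> J" for i j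
          using that sum[of i j] by force
        \<comment> \<open>The sum over l splits into a term in i, a term in j and a constant, so its
          maximum over I x J is found at separate maximizers.\<close>
        obtain i where i: "i \<in> I" "\<And>i'. i' \<in> I \<Longrightarrow> \<alpha> i' \<le> \<alpha> i"
          using obtains_MAX[of I \<alpha>] fin ne Max_ge[of "\<alpha> ` I"] by (metis finite_imageI imageI)
        obtain j where j: "j \<in> J" "\<And>j'. j' \<in> J \<Longrightarrow> \<beta> j' \<le> \<beta> j"
          using obtains_MAX[of J \<beta>] fin ne Max_ge[of "\<beta> ` J"] by (metis finite_imageI imageI)
        \<comment> \<open>Half of the gap: adding it makes u and v positive, so that they can be
          divided by, and still leaves their weighted mean below W.\<close>
        define e where "e = (W - (\<theta> * \<alpha> i + (1 - \<theta>) * \<beta> j)) / 2"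
        have e: "0 < e" using neg[OF i(1) j(1)] by (simp add: e_def)
        define u v where "u = \<alpha> i + e" and "v = \<beta> j + e"
        have u: "0 < u" and v: "0 < v" unfolding u_def v_def \<alpha>_def \<beta>_def
          using e by (auto intro!: add_nonneg_pos sum_nonneg)
        have "\<theta> * u + (1 - \<theta>) * v = \<theta> * \<alpha> i + (1 - \<theta>) * \<beta> j + e" by (simp add: u_def v_def algebra_simps)
        moreover have "W = \<theta> * \<alpha> i + (1 - \<theta>) * \<beta> j + 2 * e" unfolding e_def by (simp add: diff_divide_distrib add_divide_distrib)
        ultimately have lt: "\<theta> * u + (1 - \<theta>) * v < W" using e by linarith
        \<comment> \<open>Rescaled to meet the hypotheses of \<open>dom'\<close>, whose conclusion
          becomes that W is at most u^\<theta> v^(1-\<theta>); AM-GM then contradicts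
          \<open>lt\<close>.\<close>
        let ?a = "\<lambda>k i. of_real (u powr (- P)) * a k i" and ?b = "\<lambda>k j. of_real (v powr (- Q)) * b k j"
        have "(\<Sum>k<n. cmod (Z (?a k) (?b k)) powr s) \<le> A powr s"
        proof (rule dom')
          fix i' assume i': "i' \<in> I"
          show "lnorm p (map (\<lambda>k. ?a k i') [0..<n]) \<le> 1"
          proof (cases "p = \<infinity>")
            case True
            then show ?thesis using X i' u pqr by (subst lnorm_le_iff_sum) (auto simp: X_def P_def norm_mult)
          next
            case False
            have "(u powr (- P)) powr enn2real p = 1 / u"
              unfolding P_def using False pqr u by (intro powr_neg_iexp_powr)
            moreover have "\<alpha> i' \<le> u" using i(2)[OF i'] e by (simp add: u_def)
            ultimately show ?thesis using False pqr u
              by (subst lnorm_le_iff_sum) (auto simp: norm_mult powr_mult \<alpha>_def simp flip: sum_divide_distrib)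
          qed
        next
          fix j' assume j': "j' \<in> J"
          show "lnorm q (map (\<lambda>k. ?b k j') [0..<n]) \<le> 1"
          proof (cases "q = \<infinity>")
            case True
            then show ?thesis using X j' v pqr by (subst lnorm_le_iff_sum) (auto simp: X_def Q_def norm_mult)
          next
            case False
            have "(v powr (- Q)) powr enn2real q = 1 / v"
              unfolding Q_def using False pqr v by (intro powr_neg_iexp_powr)
            moreover have "\<beta> j' \<le> v" using j(2)[OF j'] e by (simp add: v_def)
            ultimately show ?thesis using False pqr v
              by (subst lnorm_le_iff_sum) (auto simp: norm_mult powr_mult \<beta>_def simp flip: sum_divide_distrib)
          qed
        qed
        moreover have "(\<Sum>k<n. cmod (Z (?a k) (?b k)) powr s) = (u powr (- \<theta>) * v powr (- (1 - \<theta>))) * (W * A powr s)"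
        proof -
          have "cmod (Z (?a k) (?b k)) powr s = (u powr (- \<theta>) * v powr (- (1 - \<theta>))) * cmod (Z (a k) (b k)) powr s" for k
            unfolding Zscale \<theta>(2) using u v
            by (simp add: norm_mult powr_mult powr_powr \<theta>_def s_def)
          then show ?thesis using A by (simp add: W_def sum_distrib_left)
        qed
        ultimately have "(u powr (- \<theta>) * v powr (- (1 - \<theta>))) * W * A powr s \<le> 1 * A powr s"
          by (simp add: mult.assoc)
        then have "u powr (- \<theta>) * v powr (- (1 - \<theta>)) * W \<le> 1" using A by (subst (asm) mult_le_cancel_right) auto
        then have "1 / u powr \<theta> * (1 / v powr (1 - \<theta>)) * W \<le> 1"
          by (simp only: powr_minus_divide)
        moreover have "0 < u powr \<theta>" "0 < v powr (1 - \<theta>)" using u v by auto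
        ultimately have "W \<le> u powr \<theta> * v powr (1 - \<theta>)"
          by (simp add: divide_le_eq)
        also have "\<dots> \<le> \<theta> * u + (1 - \<theta>) * v"
          using weighted_AM_GM3[of u v 1 \<theta> "1 - \<theta>" 0] u v \<theta> by simp
        finally show False using lt by simp
      qed
    qed
    then obtain \<mu> where \<mu>: "\<And>i j. i \<in> I \<Longrightarrow> j \<in> J \<Longrightarrow> 0 \<le> \<mu> (i, j)" "(\<Sum>x\<in>I \<times> J. \<mu> x) = 1"
      "\<And>y. y \<in> X \<Longrightarrow> 0 \<le> (\<Sum>x\<in>I \<times> J. \<mu> x * g y x)" by auto
    \<comment> \<open>The marginals of \<mu>: the first term of g depends on i alone, the second on
      j alone.\<close>
    define h k where "h i = (\<Sum>j\<in>J. \<mu> (i, j))" and "k j = (\<Sum>i\<in>I. \<mu> (i, j))" for i j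
    have h1: "(\<Sum>i\<in>I. h i) = 1" unfolding h_def using \<mu>(2) by (simp add: sum.cartesian_product)
    have k1: "(\<Sum>j\<in>J. k j) = 1" unfolding k_def using \<mu>(2)
      by (subst sum.swap) (simp add: sum.cartesian_product)
    have "cmod (Z a b) \<le> A" if a: "weighted_ball p I h a" and b: "weighted_ball q J k b" for a b
    proof -
      have "(a, b) \<in> X" using a b by (auto simp: X_def weighted_ball_def)
      from \<mu>(3)[OF this] have "0 \<le> (\<Sum>i\<in>I. \<Sum>j\<in>J. \<mu> (i, j) * g (a, b) (i, j))"
        by (simp add: sum.cartesian_product)
      also have "\<dots> = \<theta> * (\<Sum>i\<in>I. \<Sum>j\<in>J. \<mu> (i, j) * cmod (a i) powr enn2real p)
          + (1 - \<theta>) * (\<Sum>i\<in>I. \<Sum>j\<in>J. \<mu> (i, j) * cmod (b j) powr enn2real q)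
          - (\<Sum>i\<in>I. \<Sum>j\<in>J. \<mu> (i, j)) * (cmod (Z a b) powr s / A powr s)"
        by (simp add: g_def sum.distrib sum_subtractf sum_distrib_left sum_distrib_right sum_divide_distrib algebra_simps)
      also have "(\<Sum>i\<in>I. \<Sum>j\<in>J. \<mu> (i, j) * cmod (a i) powr enn2real p) = (\<Sum>i\<in>I. h i * cmod (a i) powr enn2real p)"
        by (simp add: h_def sum_distrib_right)
      also have "(\<Sum>i\<in>I. \<Sum>j\<in>J. \<mu> (i, j) * cmod (b j) powr enn2real q) = (\<Sum>j\<in>J. k j * cmod (b j) powr enn2real q)"
        by (subst sum.swap) (simp add: k_def sum_distrib_right)
      also have "(\<Sum>i\<in>I. \<Sum>j\<in>J. \<mu> (i, j)) = 1" using h1 by (simp add: h_def)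
      finally have "cmod (Z a b) powr s / A powr s
          \<le> \<theta> * (\<Sum>i\<in>I. h i * cmod (a i) powr enn2real p) + (1 - \<theta>) * (\<Sum>j\<in>J. k j * cmod (b j) powr enn2real q)"
        by simp
      also have "\<dots> \<le> \<theta> * 1 + (1 - \<theta>) * 1"
      proof (rule add_mono)
        show "\<theta> * (\<Sum>i\<in>I. h i * cmod (a i) powr enn2real p) \<le> \<theta> * 1"
          using a \<theta>(1) \<theta>p by (cases "p = \<infinity>") (simp_all add: weighted_ball_def mult_left_le)
        show "(1 - \<theta>) * (\<Sum>j\<in>J. k j * cmod (b j) powr enn2real q) \<le> (1 - \<theta>) * 1"
          using b \<theta>(3) \<theta>q by (cases "q = \<infinity>") (simp_all add: weighted_ball_def mult_left_le)
      qed
      finally have "cmod (Z a b) powr s \<le> A powr s" using A by (simp add: divide_le_eq)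
      then show ?thesis using powr_less_mono2[OF s less_imp_le[OF A], of "cmod (Z a b)"] by linarith
    qed
    moreover have "\<forall>i\<in>I. 0 \<le> h i" "\<forall>j\<in>J. 0 \<le> k j" using \<mu>(1) by (auto simp: h_def k_def intro: sum_nonneg)
    ultimately show ?thesis using h1 k1 by (intro exI[of _ h] exI[of _ k]) auto
  qed
qed

text \<open>A zero weight with finite p leaves coordinate i free, so a nonzero entry could be blown
  up beyond A. The multiple \<open>?T\<close> brings the form to modulus |A| + 1; coordinate j needs
  no more than 1, because \<open>k j\<close> is at most 1.\<close>

lemma weighted_ball_0:
  assumes "\<And>a b. weighted_ball p I h a \<Longrightarrow> weighted_ball q J k b \<Longrightarrow>
      cmod (\<Sum>i\<in>I. \<Sum>j\<in>J. z i j * a i * b j) \<le> A"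
    and "finite I" "finite J" "1 \<le> p" "1 \<le> q" "p \<noteq> \<infinity>" "h i = 0" "i \<in> I" "j \<in> J" and k: "\<And>j. j \<in> J \<Longrightarrow> 0 \<le> k j" "sum k J \<le> 1"
  shows "z i j = 0"
proof (rule ccontr)
  assume z: "z i j \<noteq> 0"
  have "k j \<le> sum k J" using assms by (intro member_le_sum) auto
  then have k1: "k j \<le> 1" using k by simp
  let ?T = "of_real ((\<bar>A\<bar> + 1) / cmod (z i j)) :: complex"
  let ?a = "\<lambda>i'. if i' = i then ?T else 0" and ?b = "\<lambda>j'. if j' = j then 1 else 0 :: complex"
  have "weighted_ball p I h ?a" using assms by (auto simp: weighted_ball_def if_distrib cong: if_cong intro!: order_trans[OF sum_nonpos])
  moreover have "(\<Sum>j'\<in>J. k j' * cmod (?b j') powr enn2real q) = (\<Sum>j'\<in>J. if j' = j then k j else 0)"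
    by (intro sum.cong) auto
  then have "weighted_ball q J k ?b" using assms k1 by (auto simp: weighted_ball_def)
  ultimately have "cmod (\<Sum>i'\<in>I. \<Sum>j'\<in>J. z i' j' * ?a i' * ?b j') \<le> A" by (rule assms(1))
  also have "(\<Sum>i'\<in>I. \<Sum>j'\<in>J. z i' j' * ?a i' * ?b j') = (\<Sum>i'\<in>I. if i' = i then z i j * ?T else 0)"
    using assms by (intro sum.cong) (auto simp: if_distrib[of "\<lambda>x. _ * x"] cong: if_cong)
  also have "\<dots> = z i j * ?T" using assms by simp
  finally have "\<bar>A\<bar> + 1 \<le> A" using z by (simp add: norm_mult norm_divide)
  then show False by simp
qed

section \<open>Dual norms\<close>

text \<open>All of the axioms of a seminorm but the triangle inequality, which the duality arguments do not use.\<close>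

definition homogeneous :: "'i nspace \<Rightarrow> bool" where
  "homogeneous X \<longleftrightarrow> 0 \<in> vecs X \<and> (\<forall>x\<in>vecs X. \<forall>y\<in>vecs X. x + y \<in> vecs X) \<and>
     (\<forall>c. \<forall>x\<in>vecs X. cscale c x \<in> vecs X) \<and> (\<forall>x\<in>vecs X. 0 \<le> nrm X x) \<and>
     (\<forall>c. \<forall>x\<in>vecs X. nrm X (cscale c x) = cmod c * nrm X x)"

lemma homogeneousD:
  assumes "homogeneous X"
  shows "0 \<in> vecs X" "x \<in> vecs X \<Longrightarrow> y \<in> vecs X \<Longrightarrow> x + y \<in> vecs X"
    "x \<in> vecs X \<Longrightarrow> cscale c x \<in> vecs X" "x \<in> vecs X \<Longrightarrow> 0 \<le> nrm X x"
    "x \<in> vecs X \<Longrightarrow> nrm X (cscale c x) = cmod c * nrm X x"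
  using assms by (auto simp: homogeneous_def)

lemma cscale_0 [simp]: "cscale 0 x = 0"
  by (simp add: cscale_def fun_eq_iff)

lemma homogeneous_nrm_0: "homogeneous X \<Longrightarrow> nrm X 0 = 0"
  using homogeneousD(5)[of X 0 0] homogeneousD(1)[of X] by simp

lemma homogeneous_Lp_1: "homogeneous (Lp 1 M)"
  unfolding homogeneous_def
  by (auto simp: Lp_1_iff nrm_Lp_1 cscale_def plus_fun_def zero_fun_def norm_mult)

lemma homogeneous_subspace: "homogeneous X \<Longrightarrow> cfun.subspace (vecs X)"
  by (auto simp: cfun.subspace_def homogeneous_def)

lemma fd_subspaceD:
  assumes "fd_subspace X M" "homogeneous X"
  shows "homogeneous M" "vecs M \<subseteq> vecs X" "nrm M = nrm X"
proof -
  obtain B where B: "cfun.span B \<subseteq> vecs X" "M = X\<lparr>vecs := cfun.span B\<rparr>"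
    using assms by (auto simp: fd_subspace_def)
  show "vecs M \<subseteq> vecs X" "nrm M = nrm X" using B by auto
  show "homogeneous M" unfolding homogeneous_def
    using B homogeneousD[OF assms(2)]
    by (auto intro: cfun.span_zero cfun.span_add cfun.span_scale)
qed

lemma fd_subspace_span:
  assumes "finite B" "B \<subseteq> vecs X" "homogeneous X"
  shows "fd_subspace X (X\<lparr>vecs := cfun.span B\<rparr>)"
  using assms cfun.span_minimal[OF assms(2) homogeneous_subspace[OF assms(3)]]
  by (auto simp: fd_subspace_def)

lemma dual_nrm_le:
  assumes "homogeneous X" "\<And>x. x \<in> vecs X \<Longrightarrow> nrm X x \<le> 1 \<Longrightarrow> cmod (f x) \<le> K"
  shows "nrm (dual X) f \<le> K"
proof -
  have "{x \<in> vecs X. nrm X x \<le> 1} \<noteq> {}"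
    using homogeneousD(1)[OF assms(1)] homogeneous_nrm_0[OF assms(1)] by auto
  then show ?thesis using assms(2) by (auto simp: dual_def intro!: cSUP_least)
qed

lemma dual_bound:
  assumes X: "homogeneous X" and f: "f \<in> vecs (dual X)" and x: "x \<in> vecs X"
  shows "cmod (f x) \<le> nrm (dual X) f * nrm X x"
proof -
  obtain C where C: "\<And>x. x \<in> vecs X \<Longrightarrow> cmod (f x) \<le> C * nrm X x"
    and lin: "linear_functional X f" using f by (auto simp: dual_def)
  have bdd: "bdd_above ((\<lambda>x. cmod (f x)) ` {x \<in> vecs X. nrm X x \<le> 1})"
  proof (rule bdd_aboveI2)
    fix x assume "x \<in> {x \<in> vecs X. nrm X x \<le> 1}"
    then have x: "x \<in> vecs X" "nrm X x \<le> 1" by auto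
    have "cmod (f x) \<le> \<bar>C\<bar> * nrm X x" using C[OF x(1)] mult_right_mono[OF abs_ge_self[of C] homogeneousD(4)[OF X x(1)]]
      by linarith
    also have "\<dots> \<le> \<bar>C\<bar>" using x by (simp add: mult_left_le)
    finally show "cmod (f x) \<le> \<bar>C\<bar>" .
  qed
  have nn: "0 \<le> nrm X x" using homogeneousD(4)[OF X x] .
  show ?thesis
  proof (cases "nrm X x = 0")
    \<comment> \<open>A vector of seminorm 0 cannot be normalized, but the boundedness of f makes f
      vanish there.\<close>
    case True
    then show ?thesis using C[OF x] by simp
  next
    case False
    let ?y = "cscale (1 / of_real (nrm X x)) x"
    have y: "?y \<in> vecs X" "nrm X ?y \<le> 1"
      using homogeneousD(3,5)[OF X x] nn False by (auto simp: norm_divide)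
    have "cmod (f ?y) \<le> nrm (dual X) f"
      unfolding dual_def nspace.simps using y by (intro cSUP_upper bdd) auto
    moreover have "f ?y = f x / of_real (nrm X x)" using lin x by (simp add: linear_functional_def)
    ultimately show ?thesis using nn False by (simp add: norm_divide field_simps)
  qed
qed

lemma dual_nrm_nonneg:
  assumes "homogeneous X" "f \<in> vecs (dual X)" shows "0 \<le> nrm (dual X) f"
proof -
  let ?A = "{x \<in> vecs X. nrm X x \<le> 1}"
  have 0: "0 \<in> ?A" using homogeneousD(1)[OF assms(1)] homogeneous_nrm_0[OF assms(1)] by auto
  obtain C where C: "\<And>x. x \<in> vecs X \<Longrightarrow> cmod (f x) \<le> C * nrm X x" using assms by (auto simp: dual_def)
  have "bdd_above ((\<lambda>x. cmod (f x)) ` ?A)"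
  proof (rule bdd_aboveI2)
    fix x assume x: "x \<in> ?A"
    have "cmod (f x) \<le> C * nrm X x" using C x by auto
    also have "\<dots> \<le> \<bar>C\<bar> * 1" using x homogeneousD(4)[OF assms(1)] by (intro mult_mono) auto
    finally show "cmod (f x) \<le> \<bar>C\<bar>" by simp
  qed
  from cSUP_upper[OF 0 this] have "cmod (f 0) \<le> nrm (dual X) f" by (simp add: dual_def)
  then show ?thesis using norm_ge_zero order_trans by blast
qed

lemma in_dualI:
  assumes "\<And>x y. x \<in> vecs X \<Longrightarrow> y \<in> vecs X \<Longrightarrow> f (x + y) = f x + f y"
    and "\<And>c x. x \<in> vecs X \<Longrightarrow> f (cscale c x) = c * f x"
    and "\<And>x. x \<in> vecs X \<Longrightarrow> cmod (f x) \<le> C * nrm X x"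
  shows "f \<in> vecs (dual X)"
  using assms unfolding dual_def linear_functional_def by (auto intro!: exI[of _ C])

lemma in_dualD:
  assumes "f \<in> vecs (dual X)"
  shows "x \<in> vecs X \<Longrightarrow> y \<in> vecs X \<Longrightarrow> f (x + y) = f x + f y"
    and "x \<in> vecs X \<Longrightarrow> f (cscale c x) = c * f x"
  using assms unfolding dual_def linear_functional_def by auto

lemma homogeneous_dual:
  assumes X: "homogeneous X" shows "homogeneous (dual X)"
proof -
  have sc: "cscale c f \<in> vecs (dual X)" if f: "f \<in> vecs (dual X)" for c f
    by (rule in_dualI[where C="cmod c * nrm (dual X) f"])
      (use in_dualD[OF f] dual_bound[OF X f] in \<open>auto simp: cscale_def algebra_simps norm_mult intro!: mult_left_mono\<close>)
  have le: "nrm (dual X) (cscale c f) \<le> cmod c * nrm (dual X) f" if f: "f \<in> vecs (dual X)" for c f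
  proof (rule dual_nrm_le[OF X])
    fix x assume x: "x \<in> vecs X" "nrm X x \<le> 1"
    have "cmod (f x) \<le> nrm (dual X) f * nrm X x" using dual_bound[OF X f x(1)] .
    also have "\<dots> \<le> nrm (dual X) f" using x dual_nrm_nonneg[OF X f] by (simp add: mult_left_le)
    finally show "cmod (cscale c f x) \<le> cmod c * nrm (dual X) f"
      by (simp add: cscale_def norm_mult mult_left_mono)
  qed
  have eq: "nrm (dual X) (cscale c f) = cmod c * nrm (dual X) f" if f: "f \<in> vecs (dual X)" for c f
  proof (cases "c = 0")
    case True
    then show ?thesis using le[OF f, of c] dual_nrm_nonneg[OF X sc[OF f, of c]] by simp
  next
    case False
    have "f = cscale (1 / c) (cscale c f)" using False by (simp add: cscale_def)
    then have "nrm (dual X) f \<le> cmod (1 / c) * nrm (dual X) (cscale c f)" using le[OF sc[OF f]] by metis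
    then show ?thesis using le[OF f, of c] False by (simp add: norm_divide field_simps)
  qed
  have add: "f + g \<in> vecs (dual X)" if f: "f \<in> vecs (dual X)" and g: "g \<in> vecs (dual X)" for f g
  proof (rule in_dualI[where C="nrm (dual X) f + nrm (dual X) g"])
    fix x assume "x \<in> vecs X"
    then show "cmod ((f + g) x) \<le> (nrm (dual X) f + nrm (dual X) g) * nrm X x"
      using dual_bound[OF X f] dual_bound[OF X g] unfolding plus_fun_def distrib_right
      by (intro norm_triangle_le add_mono)
  qed (use in_dualD[OF f] in_dualD[OF g] in \<open>auto simp: plus_fun_def algebra_simps\<close>)
  have "0 \<in> vecs (dual X)" by (rule in_dualI[where C=0]) auto
  then show ?thesis unfolding homogeneous_def using sc eq add dual_nrm_nonneg[OF X] by blast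
qed

lemma dual_nrm_eq_0:
  assumes "homogeneous X" "\<And>x. x \<in> vecs X \<Longrightarrow> f x = 0"
  shows "nrm (dual X) f = 0"
proof (rule antisym)
  show "nrm (dual X) f \<le> 0" using assms by (intro dual_nrm_le) auto
  have "f \<in> vecs (dual X)"
    by (rule in_dualI[where C=0]) (use assms homogeneousD(2,3)[OF assms(1)] in auto)
  then show "0 \<le> nrm (dual X) f" by (rule dual_nrm_nonneg[OF assms(1)])
qed

text \<open>Evaluations are among the functionals that define the weak norm on a dual space, and so
  bound it from below.\<close>

lemma eval_in_bidual:
  assumes X: "homogeneous X" and x: "x \<in> vecs X" "nrm X x \<le> 1"
  shows "(\<lambda>f. f x) \<in> vecs (dual (dual X))" "nrm (dual (dual X)) (\<lambda>f. f x) \<le> 1"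
proof -
  have le: "cmod (f x) \<le> nrm (dual X) f" if f: "f \<in> vecs (dual X)" for f
  proof -
    have "cmod (f x) \<le> nrm (dual X) f * nrm X x" using dual_bound[OF X f x(1)] .
    also have "\<dots> \<le> nrm (dual X) f" using x dual_nrm_nonneg[OF X f] by (simp add: mult_left_le)
    finally show ?thesis .
  qed
  show "(\<lambda>f. f x) \<in> vecs (dual (dual X))"
    by (rule in_dualI[where C=1]) (use le in \<open>auto simp: cscale_def\<close>)
  show "nrm (dual (dual X)) (\<lambda>f. f x) \<le> 1"
    by (rule dual_nrm_le[OF homogeneous_dual[OF X]]) (use le order_trans in blast)
qed

lemma map_conv_nth: "map f xs = map (\<lambda>i. f (xs ! i)) [0..<length xs]"
  by (rule nth_equalityI) auto

lemma lnorm_mono: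
  assumes "1 \<le> s" "\<And>x. x \<in> set xs \<Longrightarrow> cmod (f x) \<le> cmod (g x)"
  shows "lnorm s (map f xs) \<le> lnorm s (map g xs)"
proof -
  have "lnorm s (map (\<lambda>i. f (xs ! i)) [0..<length xs]) \<le> lnorm s (map (\<lambda>i. g (xs ! i)) [0..<length xs])"
  proof (subst lnorm_le_iff[OF assms(1) lnorm_nonneg], rule Lp_bound_dominated)
    show "Lp_bound s (count_space {..<length xs}) (\<lambda>i. g (xs ! i)) (lnorm s (map (\<lambda>i. g (xs ! i)) [0..<length xs]))"
      using lnorm_le_iff[OF assms(1) lnorm_nonneg] by blast
  qed (use assms(2) in \<open>auto simp: AE_count_space\<close>)
  then show ?thesis by (simp flip: map_conv_nth)
qed

lemma lnorm_scale:
  assumes "1 \<le> s" "0 \<le> c"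
  shows "lnorm s (map (\<lambda>x. of_real c * f x) xs) \<le> c * lnorm s (map f xs)"
proof -
  have "Lp_bound s (count_space {..<length xs}) (\<lambda>i. f (xs ! i)) (lnorm s (map f xs))"
    unfolding map_conv_nth[of f xs] using lnorm_le_iff[OF assms(1) lnorm_nonneg] by blast
  from Lp_bound_scale[OF this, of "of_real c"] show ?thesis
    unfolding map_conv_nth[of "\<lambda>x. of_real c * f x" xs] using assms
    by (subst lnorm_le_iff) (auto simp: lnorm_nonneg)
qed

text \<open>The supremum is a real one and has to be shown bounded: functionals of norm at most 1
  satisfy |f x| <= \<open>nrm X x\<close> entry by entry.\<close>

lemma weak_norm_ge:
  assumes X: "homogeneous X" and s: "1 \<le> s" and xs: "set xs \<subseteq> vecs X"
    and f: "f \<in> vecs (dual X)" "nrm (dual X) f \<le> 1"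
  shows "lnorm s (map f xs) \<le> weak_norm s X xs"
  unfolding weak_norm_def
proof (rule cSUP_upper)
  show "bdd_above ((\<lambda>f. lnorm s (map f xs)) ` {f \<in> vecs (dual X). nrm (dual X) f \<le> 1})"
  proof (rule bdd_aboveI2)
    fix f assume f: "f \<in> {f \<in> vecs (dual X). nrm (dual X) f \<le> 1}"
    show "lnorm s (map f xs) \<le> lnorm s (map (\<lambda>x. of_real (nrm X x)) xs)"
    proof (rule lnorm_mono[OF s])
      fix x assume "x \<in> set xs"
      then have x: "x \<in> vecs X" using xs by auto
      have "cmod (f x) \<le> nrm (dual X) f * nrm X x" using dual_bound[OF X _ x] f by auto
      also have "\<dots> \<le> 1 * nrm X x" using f homogeneousD(4)[OF X x] by (intro mult_right_mono) auto
      finally show "cmod (f x) \<le> cmod (of_real (nrm X x))" by simp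
    qed
  qed
qed (use f in auto)

lemma zero_functional:
  assumes "homogeneous X"
  shows "(\<lambda>x. 0) \<in> vecs (dual X)" "nrm (dual X) (\<lambda>x. 0) \<le> 1"
proof -
  show "(\<lambda>x. 0) \<in> vecs (dual X)" by (rule in_dualI[where C=0]) auto
  show "nrm (dual X) (\<lambda>x. 0) \<le> 1" by (rule dual_nrm_le[OF assms]) auto
qed

lemma weak_norm_nonneg:
  assumes "homogeneous X" "1 \<le> s" "set xs \<subseteq> vecs X" shows "0 \<le> weak_norm s X xs"
  using weak_norm_ge[OF assms zero_functional[OF assms(1)]] lnorm_nonneg order_trans by blast

lemma weak_norm_le:
  assumes "homogeneous X"
    and "\<And>f. f \<in> vecs (dual X) \<Longrightarrow> nrm (dual X) f \<le> 1 \<Longrightarrow> lnorm s (map f xs) \<le> K"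
  shows "weak_norm s X xs \<le> K"
  unfolding weak_norm_def using zero_functional[OF assms(1)] assms(2) by (intro cSUP_least) auto

lemma functional_sum:
  assumes X: "homogeneous X" and F: "F \<in> vecs (dual X)" and S: "finite S" and x: "\<And>i. i \<in> S \<Longrightarrow> x i \<in> vecs X"
  shows "(\<lambda>t. \<Sum>i\<in>S. k i * x i t) \<in> vecs X" "F (\<lambda>t. \<Sum>i\<in>S. k i * x i t) = (\<Sum>i\<in>S. k i * F (x i))"
proof -
  have "(\<lambda>t. \<Sum>i\<in>S. k i * x i t) \<in> vecs X \<and> F (\<lambda>t. \<Sum>i\<in>S. k i * x i t) = (\<Sum>i\<in>S. k i * F (x i))"
    using S x
  proof (induction S rule: finite_induct)
    case empty
    have "F (cscale 0 0) = 0 * F 0" using in_dualD(2)[OF F] homogeneousD(1)[OF X] by blast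
    then show ?case using homogeneousD(1)[OF X] by (simp add: zero_fun_def)
  next
    case (insert a S)
    have e: "(\<lambda>t. \<Sum>i\<in>insert a S. k i * x i t) = cscale (k a) (x a) + (\<lambda>t. \<Sum>i\<in>S. k i * x i t)"
      using insert by (simp add: cscale_def fun_eq_iff)
    have IH: "(\<lambda>t. \<Sum>i\<in>S. k i * x i t) \<in> vecs X" "F (\<lambda>t. \<Sum>i\<in>S. k i * x i t) = (\<Sum>i\<in>S. k i * F (x i))"
      using insert by auto
    have xa: "x a \<in> vecs X" using insert.prems by simp
    show ?case unfolding e
      using IH homogeneousD(2,3)[OF X] xa in_dualD[OF F] insert.hyps by simp
  qed
  then show "(\<lambda>t. \<Sum>i\<in>S. k i * x i t) \<in> vecs X" "F (\<lambda>t. \<Sum>i\<in>S. k i * x i t) = (\<Sum>i\<in>S. k i * F (x i))"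
    by auto
qed

text \<open>The weak norm in a dual is a supremum over the bidual, but points of X suffice. Duality
  of ell^s moves F outside the sum, to the functional with terms \<open>k i * (fs ! i) x\<close>,
  whose norm is computed on the ball of X. This takes the place of Goldstine's theorem.\<close>

lemma weak_norm_dual_le:
  assumes X: "homogeneous X" and fs: "set fs \<subseteq> vecs (dual X)" and s: "1 \<le> s" and K: "0 \<le> K"
    and le: "\<And>k x. lnorm (conj_exp s) (map k [0..<length fs]) \<le> 1 \<Longrightarrow> x \<in> vecs X \<Longrightarrow> nrm X x \<le> 1 \<Longrightarrow>
      cmod (\<Sum>i<length fs. k i * (fs ! i) x) \<le> K"
  shows "weak_norm s (dual X) fs \<le> K"
proof (rule weak_norm_le[OF homogeneous_dual[OF X]])
  fix F assume F: "F \<in> vecs (dual (dual X))" "nrm (dual (dual X)) F \<le> 1"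
  have "lnorm s (map (\<lambda>i. F (fs ! i)) [0..<length fs]) \<le> K"
  proof (rule lnorm_dual[OF s K])
    fix k assume k: "lnorm (conj_exp s) (map k [0..<length fs]) \<le> 1"
    let ?g = "\<lambda>x. \<Sum>i<length fs. k i * (fs ! i) x"
    have g: "?g \<in> vecs (dual X)" "F ?g = (\<Sum>i<length fs. k i * F (fs ! i))"
      using functional_sum[OF homogeneous_dual[OF X] F(1), of "{..<length fs}" "\<lambda>i. fs ! i" k] fs
      by (auto simp: subset_iff)
    have "cmod (F ?g) \<le> nrm (dual (dual X)) F * nrm (dual X) ?g"
      by (rule dual_bound[OF homogeneous_dual[OF X] F(1) g(1)])
    also have "\<dots> \<le> 1 * nrm (dual X) ?g" using F dual_nrm_nonneg[OF X g(1)] by (intro mult_right_mono) auto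
    also have "nrm (dual X) ?g \<le> K" using le[OF k] by (intro dual_nrm_le[OF X])
    finally show "cmod (\<Sum>i<length fs. F (fs ! i) * k i) \<le> K" using g(2) by (simp add: mult.commute)
  qed
  then show "lnorm s (map F fs) \<le> K" by (simp flip: map_conv_nth)
qed

section \<open>Tensors and their pairing with tensors of functionals\<close>

lemma tensor_eq_refl [simp]: "tensor_eq X Y z z"
  by (simp add: tensor_eq_def)

lemma norm_sum_list: "cmod (\<Sum>x\<leftarrow>xs. f x) \<le> (\<Sum>x\<leftarrow>xs. cmod (f x))"
  by (induction xs) (auto intro: norm_triangle_le)

text \<open>This makes the pairing independent of the list chosen for the tensor of functionals,
  being one of the forms that \<open>tensor_eq\<close> compares.\<close>

lemma bilinear_form_pairing:
  assumes M: "homogeneous M" "homogeneous N" and z: "set z \<subseteq> vecs M \<times> vecs N"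
  shows "bilinear_form (dual M) (dual N) (\<lambda>f g. \<Sum>(x, y)\<leftarrow>z. f x * g y)"
  unfolding bilinear_form_def linear_functional_def
proof (intro conjI ballI allI impI)
  fix f g assume f: "f \<in> vecs (dual M)" and g: "g \<in> vecs (dual N)" and n: "nrm (dual M) f = 0 \<or> nrm (dual N) g = 0"
  have "f x * g y = 0" if "(x, y) \<in> set z" for x y
    using dual_bound[OF M(1) f, of x] dual_bound[OF M(2) g, of y] that z n by auto
  then have "(\<Sum>(x, y)\<leftarrow>z. f x * g y) = (\<Sum>(x, y)\<leftarrow>z. 0)"
    by (intro arg_cong[where f=sum_list] map_cong) auto
  then show "(\<Sum>(x, y)\<leftarrow>z. f x * g y) = 0" by (simp add: case_prod_unfold)
qed (simp_all add: case_prod_unfold plus_fun_def cscale_def distrib_left distrib_right sum_list_addf sum_list_const_mult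
       mult.assoc mult.left_commute[of _ "_ :: complex"] del: mult.left_commute)

lemma pairing_eq_sum: "pairing v z = (\<Sum>(f, g)\<leftarrow>v. (\<lambda>f g. \<Sum>(x, y)\<leftarrow>z. f x * g y) f g)"
  by (simp add: pairing_def)

lemma pairing_tensor_eq:
  assumes "homogeneous M" "homogeneous N" "set z \<subseteq> vecs M \<times> vecs N" "tensor_eq (dual M) (dual N) v w"
  shows "pairing v z = pairing w z"
  using assms(4) bilinear_form_pairing[OF assms(1-3)] unfolding tensor_eq_def pairing_eq_sum by blast

lemma pairing_map:
  "pairing (map (\<lambda>(c, f, g). (cscale c f, g)) ts) z = (\<Sum>(c, f, g)\<leftarrow>ts. \<Sum>(x, y)\<leftarrow>z. c * f x * g y)"
  by (simp add: pairing_def cscale_def case_prod_unfold comp_def)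

text \<open>Evaluation at the normalized x is a bidual functional of norm at most 1. If x has
  seminorm 0, every value f x is 0.\<close>

lemma lnorm_eval_le:
  assumes M: "homogeneous M" and s: "1 \<le> s" and x: "x \<in> vecs M" and fs: "set fs \<subseteq> vecs (dual M)"
  shows "lnorm s (map (\<lambda>f. f x) fs) \<le> weak_norm s (dual M) fs * nrm M x"
proof -
  let ?n = "nrm M x"
  have n: "0 \<le> ?n" using homogeneousD(4)[OF M x] .
  let ?y = "cscale (1 / of_real ?n) x"
  have y: "?y \<in> vecs M" "nrm M ?y \<le> 1"
    using homogeneousD(3,5)[OF M x] n by (auto simp: norm_divide)
  have "cmod (f x) \<le> cmod (of_real ?n * f ?y)" if "f \<in> set fs" for f
  proof -
    have f: "f \<in> vecs (dual M)" using that fs by auto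
    show ?thesis using in_dualD(2)[OF f x] dual_bound[OF M f x] by (cases "?n = 0") auto
  qed
  then have "lnorm s (map (\<lambda>f. f x) fs) \<le> lnorm s (map (\<lambda>f. of_real ?n * f ?y) fs)"
    by (intro lnorm_mono s)
  also have "\<dots> \<le> ?n * lnorm s (map (\<lambda>f. f ?y) fs)" by (rule lnorm_scale[OF s n])
  also have "\<dots> \<le> ?n * weak_norm s (dual M) fs"
    using weak_norm_ge[OF homogeneous_dual[OF M] s fs eval_in_bidual[OF M y]] n by (intro mult_left_mono)
  finally show ?thesis by (simp add: mult.commute)
qed

section \<open>The norm \<alpha> and its dual for the exponents q and p'\<close>

locale exponents =
  fixes p q :: ennreal
  assumes q1: "1 \<le> q" and qp: "q \<le> p"
begin

definition r :: ennreal where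
  "r = inverse (inverse q + inverse (conj_exp p) - 1)"

lemma p1: "1 \<le> p"
  using q1 qp by simp

lemma r1: "1 \<le> r"
  unfolding r_def by (rule alpha_exponent[OF q1 qp])

lemma q'1: "1 \<le> conj_exp q"
  by (rule conj_exp_ge_1[OF q1])

lemma exponent_sum: "iexp r + iexp p + iexp (conj_exp q) = 1"
  using alpha_exponent(2)[OF q1 qp] q1 by (simp add: r_def iexp_conj_exp)

text \<open>The cost of a representation in the infimum defining \<alpha> with a = q and b = p', so
  that b' = p and a' = q'.\<close>

definition val where
  "val X Y ts = lnorm r (map (\<lambda>(c, x, y). c) ts) * weak_norm p X (map (\<lambda>(c, x, y). x) ts)
          * weak_norm (conj_exp q) Y (map (\<lambda>(c, x, y). y) ts)"

lemma alpha_eq: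
  "alpha q (conj_exp p) X Y z = Inf {val X Y ts | ts. set ts \<subseteq> UNIV \<times> vecs X \<times> vecs Y \<and>
          tensor_eq X Y z (map (\<lambda>(c, x, y). (cscale c x, y)) ts)}"
  by (simp add: alpha_def val_def r_def conj_exp_conj_exp[OF p1])

lemma val_nonneg:
  assumes "homogeneous X" "homogeneous Y" "set ts \<subseteq> UNIV \<times> vecs X \<times> vecs Y"
  shows "0 \<le> val X Y ts"
  unfolding val_def using assms(3)
  by (intro mult_nonneg_nonneg lnorm_nonneg weak_norm_nonneg assms p1 q'1) auto

lemma alpha_le:
  assumes XY: "homogeneous X" "homogeneous Y" and ts: "set ts \<subseteq> UNIV \<times> vecs X \<times> vecs Y"
  shows "alpha q (conj_exp p) X Y (map (\<lambda>(c, x, y). (cscale c x, y)) ts) \<le> val X Y ts"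
  unfolding alpha_eq
proof (rule cInf_lower)
  show "bdd_below {val X Y ts' |ts'. set ts' \<subseteq> UNIV \<times> vecs X \<times> vecs Y \<and>
     tensor_eq X Y (map (\<lambda>(c, x, y). (cscale c x, y)) ts) (map (\<lambda>(c, x, y). (cscale c x, y)) ts')}"
    using val_nonneg[OF XY] by (intro bdd_belowI[of _ 0]) auto
qed (use ts in auto)

text \<open>The infimum runs over a nonempty set: z itself with coefficients 1 is a representation.
  The factor c stays outside so that c = 0 is covered.\<close>

lemma le_alpha:
  assumes z: "set z \<subseteq> vecs X \<times> vecs Y" and c: "0 \<le> c"
    and le: "\<And>ts. set ts \<subseteq> UNIV \<times> vecs X \<times> vecs Y \<Longrightarrow>
      tensor_eq X Y z (map (\<lambda>(c, x, y). (cscale c x, y)) ts) \<Longrightarrow> K \<le> c * val X Y ts"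
  shows "K \<le> c * alpha q (conj_exp p) X Y z"
proof -
  let ?S = "{val X Y ts | ts. set ts \<subseteq> UNIV \<times> vecs X \<times> vecs Y \<and>
          tensor_eq X Y z (map (\<lambda>(c, x, y). (cscale c x, y)) ts)}"
  let ?ts = "map (\<lambda>(x, y). (1, x, y)) z"
  have "map (\<lambda>(c, x, y). (cscale c x, y)) ?ts = z"
    by (simp add: cscale_def case_prod_unfold comp_def)
  moreover have "set ?ts \<subseteq> UNIV \<times> vecs X \<times> vecs Y" using z by auto
  ultimately have ts: "set ?ts \<subseteq> UNIV \<times> vecs X \<times> vecs Y"
    "tensor_eq X Y z (map (\<lambda>(c, x, y). (cscale c x, y)) ?ts)" by auto
  then have ne: "?S \<noteq> {}" by blast
  show ?thesis
  proof (cases "c = 0")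
    case True
    then show ?thesis using le[OF ts] by simp
  next
    case False
    then have c: "0 < c" using assms by simp
    have "K / c \<le> Inf ?S"
      using ne by (rule cInf_greatest) (use le c in \<open>auto simp: divide_le_eq mult.commute\<close>)
    then show ?thesis using c by (simp add: alpha_eq divide_le_eq mult.commute)
  qed
qed

text \<open>A crude bound, there to make the supremum in \<open>alpha_dual_fd\<close> finite. Each
  entry of z is estimated by Hoelder's inequality with the exponents r, p, q'.\<close>

lemma pairing_le:
  assumes M: "homogeneous M" "homogeneous N" and z: "set z \<subseteq> vecs M \<times> vecs N"
    and v: "set v \<subseteq> vecs (dual M) \<times> vecs (dual N)"
  shows "cmod (pairing v z) \<le> (\<Sum>(x, y)\<leftarrow>z. nrm M x * nrm N y) * alpha q (conj_exp p) (dual M) (dual N) v"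
proof (rule le_alpha[OF v])
  show "0 \<le> (\<Sum>(x, y)\<leftarrow>z. nrm M x * nrm N y)"
    using z homogeneousD(4)[OF M(1)] homogeneousD(4)[OF M(2)]
    by (intro sum_list_nonneg) (auto intro!: mult_nonneg_nonneg)
  fix ts assume ts: "set ts \<subseteq> UNIV \<times> vecs (dual M) \<times> vecs (dual N)"
    and eq: "tensor_eq (dual M) (dual N) v (map (\<lambda>(c, x, y). (cscale c x, y)) ts)"
  let ?c = "\<lambda>(c, f, g). c" and ?f = "\<lambda>(c, f, g). f" and ?g = "\<lambda>(c, f, g). g"
  have one: "cmod (\<Sum>(c, f, g)\<leftarrow>ts. c * f x * g y) \<le> nrm M x * nrm N y * val (dual M) (dual N) ts"
    if xy: "(x, y) \<in> set z" for x y
  proof -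
    have x: "x \<in> vecs M" and y: "y \<in> vecs N" using xy z by auto
    have fs: "set (map ?f ts) \<subseteq> vecs (dual M)" "set (map ?g ts) \<subseteq> vecs (dual N)" using ts by auto
    have "cmod (\<Sum>(c, f, g)\<leftarrow>ts. c * f x * g y) \<le> (\<Sum>t\<leftarrow>ts. cmod (?c t * ?f t x * ?g t y))"
      using norm_sum_list[of "\<lambda>(c, f, g). c * f x * g y" ts] by (simp add: case_prod_unfold)
    also have "\<dots> \<le> lnorm r (map ?c ts) * lnorm p (map (\<lambda>t. ?f t x) ts) * lnorm (conj_exp q) (map (\<lambda>t. ?g t y) ts)"
      by (rule Holder3_list[OF r1 p1 q'1 exponent_sum])
    also have "\<dots> \<le> lnorm r (map ?c ts) * (weak_norm p (dual M) (map ?f ts) * nrm M x)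
        * (weak_norm (conj_exp q) (dual N) (map ?g ts) * nrm N y)"
      using lnorm_eval_le[OF M(1) p1 x fs(1)] lnorm_eval_le[OF M(2) q'1 y fs(2)]
      by (intro mult_mono mult_nonneg_nonneg lnorm_nonneg weak_norm_nonneg homogeneous_dual M p1 q'1 fs
          homogeneousD(4)[OF M(1) x]) (auto simp: comp_def)
    also have "\<dots> = nrm M x * nrm N y * val (dual M) (dual N) ts" by (simp add: val_def)
    finally show ?thesis .
  qed
  have "pairing v z = (\<Sum>(c, f, g)\<leftarrow>ts. \<Sum>(x, y)\<leftarrow>z. c * f x * g y)"
    using pairing_tensor_eq[OF M z eq] pairing_map by simp
  also have "\<dots> = (\<Sum>(x, y)\<leftarrow>z. \<Sum>(c, f, g)\<leftarrow>ts. c * f x * g y)"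
    by (simp add: case_prod_unfold sum_list_sum_nth atLeast0LessThan) (rule sum.swap)
  finally have "cmod (pairing v z) \<le> (\<Sum>(x, y)\<leftarrow>z. cmod (\<Sum>(c, f, g)\<leftarrow>ts. c * f x * g y))"
    using norm_sum_list[of "\<lambda>(x, y). \<Sum>(c, f, g)\<leftarrow>ts. c * f x * g y" z] by (simp add: case_prod_unfold)
  also have "\<dots> \<le> (\<Sum>(x, y)\<leftarrow>z. nrm M x * nrm N y * val (dual M) (dual N) ts)"
    using one by (intro sum_list_mono) auto
  also have "\<dots> = (\<Sum>(x, y)\<leftarrow>z. nrm M x * nrm N y) * val (dual M) (dual N) ts"
    by (simp add: case_prod_unfold sum_list_mult_const)
  finally show "cmod (pairing v z) \<le> (\<Sum>(x, y)\<leftarrow>z. nrm M x * nrm N y) * val (dual M) (dual N) ts" .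
qed

lemma alpha_dual_fd_ge:
  assumes M: "homogeneous M" "homogeneous N" and z: "set z \<subseteq> vecs M \<times> vecs N"
    and v: "set v \<subseteq> vecs (dual M) \<times> vecs (dual N)" "alpha q (conj_exp p) (dual M) (dual N) v \<le> 1"
  shows "cmod (pairing v z) \<le> alpha_dual_fd q (conj_exp p) M N z"
  unfolding alpha_dual_fd_def
proof (rule cSUP_upper)
  have nn: "0 \<le> (\<Sum>(x, y)\<leftarrow>z. nrm M x * nrm N y)"
    using z homogeneousD(4)[OF M(1)] homogeneousD(4)[OF M(2)]
    by (intro sum_list_nonneg) (auto intro!: mult_nonneg_nonneg)
  show "bdd_above ((\<lambda>v. cmod (pairing v z)) ` {v. set v \<subseteq> vecs (dual M) \<times> vecs (dual N) \<and> alpha q (conj_exp p) (dual M) (dual N) v \<le> 1})"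
  proof (rule bdd_aboveI2)
    fix v assume v: "v \<in> {v. set v \<subseteq> vecs (dual M) \<times> vecs (dual N) \<and> alpha q (conj_exp p) (dual M) (dual N) v \<le> 1}"
    then have "cmod (pairing v z) \<le> (\<Sum>(x, y)\<leftarrow>z. nrm M x * nrm N y) * alpha q (conj_exp p) (dual M) (dual N) v"
      using pairing_le[OF M z] by auto
    also have "\<dots> \<le> (\<Sum>(x, y)\<leftarrow>z. nrm M x * nrm N y)" using v nn by (simp add: mult_left_le)
    finally show "cmod (pairing v z) \<le> (\<Sum>(x, y)\<leftarrow>z. nrm M x * nrm N y)" .
  qed
qed (use v in auto)

lemma alpha_Nil_le_1:
  assumes "homogeneous X" "homogeneous Y" shows "alpha q (conj_exp p) X Y [] \<le> 1"
proof -
  have "alpha q (conj_exp p) X Y [] \<le> val X Y []" using alpha_le[OF assms, of "[]"] by simp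
  also have "val X Y [] = 0" by (simp add: val_def lnorm_def)
  finally show ?thesis by simp
qed

lemma alpha_dual_fd_nonneg:
  assumes "homogeneous M" "homogeneous N" "set z \<subseteq> vecs M \<times> vecs N"
  shows "0 \<le> alpha_dual_fd q (conj_exp p) M N z"
  using alpha_dual_fd_ge[OF assms, of "[]"] alpha_Nil_le_1[OF homogeneous_dual homogeneous_dual] assms
  by (auto simp: pairing_def)

lemma alpha_dual_fd_le:
  assumes M: "homogeneous M" "homogeneous N"
    and "\<And>v. set v \<subseteq> vecs (dual M) \<times> vecs (dual N) \<Longrightarrow> alpha q (conj_exp p) (dual M) (dual N) v \<le> 1 \<Longrightarrow>
      cmod (pairing v z) \<le> K"
  shows "alpha_dual_fd q (conj_exp p) M N z \<le> K"
  unfolding alpha_dual_fd_def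
proof (rule cSUP_least)
  show "{v. set v \<subseteq> vecs (dual M) \<times> vecs (dual N) \<and> alpha q (conj_exp p) (dual M) (dual N) v \<le> 1} \<noteq> {}"
    using alpha_Nil_le_1[OF homogeneous_dual[OF M(1)] homogeneous_dual[OF M(2)]] by (auto intro!: exI[of _ "[]"])
qed (use assms in auto)

lemma alpha_dual_le:
  assumes X: "homogeneous X" "homogeneous Y" and fd: "fd_subspace X M" "fd_subspace Y N"
    and w: "set w \<subseteq> vecs M \<times> vecs N" "tensor_eq X Y z w"
  shows "alpha_dual q (conj_exp p) X Y z \<le> alpha_dual_fd q (conj_exp p) M N w"
  unfolding alpha_dual_def
proof (rule cInf_lower)
  show "bdd_below {alpha_dual_fd q (conj_exp p) M N w |M N w.
      fd_subspace X M \<and> fd_subspace Y N \<and> set w \<subseteq> vecs M \<times> vecs N \<and> tensor_eq X Y z w}"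
    using alpha_dual_fd_nonneg[OF fd_subspaceD(1)[OF _ X(1)] fd_subspaceD(1)[OF _ X(2)]]
    by (intro bdd_belowI[of _ 0]) auto
qed (use fd w in auto)

text \<open>The spans of the entries of z are one admissible pair of subspaces, so the infimum runs
  over a nonempty set.\<close>

lemma le_alpha_dual:
  assumes X: "homogeneous X" "homogeneous Y" and z: "set z \<subseteq> vecs X \<times> vecs Y" and c: "0 \<le> c"
    and le: "\<And>M N w. fd_subspace X M \<Longrightarrow> fd_subspace Y N \<Longrightarrow> set w \<subseteq> vecs M \<times> vecs N \<Longrightarrow> tensor_eq X Y z w \<Longrightarrow>
      K \<le> c * alpha_dual_fd q (conj_exp p) M N w"
  shows "K \<le> c * alpha_dual q (conj_exp p) X Y z"
proof -
  let ?S = "{alpha_dual_fd q (conj_exp p) M N w |M N w.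
      fd_subspace X M \<and> fd_subspace Y N \<and> set w \<subseteq> vecs M \<times> vecs N \<and> tensor_eq X Y z w}"
  let ?M = "X\<lparr>vecs := cfun.span (fst ` set z)\<rparr>" and ?N = "Y\<lparr>vecs := cfun.span (snd ` set z)\<rparr>"
  have fd: "fd_subspace X ?M" "fd_subspace Y ?N"
    using z X by (auto intro!: fd_subspace_span)
  have zMN: "set z \<subseteq> vecs ?M \<times> vecs ?N"
    by (auto intro!: cfun.span_base image_eqI)
  show ?thesis
  proof (cases "c = 0")
    case True
    then show ?thesis using le[OF fd zMN] by simp
  next
    case False
    then have c: "0 < c" using assms by simp
    have "?S \<noteq> {}" using fd zMN by (auto intro!: exI[of _ ?M] exI[of _ ?N] exI[of _ z])
    then have "K / c \<le> Inf ?S"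
      by (rule cInf_greatest) (use le c in \<open>auto simp: divide_le_eq mult.commute\<close>)
    then show ?thesis using c by (simp add: alpha_dual_def divide_le_eq mult.commute)
  qed
qed

end

section \<open>Step functions and averages in Lebesgue spaces\<close>

definition step_fun :: "'a set set \<Rightarrow> ('a set \<Rightarrow> complex) \<Rightarrow> 'a \<Rightarrow> complex" where
  "step_fun \<A> c = (\<lambda>s. \<Sum>A\<in>\<A>. c A * indicator A s)"

lemma step_fun_in:
  "finite_partition M \<A> \<Longrightarrow> A \<in> \<A> \<Longrightarrow> s \<in> A \<Longrightarrow> step_fun \<A> c s = c A"
  unfolding step_fun_def by (rule sum_indicator_partition)

lemma step_fun_out:
  "finite_partition M \<A> \<Longrightarrow> s \<notin> \<Union>\<A> \<Longrightarrow> step_fun \<A> c s = 0"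
  unfolding step_fun_def by (rule sum_indicator_partition)

lemma step_fun_measurable:
  "finite_partition M \<A> \<Longrightarrow> step_fun \<A> c \<in> borel_measurable M"
  unfolding step_fun_def
  by (intro borel_measurable_sum borel_measurable_times borel_measurable_const borel_measurable_indicator)
    (rule finite_partition_sets)

lemma norm_step_fun_powr:
  assumes "finite_partition M \<A>"
  shows "cmod (step_fun \<A> c s) powr t = (\<Sum>A\<in>\<A>. cmod (c A) powr t * indicator A s)"
proof (cases "s \<in> \<Union>\<A>")
  case True
  then obtain A where "A \<in> \<A>" "s \<in> A" by auto
  then show ?thesis
    using sum_indicator_partition(1)[OF assms, of s A "\<lambda>A. cmod (c A) powr t"] step_fun_in[OF assms]
    by simp
next
  case False
  then show ?thesis
    using sum_indicator_partition(2)[OF assms, of s "\<lambda>A. cmod (c A) powr t"] step_fun_out[OF assms]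
    by simp
qed

text \<open>An indicator has L^s norm equal to its measure to the power 1/s; normalization lowers
  the exponent by 1, also for s = infinity.\<close>

lemma unit_ind_Lp_bound:
  assumes s: "1 \<le> s" and A: "A \<in> sets M" "emeasure M A < \<infinity>" "0 < measure M A"
  shows "Lp_bound s M (unit_ind M A) (measure M A powr (iexp s - 1))"
proof -
  have m: "unit_ind M A \<in> borel_measurable M" using integrable_unit_ind[OF A(1,2)] by auto
  have n: "cmod (unit_ind M A x) = indicator A x / measure M A" for x
    using A by (simp add: unit_ind_def norm_divide indicator_def)
  show ?thesis
  proof (cases "s = \<infinity>")
    case True
    then show ?thesis using m A
      by (auto simp: Lp_bound_def n indicator_def powr_minus_divide)
  next
    case False
    let ?s = "enn2real s"
    have s1: "1 \<le> ?s" using enn2real_ge_1[OF s False] .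
    have "cmod (unit_ind M A x) powr ?s = indicator A x * (1 / measure M A) powr ?s" for x
      unfolding n by (simp add: indicator_def)
    moreover have "integrable M (\<lambda>x. indicator A x * (1 / measure M A) powr ?s)"
      using A by (intro integrable_mult_left) (simp add: integrable_indicator_iff)
    moreover have "(LINT x|M. indicator A x * (1 / measure M A) powr ?s) = measure M A * (1 / measure M A) powr ?s"
      using A by simp
    moreover have "measure M A * (1 / measure M A) powr ?s = (measure M A powr (iexp s - 1)) powr ?s"
    proof -
      have e: "(iexp s - 1) * ?s = 1 + - ?s" using s1 by (simp add: iexp_finite[OF s False] left_diff_distrib)
      have "(measure M A powr (iexp s - 1)) powr ?s = measure M A powr (1 + - ?s)"
        unfolding powr_powr e ..
      also have "\<dots> = measure M A * (1 / measure M A) powr ?s"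
        unfolding powr_add using A by (simp add: powr_minus_divide powr_divide)
      finally show ?thesis ..
    qed
    ultimately show ?thesis using False m by (simp add: Lp_bound_def)
  qed
qed

lemma unit_ind_in_Lp:
  "1 \<le> s \<Longrightarrow> A \<in> sets M \<Longrightarrow> emeasure M A < \<infinity> \<Longrightarrow> 0 < measure M A \<Longrightarrow> unit_ind M A \<in> vecs (Lp s M)"
  using unit_ind_Lp_bound vecs_Lp_iff by metis

lemma average_bound:
  assumes p: "1 \<le> p" and A: "A \<in> sets M" "emeasure M A < \<infinity>" "0 < measure M A" and f: "Lp_bound p M f c"
  shows "cmod (LINT s|M. unit_ind M A s * f s) \<le> measure M A powr (- iexp p) * c"
  using Holder(3)[OF p unit_ind_Lp_bound[OF conj_exp_ge_1[OF p] A] f] by (simp add: iexp_conj_exp p)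

text \<open>Hoelder's inequality on A alone: f is first cut off to A, so that only its norm over A
  enters.\<close>

lemma Jensen_average:
  assumes p: "1 \<le> p" "p \<noteq> \<infinity>" and A: "A \<in> sets M" "emeasure M A < \<infinity>" "0 < measure M A"
    and f: "f \<in> vecs (Lp p M)"
  shows "measure M A * cmod (LINT s|M. unit_ind M A s * f s) powr enn2real p
    \<le> (LINT s|M. indicator A s * cmod (f s) powr enn2real p)"
proof -
  let ?p = "enn2real p" let ?f = "\<lambda>s. indicator A s * f s"
  let ?S = "LINT s|M. indicator A s * cmod (f s) powr ?p"
  have p1: "1 \<le> ?p" using enn2real_ge_1[OF p] .
  have [measurable]: "f \<in> borel_measurable M" "A \<in> sets M"
    and i: "integrable M (\<lambda>s. cmod (f s) powr ?p)" using f p A by (auto simp: Lp_def)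
  have e: "cmod (?f s) powr ?p = indicator A s * cmod (f s) powr ?p" for s
    by (simp add: indicator_def)
  have S0: "0 \<le> ?S" by (intro integral_nonneg_AE) auto
  have SS: "(?S powr iexp p) powr ?p = ?S" using powr_iexp_powr[OF p S0] .
  have fb: "Lp_bound p M ?f (?S powr iexp p)"
    unfolding Lp_bound_def e using p integrable_indicator_mult[OF i A(1)] SS by auto
  have "(\<lambda>s. unit_ind M A s * ?f s) = (\<lambda>s. unit_ind M A s * f s)"
    by (simp add: unit_ind_def indicator_def fun_eq_iff)
  from average_bound[OF p(1) A fb, unfolded this]
  have "cmod (LINT s|M. unit_ind M A s * f s) powr ?p \<le> (measure M A powr (- iexp p) * ?S powr iexp p) powr ?p"
    using p1 by (intro powr_mono2) auto
  also have "\<dots> = ?S / measure M A"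
    using powr_neg_iexp_powr[OF p A(3)] SS by (simp add: powr_mult)
  finally show ?thesis using A(3) by (simp add: le_divide_eq mult.commute)
qed

text \<open>The case \<open>p = \<infinity>\<close> is separate because \<open>0 powr 0 = 0\<close>.\<close>

definition step_weight :: "ennreal \<Rightarrow> 'a measure \<Rightarrow> ('a set \<Rightarrow> real) \<Rightarrow> 'a set \<Rightarrow> real" where
  "step_weight p M h A = (if p = \<infinity> then 1 else (h A / measure M A) powr iexp p)"

text \<open>For finite p the p-th power of the weight is the density
  \<open>h A / measure M A\<close>, which integrates to \<open>h A\<close> over A.\<close>

lemma step_weight_bound:
  assumes P: "finite_partition M \<A>" and p: "1 \<le> p" and h: "\<And>A. A \<in> \<A> \<Longrightarrow> 0 \<le> h A" "sum h \<A> \<le> 1"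
  shows "Lp_bound p M (step_fun \<A> (\<lambda>A. of_real (step_weight p M h A))) 1"
proof (cases "p = \<infinity>")
  case True
  have "cmod (step_fun \<A> (\<lambda>A. of_real (step_weight p M h A)) s) \<le> 1" for s
    using step_fun_in[OF P, of _ s] step_fun_out[OF P, of s] True
    by (cases "s \<in> \<Union>\<A>") (auto simp: step_weight_def)
  then show ?thesis using True step_fun_measurable[OF P] by (simp add: Lp_bound_def)
next
  case False
  let ?p = "enn2real p"
  have d: "cmod (of_real (step_weight p M h A)) powr ?p = h A / measure M A" if "A \<in> \<A>" for A
    using False p h(1)[OF that] finite_partition_sets(3)[OF P that] by (simp add: step_weight_def powr_iexp_powr)
  have i: "integrable M (\<lambda>s. cmod (of_real (step_weight p M h A)) powr ?p * indicator A s)" if "A \<in> \<A>" for A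
    using finite_partition_sets[OF P that] by (intro integrable_mult_right) (simp add: integrable_indicator_iff)
  have "(LINT s|M. cmod (step_fun \<A> (\<lambda>A. of_real (step_weight p M h A)) s) powr ?p)
      = (\<Sum>A\<in>\<A>. LINT s|M. cmod (of_real (step_weight p M h A)) powr ?p * indicator A s)"
    unfolding norm_step_fun_powr[OF P] by (rule Bochner_Integration.integral_sum) (rule i)
  also have "\<dots> = sum h \<A>"
    using d finite_partition_sets[OF P] finite_partition_sets(3)[OF P, THEN less_imp_neq, symmetric]
    by (intro sum.cong) (auto simp del: norm_of_real)
  finally have "(LINT s|M. cmod (step_fun \<A> (\<lambda>A. of_real (step_weight p M h A)) s) powr ?p) \<le> 1"
    using h(2) by simp
  moreover have "integrable M (\<lambda>s. cmod (step_fun \<A> (\<lambda>A. of_real (step_weight p M h A)) s) powr ?p)"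
    unfolding norm_step_fun_powr[OF P] using i by (intro Bochner_Integration.integrable_sum)
  ultimately show ?thesis using False step_fun_measurable[OF P] by (simp add: Lp_bound_def)
qed

lemma sum_indicator_integral_le:
  fixes g :: "'a \<Rightarrow> real"
  assumes P: "finite_partition M \<A>" and g: "integrable M g" "\<And>s. 0 \<le> g s"
  shows "(\<Sum>A\<in>\<A>. LINT s|M. indicator A s * g s) \<le> (LINT s|M. g s)"
proof -
  have i: "integrable M (\<lambda>s. indicator A s * g s)" if "A \<in> \<A>" for A
    using finite_partition_sets(1)[OF P that] g by (intro integrable_indicator_mult) auto
  have "(\<Sum>A\<in>\<A>. LINT s|M. indicator A s * g s) = (LINT s|M. (\<Sum>A\<in>\<A>. indicator A s * g s))"
    by (rule Bochner_Integration.integral_sum[symmetric]) (rule i)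
  also have "\<dots> \<le> (LINT s|M. g s)"
  proof (rule integral_mono)
    show "(\<Sum>A\<in>\<A>. indicator A s * g s) \<le> g s" for s
      using mult_right_mono[OF sum_indicator_le_1[OF P, of s] g(2)[of s]] by (simp add: sum_distrib_right)
  qed (use i g in auto)
  finally show ?thesis .
qed

text \<open>Dividing averages by the weight carries the unit ball of L^p into the weighted ball. For
  finite p and an average m, the weight cancels \<open>h A\<close> and leaves
  \<open>measure M A\<close> times |m|^p, which Jensen bounds by the integral of |f|^p over A; where
  \<open>h A = 0\<close> the term is 0.\<close>

lemma average_in_ball:
  assumes P: "finite_partition M \<A>" and p: "1 \<le> p" and h: "\<And>A. A \<in> \<A> \<Longrightarrow> 0 \<le> h A" and f: "Lp_bound p M f 1"
  shows "weighted_ball p \<A> h (\<lambda>A. (LINT s|M. unit_ind M A s * f s) / of_real (step_weight p M h A))"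
proof (cases "p = \<infinity>")
  case True
  show ?thesis unfolding weighted_ball_def if_P[OF True]
  proof
    fix A assume A: "A \<in> \<A>"
    show "cmod ((LINT s|M. unit_ind M A s * f s) / of_real (step_weight p M h A)) \<le> 1"
      using average_bound[OF p finite_partition_sets[OF P A] f] finite_partition_sets(3)[OF P A] True
      by (simp add: step_weight_def)
  qed
next
  case False
  let ?p = "enn2real p" let ?m = "\<lambda>A. LINT s|M. unit_ind M A s * f s"
  have fp: "f \<in> vecs (Lp p M)" using f vecs_Lp_iff[OF p] by blast
  have i: "integrable M (\<lambda>s. cmod (f s) powr ?p)" "(LINT s|M. cmod (f s) powr ?p) \<le> 1"
    using f False by (auto simp: Lp_bound_def)
  have "(\<Sum>A\<in>\<A>. h A * cmod (?m A / of_real (step_weight p M h A)) powr ?p) \<le> (\<Sum>A\<in>\<A>. LINT s|M. indicator A s * cmod (f s) powr ?p)"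
  proof (rule sum_mono)
    fix A assume A: "A \<in> \<A>"
    note s = finite_partition_sets[OF P A]
    show "h A * cmod (?m A / of_real (step_weight p M h A)) powr ?p \<le> (LINT s|M. indicator A s * cmod (f s) powr ?p)"
    proof (cases "h A = 0")
      case True
      then show ?thesis by (simp add: integral_nonneg_AE)
    next
      case hA: False
      then have h0: "0 < h A" using h[OF A] by simp
      have "step_weight p M h A powr ?p = h A / measure M A" "0 \<le> step_weight p M h A"
        using False p h0 s by (simp_all add: step_weight_def powr_iexp_powr)
      then have "h A * cmod (?m A / of_real (step_weight p M h A)) powr ?p = measure M A * cmod (?m A) powr ?p"
        using h0 s by (simp add: norm_divide powr_divide)
      then show ?thesis using Jensen_average[OF p False s fp] by simp
    qed
  qed
  also have "\<dots> \<le> (LINT s|M. cmod (f s) powr ?p)" by (rule sum_indicator_integral_le[OF P i(1)]) simp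
  finally show ?thesis using i(2) False by (simp add: weighted_ball_def)
qed

text \<open>For finite p, sum and integral are exchanged: the p-th powers of the norms sum to the
  integral of |h|^p times the pointwise sum of |a f A|^p, and the latter is at most W^p on each set
  A.\<close>

lemma step_fun_lnorm:
  assumes P: "finite_partition M \<A>" and p: "1 \<le> p" and W: "0 \<le> W" and h: "Lp_bound p M h 1"
    and a: "\<And>A. A \<in> \<A> \<Longrightarrow> lnorm p (map (\<lambda>f. a f A) fs) \<le> W"
  shows "\<And>f. (\<lambda>s. h s * step_fun \<A> (a f) s) \<in> vecs (Lp p M)"
    and "lnorm p (map (\<lambda>f. of_real (nrm (Lp p M) (\<lambda>s. h s * step_fun \<A> (a f) s))) fs) \<le> W"
proof -
  have hm[measurable]: "h \<in> borel_measurable M" using h by (simp add: Lp_bound_def)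
  note [measurable] = step_fun_measurable[OF P]
  let ?n = "length fs" let ?a = "\<lambda>i. a (fs ! i)"
  let ?N = "\<lambda>f. nrm (Lp p M) (\<lambda>s. h s * step_fun \<A> (a f) s)"
  have bdd: "cmod (step_fun \<A> c s) \<le> (\<Sum>A\<in>\<A>. cmod (c A))" for c s
    unfolding step_fun_def by (rule order_trans[OF norm_sum sum_mono]) (auto simp: norm_mult indicator_def)
  show mem: "(\<lambda>s. h s * step_fun \<A> (a f) s) \<in> vecs (Lp p M)" for f
  proof -
    let ?c = "\<Sum>A\<in>\<A>. cmod (a f A)"
    have c0: "0 \<le> ?c" by (intro sum_nonneg) simp
    have "Lp_bound p M (\<lambda>s. of_real ?c * h s) (cmod (of_real ?c) * 1)" by (rule Lp_bound_scale[OF h])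
    then have "Lp_bound p M (\<lambda>s. h s * step_fun \<A> (a f) s) (cmod (of_real ?c) * 1)"
    proof (rule Lp_bound_dominated)
      show "AE x in M. cmod (h x * step_fun \<A> (a f) x) \<le> cmod (of_real ?c * h x)"
        using bdd[of "a f"] by (intro AE_I2)
          (simp only: norm_mult norm_of_real abs_of_nonneg[OF c0] mult.commute[of ?c] mult_left_mono norm_ge_zero)
    qed measurable
    then show ?thesis using vecs_Lp_iff[OF p] by blast
  qed
  have a': "lnorm p (map (\<lambda>i. ?a i A) [0..<?n]) \<le> W" if "A \<in> \<A>" for A
    using a[OF that] by (simp add: map_conv_nth[of "\<lambda>f. a f A" fs])
  have "lnorm p (map (\<lambda>i. of_real (?N (fs ! i))) [0..<?n]) \<le> W"
  proof (cases "p = \<infinity>")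
    case True
    have "?N (fs ! i) \<le> W" if i: "i < ?n" for i
    proof -
      have "cmod (?a i A) \<le> W" if "A \<in> \<A>" for A
        using a'[OF that] i True W p by (simp add: lnorm_le_iff_sum)
      then have st: "cmod (step_fun \<A> (?a i) s) \<le> W" for s
        using step_fun_in[OF P, of _ s] step_fun_out[OF P, of s] W by (cases "s \<in> \<Union>\<A>") auto
      have "AE s in M. cmod (h s) \<le> 1" using h True by (simp add: Lp_bound_def)
      then have "AE s in M. cmod (h s * step_fun \<A> (?a i) s) \<le> W"
      proof (elim eventually_mono)
        fix s assume "cmod (h s) \<le> 1"
        then have "cmod (h s) * cmod (step_fun \<A> (?a i) s) \<le> 1 * W"
          using st by (intro mult_mono) auto
        then show "cmod (h s * step_fun \<A> (?a i) s) \<le> W" by (simp add: norm_mult)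
      qed
      then have "Lp_bound p M (\<lambda>s. h s * step_fun \<A> (?a i) s) W" using W True by (simp add: Lp_bound_def)
      then show ?thesis using Lp_bound_iff[OF p W] by blast
    qed
    then show ?thesis using True W p by (auto simp: lnorm_le_iff_sum nrm_Lp_nonneg)
  next
    case False
    let ?p = "enn2real p"
    have p1: "1 \<le> ?p" using enn2real_ge_1[OF p False] .
    have ih: "integrable M (\<lambda>s. cmod (h s) powr ?p)" "(LINT s|M. cmod (h s) powr ?p) \<le> 1"
      using h False by (auto simp: Lp_bound_def)
    have ii: "integrable M (\<lambda>s. cmod (h s * step_fun \<A> (?a i) s) powr ?p)" for i
      using mem[of "fs ! i"] False by (simp add: Lp_def)
    have nn: "?N (fs ! i) powr ?p = (LINT s|M. cmod (h s * step_fun \<A> (?a i) s) powr ?p)" for i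
    proof -
      have "0 \<le> (LINT s|M. cmod (h s * step_fun \<A> (?a i) s) powr ?p)" by (intro integral_nonneg_AE) auto
      then show ?thesis using False p1 by (simp add: Lp_def powr_powr)
    qed
    have pt: "(\<Sum>i<?n. cmod (step_fun \<A> (?a i) s) powr ?p) \<le> W powr ?p" for s
    proof (cases "s \<in> \<Union>\<A>")
      case True
      then obtain A where A: "A \<in> \<A>" "s \<in> A" by auto
      then show ?thesis using a'[OF A(1)] step_fun_in[OF P A] False p W by (simp add: lnorm_le_iff_sum)
    next
      case False
      then show ?thesis using step_fun_out[OF P] by simp
    qed
    have "(\<Sum>i<?n. ?N (fs ! i) powr ?p) = (LINT s|M. (\<Sum>i<?n. cmod (h s * step_fun \<A> (?a i) s) powr ?p))"
      unfolding nn by (rule Bochner_Integration.integral_sum[symmetric]) (rule ii)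
    also have "\<dots> \<le> (LINT s|M. W powr ?p * cmod (h s) powr ?p)"
    proof (rule integral_mono)
      show "(\<Sum>i<?n. cmod (h s * step_fun \<A> (?a i) s) powr ?p) \<le> W powr ?p * cmod (h s) powr ?p" for s
        using mult_left_mono[OF pt[of s], of "cmod (h s) powr ?p"]
        by (simp add: norm_mult powr_mult sum_distrib_left mult.commute)
    qed (use ii ih in auto)
    also have "\<dots> \<le> W powr ?p" using ih(2) by (simp add: mult_left_le)
    finally show ?thesis using False p W by (simp add: lnorm_le_iff_sum nrm_Lp_nonneg)
  qed
  then show "lnorm p (map (\<lambda>f. of_real (?N f)) fs) \<le> W"
    by (simp add: map_conv_nth[of "\<lambda>f. of_real (?N f)" fs])
qed

lemma integral_step_fun:
  assumes P: "finite_partition M \<A>" and x: "integrable M x"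
  shows "(LINT s|M. step_fun \<A> c s * x s) = (\<Sum>A\<in>\<A>. c A * mass M A x)"
proof -
  have i: "integrable M (\<lambda>s. c A * (indicator A s * x s))" if "A \<in> \<A>" for A
    using integrable_indicator_mult[OF x finite_partition_sets(1)[OF P that]] by (rule integrable_mult_right)
  have "(LINT s|M. step_fun \<A> c s * x s) = (LINT s|M. (\<Sum>A\<in>\<A>. c A * (indicator A s * x s)))"
    by (simp add: step_fun_def sum_distrib_right mult.assoc)
  also have "\<dots> = (\<Sum>A\<in>\<A>. LINT s|M. c A * (indicator A s * x s))"
    by (rule Bochner_Integration.integral_sum) (rule i)
  finally show ?thesis by (simp add: mass_def)
qed

section \<open>The two bounds as inequalities for a bilinear form\<close>

lemma integral_sum_list:
  fixes f :: "'c \<Rightarrow> 'a \<Rightarrow> complex"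
  assumes "\<And>x. x \<in> set xs \<Longrightarrow> integrable M (f x)"
  shows "integrable M (\<lambda>t. \<Sum>x\<leftarrow>xs. f x t)" "(LINT t|M. (\<Sum>x\<leftarrow>xs. f x t)) = (\<Sum>x\<leftarrow>xs. LINT t|M. f x t)"
proof -
  have "integrable M (\<lambda>t. \<Sum>x\<leftarrow>xs. f x t) \<and> (LINT t|M. (\<Sum>x\<leftarrow>xs. f x t)) = (\<Sum>x\<leftarrow>xs. LINT t|M. f x t)"
    using assms by (induction xs) auto
  then show "integrable M (\<lambda>t. \<Sum>x\<leftarrow>xs. f x t)" "(LINT t|M. (\<Sum>x\<leftarrow>xs. f x t)) = (\<Sum>x\<leftarrow>xs. LINT t|M. f x t)"
    by auto
qed

text \<open>Duality in L^q turns the operator norm into a supremum of B over two unit balls. The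
  crude bound K0 makes the real supremum in \<open>opnorm\<close> meaningful, while K is
  sharp.\<close>

lemma opnorm_dual:
  assumes sf: "semifinite N" and p: "1 \<le> p" and q: "1 \<le> q"
    and T: "\<And>h. h \<in> vecs (Lp p M) \<Longrightarrow> T h \<in> vecs (Lp q N)"
    and pair: "\<And>h k. h \<in> vecs (Lp p M) \<Longrightarrow> k \<in> vecs (Lp (conj_exp q) N) \<Longrightarrow> (LINT t|N. T h t * k t) = B h k"
    and bd: "\<And>h k. Lp_bound p M h 1 \<Longrightarrow> Lp_bound (conj_exp q) N k 1 \<Longrightarrow> cmod (B h k) \<le> K0"
  shows opnorm_dual_nonneg: "0 \<le> opnorm (Lp p M) (Lp q N) T"
    and opnorm_dual_le_iff: "\<And>K. 0 \<le> K \<Longrightarrow> opnorm (Lp p M) (Lp q N) T \<le> K \<longleftrightarrow>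
      (\<forall>h k. Lp_bound p M h 1 \<longrightarrow> Lp_bound (conj_exp q) N k 1 \<longrightarrow> cmod (B h k) \<le> K)"
proof -
  let ?S = "{h \<in> vecs (Lp p M). nrm (Lp p M) h \<le> 1}"
  have S: "h \<in> ?S \<longleftrightarrow> Lp_bound p M h 1" for h using Lp_bound_iff[OF p, of 1 M h] by simp
  have q': "1 \<le> conj_exp q" by (rule conj_exp_ge_1[OF q])
  have single: "nrm (Lp q N) (T h) \<le> K \<longleftrightarrow> (\<forall>k. Lp_bound (conj_exp q) N k 1 \<longrightarrow> cmod (B h k) \<le> K)"
    if h: "h \<in> ?S" and K: "0 \<le> K" for h K
  proof
    assume "nrm (Lp q N) (T h) \<le> K"
    then have Th: "Lp_bound (conj_exp (conj_exp q)) N (T h) K"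
      using T h Lp_bound_iff[OF q K, of N "T h"] by (simp add: conj_exp_conj_exp[OF q])
    show "\<forall>k. Lp_bound (conj_exp q) N k 1 \<longrightarrow> cmod (B h k) \<le> K"
    proof (intro allI impI)
      fix k assume k: "Lp_bound (conj_exp q) N k 1"
      then have "k \<in> vecs (Lp (conj_exp q) N)" using vecs_Lp_iff[OF q'] by blast
      then show "cmod (B h k) \<le> K" using Holder(3)[OF q' Th k] pair h by simp
    qed
  next
    assume k: "\<forall>k. Lp_bound (conj_exp q) N k 1 \<longrightarrow> cmod (B h k) \<le> K"
    have "Lp_bound q N (T h) K"
    proof (rule Lp_bound_dual[OF sf q _ K])
      show "T h \<in> vecs (Lp q N)" using T h by simp
      fix k assume k1: "Lp_bound (conj_exp q) N k 1"
      then have "k \<in> vecs (Lp (conj_exp q) N)" using vecs_Lp_iff[OF q'] by blast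
      then show "cmod (LINT x|N. T h x * k x) \<le> K" using k k1 pair h by simp
    qed
    then show "nrm (Lp q N) (T h) \<le> K" using Lp_bound_iff[OF q K] by blast
  qed
  have bdd: "bdd_above ((\<lambda>h. nrm (Lp q N) (T h)) ` ?S)"
  proof (rule bdd_aboveI2)
    fix h assume h: "h \<in> ?S"
    have "0 \<le> max K0 0" by simp
    from single[OF h this] show "nrm (Lp q N) (T h) \<le> max K0 0"
      using bd S h by (auto simp: le_max_iff_disj)
  qed
  have "Lp_bound p M (\<lambda>_. 0) 1" by (rule Lp_bound_mono[OF Lp_bound_0]) simp
  then have zero: "(\<lambda>_. 0) \<in> ?S" using S by blast
  have "nrm (Lp q N) (T (\<lambda>_. 0)) \<le> opnorm (Lp p M) (Lp q N) T"
    unfolding opnorm_def by (rule cSUP_upper[OF zero bdd])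
  then show "0 \<le> opnorm (Lp p M) (Lp q N) T" using nrm_Lp_nonneg order_trans by blast
  show "opnorm (Lp p M) (Lp q N) T \<le> K \<longleftrightarrow>
      (\<forall>h k. Lp_bound p M h 1 \<longrightarrow> Lp_bound (conj_exp q) N k 1 \<longrightarrow> cmod (B h k) \<le> K)" if K: "0 \<le> K" for K
  proof -
    have "opnorm (Lp p M) (Lp q N) T \<le> K \<longleftrightarrow> (\<forall>h\<in>?S. nrm (Lp q N) (T h) \<le> K)"
      unfolding opnorm_def using zero by (intro cSUP_le_iff bdd) blast
    also have "\<dots> \<longleftrightarrow> (\<forall>h\<in>?S. \<forall>k. Lp_bound (conj_exp q) N k 1 \<longrightarrow> cmod (B h k) \<le> K)"
      using single[OF _ K] by blast
    also have "\<dots> \<longleftrightarrow> (\<forall>h k. Lp_bound p M h 1 \<longrightarrow> Lp_bound (conj_exp q) N k 1 \<longrightarrow> cmod (B h k) \<le> K)"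
      unfolding Ball_def S by blast
    finally show ?thesis .
  qed
qed

context bounded_kernel
begin

lemma \<beta>_diff_left:
  assumes "integrable M x" "integrable M y" "integrable N z"
  shows "\<beta> (\<lambda>s. x s - y s) z = \<beta> x z - \<beta> y z"
proof -
  have "\<beta> (\<lambda>s. x s + (-1) * y s) z = \<beta> x z + (-1) * \<beta> y z"
    using assms by (subst \<beta>_add_left) (auto simp only: \<beta>_scale_left intro!: integrable_mult_right)
  then show ?thesis by simp
qed

lemma \<beta>_diff_right:
  assumes "integrable M x" "integrable N y" "integrable N z"
  shows "\<beta> x (\<lambda>t. y t - z t) = \<beta> x y - \<beta> x z"
proof -
  have "\<beta> x (\<lambda>t. y t + (-1) * z t) = \<beta> x y + (-1) * \<beta> x z"
    using assms by (subst \<beta>_add_right) (auto simp only: \<beta>_scale_right intro!: integrable_mult_right)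
  then show ?thesis by simp
qed

lemma \<beta>_sum_left:
  assumes "finite S" "\<And>i. i \<in> S \<Longrightarrow> integrable M (f i)" "integrable N y"
  shows "\<beta> (\<lambda>s. \<Sum>i\<in>S. c i * f i s) y = (\<Sum>i\<in>S. c i * \<beta> (f i) y)"
  using assms(1,2)
proof (induction S rule: finite_induct)
  case empty
  show ?case using \<beta>_scale_left[of "\<lambda>_. 0" y 0] assms(3) by simp
next
  case (insert a S)
  have "\<beta> (\<lambda>s. c a * f a s + (\<Sum>i\<in>S. c i * f i s)) y = \<beta> (\<lambda>s. c a * f a s) y + \<beta> (\<lambda>s. \<Sum>i\<in>S. c i * f i s) y"
    using insert.prems assms(3) by (intro \<beta>_add_left integrable_mult_right Bochner_Integration.integrable_sum) auto
  then show ?case using insert assms(3) by (simp add: \<beta>_scale_left)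
qed

lemma \<beta>_sum_right:
  assumes "finite S" "\<And>i. i \<in> S \<Longrightarrow> integrable N (f i)" "integrable M x"
  shows "\<beta> x (\<lambda>s. \<Sum>i\<in>S. c i * f i s) = (\<Sum>i\<in>S. c i * \<beta> x (f i))"
  using assms(1,2)
proof (induction S rule: finite_induct)
  case empty
  show ?case by (simp add: \<beta>_eq)
next
  case (insert a S)
  have "\<beta> x (\<lambda>s. c a * f a s + (\<Sum>i\<in>S. c i * f i s)) = \<beta> x (\<lambda>s. c a * f a s) + \<beta> x (\<lambda>s. \<Sum>i\<in>S. c i * f i s)"
    using insert.prems assms(3) by (intro \<beta>_add_right integrable_mult_right Bochner_Integration.integrable_sum) auto
  then show ?case using insert by (simp add: \<beta>_scale_right)
qed

lemma \<beta>_avg_proj: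
  assumes A: "finite_partition M \<A>" and B: "finite_partition N \<B>"
  shows "\<beta> (avg_proj M \<A> x) (avg_proj N \<B> y) =
    (\<Sum>A\<in>\<A>. \<Sum>B\<in>\<B>. mass M A x * mass N B y * \<beta> (unit_ind M A) (unit_ind N B))"
proof -
  have iA: "integrable M (unit_ind M A)" if "A \<in> \<A>" for A
    using finite_partition_sets[OF A that] by (intro integrable_unit_ind)
  have iB: "integrable N (unit_ind N B)" if "B \<in> \<B>" for B
    using finite_partition_sets[OF B that] by (intro integrable_unit_ind)
  have "\<beta> (avg_proj M \<A> x) (avg_proj N \<B> y) = (\<Sum>A\<in>\<A>. mass M A x * \<beta> (unit_ind M A) (avg_proj N \<B> y))"
    unfolding avg_proj_def[of M] using iA finite_partition_finite[OF A] integrable_avg_proj[OF B]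
    by (intro \<beta>_sum_left) auto
  also have "\<dots> = (\<Sum>A\<in>\<A>. mass M A x * (\<Sum>B\<in>\<B>. mass N B y * \<beta> (unit_ind M A) (unit_ind N B)))"
    unfolding avg_proj_def using iA iB finite_partition_finite[OF B]
    by (intro sum.cong refl arg_cong2[where f="(*)"] \<beta>_sum_right) auto
  finally show ?thesis by (simp add: sum_distrib_left mult.assoc)
qed

text \<open>One argument is changed at a time; the second change is weighted by the norm of x',
  which is at most that of x.\<close>

lemma \<beta>_perturb:
  assumes x: "integrable M x" "integrable M x'" "(LINT s|M. cmod (x s - x' s)) \<le> d" "(LINT s|M. cmod (x' s)) \<le> (LINT s|M. cmod (x s))"
    and y: "integrable N y" "integrable N y'" "(LINT t|N. cmod (y t - y' t)) \<le> d"
  shows "cmod (\<beta> x y - \<beta> x' y') \<le> d * (kernel_norm * ((LINT s|M. cmod (x s)) + (LINT t|N. cmod (y t))))"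
proof -
  let ?x = "LINT s|M. cmod (x s)" and ?y = "LINT t|N. cmod (y t)"
  have d: "0 \<le> d" using x(3) by (rule order_trans[rotated]) simp
  have "\<beta> x y - \<beta> x' y' = \<beta> (\<lambda>s. x s - x' s) y + \<beta> x' (\<lambda>t. y t - y' t)"
    using x y by (simp add: \<beta>_diff_left \<beta>_diff_right)
  also have "cmod \<dots> \<le> kernel_norm * (LINT s|M. cmod (x s - x' s)) * ?y + kernel_norm * (LINT s|M. cmod (x' s)) * (LINT t|N. cmod (y t - y' t))"
    using x y by (intro norm_triangle_le add_mono integrable_\<beta>(2)) auto
  also have "\<dots> \<le> kernel_norm * d * ?y + kernel_norm * ?x * d"
    using x y d kernel_norm_nonneg by (intro add_mono mult_mono mult_nonneg_nonneg) auto
  finally show ?thesis by (simp add: algebra_simps)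
qed

text \<open>Continuity of \<beta> on L^1 x L^1. As the list is finite, one partition on each side
  serves all of its entries.\<close>

lemma \<beta>_approx:
  assumes z: "set z \<subseteq> vecs (Lp 1 M) \<times> vecs (Lp 1 N)" and e: "0 < e"
  shows "\<exists>\<A> \<B>. finite_partition M \<A> \<and> finite_partition N \<B> \<and>
    cmod ((\<Sum>(x, y)\<leftarrow>z. \<beta> x y) - (\<Sum>(x, y)\<leftarrow>z. \<beta> (avg_proj M \<A> x) (avg_proj N \<B> y))) \<le> e"
proof -
  let ?D = "\<lambda>(x, y). kernel_norm * ((LINT s|M. cmod (x s)) + (LINT t|N. cmod (y t)))"
  define D where "D = (\<Sum>t\<leftarrow>z. ?D t)"
  have D: "0 \<le> D" unfolding D_def using kernel_norm_nonneg by (intro sum_list_nonneg) auto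
  define d where "d = e / (D + 1)"
  have d: "0 < d" using e D by (simp add: d_def)
  have zi: "integrable M x" "integrable N y" if "(x, y) \<in> set z" for x y
    using that z by (auto simp: Lp_1_iff)
  have "\<exists>\<A>. finite_partition M \<A> \<and> (\<forall>x\<in>fst ` set z. (LINT s|M. cmod (x s - avg_proj M \<A> x s)) \<le> d)"
    by (rule partition_approx) (use zi d in auto)
  then obtain \<A> where A: "finite_partition M \<A>" "\<And>x. x \<in> fst ` set z \<Longrightarrow> (LINT s|M. cmod (x s - avg_proj M \<A> x s)) \<le> d"
    by blast
  have "\<exists>\<B>. finite_partition N \<B> \<and> (\<forall>y\<in>snd ` set z. (LINT t|N. cmod (y t - avg_proj N \<B> y t)) \<le> d)"
    by (rule partition_approx) (use zi d in auto)
  then obtain \<B> where B: "finite_partition N \<B>" "\<And>y. y \<in> snd ` set z \<Longrightarrow> (LINT t|N. cmod (y t - avg_proj N \<B> y t)) \<le> d"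
    by blast
  have one: "cmod (\<beta> x y - \<beta> (avg_proj M \<A> x) (avg_proj N \<B> y)) \<le> d * ?D (x, y)" if xy: "(x, y) \<in> set z" for x y
    unfolding prod.case
    using zi[OF xy] A B xy
    by (intro \<beta>_perturb integrable_avg_proj norm_avg_proj_le) force+
  have "(\<Sum>(x, y)\<leftarrow>z. \<beta> x y) - (\<Sum>(x, y)\<leftarrow>z. \<beta> (avg_proj M \<A> x) (avg_proj N \<B> y))
      = (\<Sum>(x, y)\<leftarrow>z. \<beta> x y - \<beta> (avg_proj M \<A> x) (avg_proj N \<B> y))"
    by (simp add: case_prod_unfold sum_list_subtractf)
  also have "cmod \<dots> \<le> (\<Sum>(x, y)\<leftarrow>z. cmod (\<beta> x y - \<beta> (avg_proj M \<A> x) (avg_proj N \<B> y)))"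
    using norm_sum_list[of "\<lambda>(x, y). \<beta> x y - \<beta> (avg_proj M \<A> x) (avg_proj N \<B> y)" z] by (simp add: case_prod_unfold)
  also have "\<dots> \<le> (\<Sum>t\<leftarrow>z. d * ?D t)"
    using one by (intro sum_list_mono) auto
  also have "\<dots> = d * D" by (simp add: D_def sum_list_const_mult case_prod_unfold)
  also have "\<dots> \<le> e" using D e by (simp add: d_def field_simps)
  finally show ?thesis using A B by blast
qed

text \<open>Hence the sum of \<beta> over a list depends only on the tensor, and representatives in
  finite-dimensional subspaces may be substituted.\<close>

lemma bilinear_form_\<beta>: "bilinear_form (Lp 1 M) (Lp 1 N) \<beta>"
  unfolding bilinear_form_def linear_functional_def
proof (intro conjI ballI allI impI)
  fix x y assume x: "x \<in> vecs (Lp 1 M)" and y: "y \<in> vecs (Lp 1 N)" and "nrm (Lp 1 M) x = 0 \<or> nrm (Lp 1 N) y = 0"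
  then show "\<beta> x y = 0" using integrable_\<beta>(2)[of x y] by (auto simp: Lp_1_iff nrm_Lp_1)
qed (auto simp: Lp_1_iff plus_fun_def cscale_def \<beta>_add_left \<beta>_add_right \<beta>_scale_left \<beta>_scale_right)

lemma sum_\<beta>_tensor_eq:
  "tensor_eq (Lp 1 M) (Lp 1 N) z w \<Longrightarrow> (\<Sum>(x, y)\<leftarrow>z. \<beta> x y) = (\<Sum>(x, y)\<leftarrow>w. \<beta> x y)"
  using bilinear_form_\<beta> by (auto simp: tensor_eq_def)

lemma \<beta>_in_dual:
  assumes "integrable M x" shows "\<beta> x \<in> vecs (dual (Lp 1 N))"
  by (rule in_dualI[where C="kernel_norm * (LINT s|M. cmod (x s))"])
    (use assms integrable_\<beta>(2)[OF assms] in \<open>auto simp: Lp_1_iff nrm_Lp_1 plus_fun_def cscale_def \<beta>_add_right \<beta>_scale_right\<close>)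

text \<open>The first condition of \<open>Lab\<close> holds for every bounded kernel, so membership
  is a matter of the bound alone.\<close>

lemma bounded_op_\<beta>: "bounded_op (Lp 1 M) (dual (Lp 1 N)) \<beta>"
  unfolding bounded_op_def
proof (intro conjI ballI allI)
  show "\<beta> x \<in> vecs (dual (Lp 1 N))" if "x \<in> vecs (Lp 1 M)" for x
    using \<beta>_in_dual that by (simp add: Lp_1_iff)
  show "nrm (dual (Lp 1 N)) (\<beta> (x + y) - (\<beta> x + \<beta> y)) = 0" if "x \<in> vecs (Lp 1 M)" "y \<in> vecs (Lp 1 M)" for x y
    using that by (intro dual_nrm_eq_0 homogeneous_Lp_1) (simp add: Lp_1_iff plus_fun_def \<beta>_add_left)
  show "nrm (dual (Lp 1 N)) (\<beta> (cscale c x) - cscale c (\<beta> x)) = 0" if "x \<in> vecs (Lp 1 M)" for c x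
    using that by (intro dual_nrm_eq_0 homogeneous_Lp_1) (simp add: Lp_1_iff cscale_def \<beta>_scale_left)
  show "\<exists>C. \<forall>x\<in>vecs (Lp 1 M). nrm (dual (Lp 1 N)) (\<beta> x) \<le> C * nrm (Lp 1 M) x"
  proof (intro exI ballI dual_nrm_le homogeneous_Lp_1)
    fix x y assume x: "x \<in> vecs (Lp 1 M)" and y: "y \<in> vecs (Lp 1 N)" "nrm (Lp 1 N) y \<le> 1"
    have "cmod (\<beta> x y) \<le> kernel_norm * nrm (Lp 1 M) x * nrm (Lp 1 N) y"
      using integrable_\<beta>(2)[of x y] x y by (simp add: Lp_1_iff nrm_Lp_1)
    also have "\<dots> \<le> kernel_norm * nrm (Lp 1 M) x"
      using y kernel_norm_nonneg by (intro mult_left_le mult_nonneg_nonneg) (auto simp: nrm_Lp_nonneg)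
    finally show "cmod (\<beta> x y) \<le> kernel_norm * nrm (Lp 1 M) x" .
  qed
qed

end

section \<open>Scalar forms of the multiplier norm and of the injective norm\<close>

locale schur_setting = bounded_kernel M N \<phi> + exponents p q
  for M :: "'a measure" and N :: "'b measure" and \<phi> and p q
begin

text \<open>The Schur map tested with h in L^p and k in L^q'. The test functions are absorbed into
  the factors of u, which puts the tensor into the tensor product of the L^1 spaces, where
  \<open>Lab_bound\<close> speaks.\<close>

definition schur_form :: "('a, 'b) tensor \<Rightarrow> ('a \<Rightarrow> complex) \<Rightarrow> ('b \<Rightarrow> complex) \<Rightarrow> complex" where
  "schur_form u h k = (\<Sum>(f, g)\<leftarrow>u. \<beta> (\<lambda>s. f s * h s) (\<lambda>t. g t * k t))"

text \<open>The counterpart of \<open>schur_form\<close> for the operator of u itself, that is, for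
  the kernel 1.\<close>

definition tensor_form :: "('a, 'b) tensor \<Rightarrow> ('a \<Rightarrow> complex) \<Rightarrow> ('b \<Rightarrow> complex) \<Rightarrow> complex" where
  "tensor_form u h k = (\<Sum>(f, g)\<leftarrow>u. (LINT s|M. f s * h s) * (LINT t|N. g t * k t))"

definition tensors :: "('a, 'b) tensor set" where
  "tensors = {u. set u \<subseteq> vecs (Lp (conj_exp p) M) \<times> vecs (Lp q N)}"

lemma tensorsD: "u \<in> tensors \<Longrightarrow> (f, g) \<in> set u \<Longrightarrow> f \<in> vecs (Lp (conj_exp p) M) \<and> g \<in> vecs (Lp q N)"
  by (auto simp: tensors_def)

lemma left_product:
  assumes "f \<in> vecs (Lp (conj_exp p) M)" "Lp_bound p M h c"
  shows "integrable M (\<lambda>s. f s * h s)" "(LINT s|M. cmod (f s * h s)) \<le> nrm (Lp (conj_exp p) M) f * c"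
  using Holder[OF p1 Lp_bound_nrm[OF conj_exp_ge_1[OF p1] assms(1)] assms(2)] by auto

lemma right_product:
  assumes "g \<in> vecs (Lp q N)" "Lp_bound (conj_exp q) N k c"
  shows "integrable N (\<lambda>t. g t * k t)" "(LINT t|N. cmod (g t * k t)) \<le> nrm (Lp q N) g * c"
proof -
  have "Lp_bound (conj_exp (conj_exp q)) N g (nrm (Lp q N) g)"
    using Lp_bound_nrm[OF q1 assms(1)] by (simp add: conj_exp_conj_exp[OF q1])
  from Holder[OF q'1 this assms(2)]
  show "integrable N (\<lambda>t. g t * k t)" "(LINT t|N. cmod (g t * k t)) \<le> nrm (Lp q N) g * c" by auto
qed

lemma kernel_times_Lp:
  assumes w: "integrable M w" and g: "g \<in> vecs (Lp q N)"
  shows "(\<lambda>t. kernel_int M N \<phi> w t * g t) \<in> vecs (Lp q N)"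
proof -
  let ?K = "kernel_norm * (LINT s|M. cmod (w s))"
  have K: "0 \<le> ?K" using kernel_norm_nonneg by (intro mult_nonneg_nonneg) auto
  have g': "Lp_bound q N g (nrm (Lp q N) g)" using Lp_bound_nrm[OF q1 g] .
  from Lp_bound_scale[OF this, of "of_real ?K"]
  have "Lp_bound q N (\<lambda>t. kernel_int M N \<phi> w t * g t) (cmod (of_real ?K) * nrm (Lp q N) g)"
  proof (rule Lp_bound_dominated)
    show "(\<lambda>t. kernel_int M N \<phi> w t * g t) \<in> borel_measurable N"
      using kernel_int_measurable[OF w] Lp_bound_measurable[OF g'] by simp
    have "AE t in N. cmod (kernel_int M N \<phi> w t) \<le> ?K"
      using kernel_int_bound[OF w] by (simp add: Lp_bound_def)
    then show "AE t in N. cmod (kernel_int M N \<phi> w t * g t) \<le> cmod (of_real ?K * g t)"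
    proof eventually_elim
      case (elim t)
      then show ?case using K mult_right_mono[OF elim, of "cmod (g t)"] by (simp only: norm_mult norm_of_real abs_of_nonneg norm_ge_zero)
    qed
  qed
  then show ?thesis using vecs_Lp_iff[OF q1] by blast
qed

lemma schur_map_Lp:
  assumes u: "u \<in> tensors" and h: "h \<in> vecs (Lp p M)"
  shows "schur_map M N \<phi> u h \<in> vecs (Lp q N)"
proof -
  obtain c where c: "Lp_bound p M h c" using h vecs_Lp_iff[OF p1] by blast
  have "(\<lambda>t. \<Sum>x\<leftarrow>u. (\<lambda>(f, g) t. kernel_int M N \<phi> (\<lambda>s. f s * h s) t * g t) x t) \<in> vecs (Lp q N)"
    by (rule Lp_sum_list[OF q1]) (use tensorsD[OF u] left_product(1)[OF _ c] kernel_times_Lp in auto)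
  then show ?thesis by (simp add: schur_map_def case_prod_unfold)
qed

lemma schur_map_pair:
  assumes u: "u \<in> tensors" and h: "h \<in> vecs (Lp p M)" and k: "k \<in> vecs (Lp (conj_exp q) N)"
  shows "(LINT t|N. schur_map M N \<phi> u h t * k t) = schur_form u h k"
proof -
  obtain c where c: "Lp_bound p M h c" using h vecs_Lp_iff[OF p1] by blast
  obtain d where d: "Lp_bound (conj_exp q) N k d" using k vecs_Lp_iff[OF q'1] by blast
  let ?F = "\<lambda>x t. kernel_int M N \<phi> (\<lambda>s. fst x s * h s) t * (snd x t * k t)"
  have i: "integrable N (?F x)" if "x \<in> set u" for x
    using tensorsD[OF u, of "fst x" "snd x"] that left_product(1)[OF _ c] right_product(1)[OF _ d]
    by (intro integrable_\<beta>(1)) auto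
  have "(LINT t|N. schur_map M N \<phi> u h t * k t) = (LINT t|N. (\<Sum>x\<leftarrow>u. ?F x t))"
    by (simp add: schur_map_def case_prod_unfold mult.assoc flip: sum_list_mult_const)
  also have "\<dots> = (\<Sum>x\<leftarrow>u. LINT t|N. ?F x t)" by (rule integral_sum_list(2)) (rule i)
  finally show ?thesis by (simp add: schur_form_def case_prod_unfold \<beta>_eq)
qed

lemma tensor_op_Lp:
  assumes u: "u \<in> tensors" shows "tensor_op M u h \<in> vecs (Lp q N)"
proof -
  have "(\<lambda>t. \<Sum>x\<leftarrow>u. (\<lambda>(f, g) t. (LINT s|M. f s * h s) * g t) x t) \<in> vecs (Lp q N)"
    by (rule Lp_sum_list[OF q1]) (use tensorsD[OF u] Lp_scale[OF q1, of _ N] in auto)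
  then show ?thesis by (simp add: tensor_op_def case_prod_unfold)
qed

lemma tensor_op_pair:
  assumes u: "u \<in> tensors" and k: "k \<in> vecs (Lp (conj_exp q) N)"
  shows "(LINT t|N. tensor_op M u h t * k t) = tensor_form u h k"
proof -
  obtain d where d: "Lp_bound (conj_exp q) N k d" using k vecs_Lp_iff[OF q'1] by blast
  let ?F = "\<lambda>x t. (LINT s|M. fst x s * h s) * (snd x t * k t)"
  have i: "integrable N (?F x)" if "x \<in> set u" for x
    using tensorsD[OF u, of "fst x" "snd x"] that right_product(1)[OF _ d]
    by (intro integrable_mult_right) auto
  have "(LINT t|N. tensor_op M u h t * k t) = (LINT t|N. (\<Sum>x\<leftarrow>u. ?F x t))"
    by (simp add: tensor_op_def case_prod_unfold mult.assoc flip: sum_list_mult_const)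
  also have "\<dots> = (\<Sum>x\<leftarrow>u. LINT t|N. ?F x t)" by (rule integral_sum_list(2)) (rule i)
  finally show ?thesis by (simp add: tensor_form_def case_prod_unfold)
qed

text \<open>Depends on the representation of u; it serves as the bound K0 of
  \<open>opnorm_dual\<close>.\<close>

lemma schur_form_bound:
  assumes u: "u \<in> tensors" and h: "Lp_bound p M h 1" and k: "Lp_bound (conj_exp q) N k 1"
  shows "cmod (schur_form u h k) \<le> (\<Sum>(f, g)\<leftarrow>u. kernel_norm * nrm (Lp (conj_exp p) M) f * nrm (Lp q N) g)"
proof -
  have "cmod (schur_form u h k) \<le> (\<Sum>(f, g)\<leftarrow>u. cmod (\<beta> (\<lambda>s. f s * h s) (\<lambda>t. g t * k t)))"
    using norm_sum_list[of "\<lambda>(f, g). \<beta> (\<lambda>s. f s * h s) (\<lambda>t. g t * k t)" u] by (simp add: schur_form_def case_prod_unfold)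
  also have "\<dots> \<le> (\<Sum>(f, g)\<leftarrow>u. kernel_norm * nrm (Lp (conj_exp p) M) f * nrm (Lp q N) g)"
  proof (rule sum_list_mono, clarify)
    fix f g assume fg: "(f, g) \<in> set u"
    have f: "f \<in> vecs (Lp (conj_exp p) M)" and g: "g \<in> vecs (Lp q N)" using tensorsD[OF u fg] by auto
    have "cmod (\<beta> (\<lambda>s. f s * h s) (\<lambda>t. g t * k t)) \<le> kernel_norm * (LINT s|M. cmod (f s * h s)) * (LINT t|N. cmod (g t * k t))"
      by (intro integrable_\<beta>(2) left_product[OF f h] right_product[OF g k])
    also have "\<dots> \<le> kernel_norm * (nrm (Lp (conj_exp p) M) f * 1) * (nrm (Lp q N) g * 1)"
      using kernel_norm_nonneg
      by (intro mult_mono mult_nonneg_nonneg left_product[OF f h] right_product[OF g k]) (auto simp: nrm_Lp_nonneg)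
    finally show "cmod (\<beta> (\<lambda>s. f s * h s) (\<lambda>t. g t * k t)) \<le> kernel_norm * nrm (Lp (conj_exp p) M) f * nrm (Lp q N) g"
      by simp
  qed
  finally show ?thesis .
qed

lemma tensor_form_bound:
  assumes u: "u \<in> tensors" and h: "Lp_bound p M h 1" and k: "Lp_bound (conj_exp q) N k 1"
  shows "cmod (tensor_form u h k) \<le> (\<Sum>(f, g)\<leftarrow>u. nrm (Lp (conj_exp p) M) f * nrm (Lp q N) g)"
proof -
  have "cmod (tensor_form u h k) \<le> (\<Sum>(f, g)\<leftarrow>u. cmod ((LINT s|M. f s * h s) * (LINT t|N. g t * k t)))"
    using norm_sum_list[of "\<lambda>(f, g). (LINT s|M. f s * h s) * (LINT t|N. g t * k t)" u] by (simp add: tensor_form_def case_prod_unfold)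
  also have "\<dots> \<le> (\<Sum>(f, g)\<leftarrow>u. nrm (Lp (conj_exp p) M) f * nrm (Lp q N) g)"
  proof (rule sum_list_mono, clarify)
    fix f g assume fg: "(f, g) \<in> set u"
    have f: "f \<in> vecs (Lp (conj_exp p) M)" and g: "g \<in> vecs (Lp q N)" using tensorsD[OF u fg] by auto
    have "cmod ((LINT s|M. f s * h s) * (LINT t|N. g t * k t)) \<le> (LINT s|M. cmod (f s * h s)) * (LINT t|N. cmod (g t * k t))"
      unfolding norm_mult[of "LINT s|M. f s * h s"] by (intro mult_mono integral_norm_bound) auto
    also have "\<dots> \<le> (nrm (Lp (conj_exp p) M) f * 1) * (nrm (Lp q N) g * 1)"
      by (intro mult_mono mult_nonneg_nonneg left_product[OF f h] right_product[OF g k]) (auto simp: nrm_Lp_nonneg)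
    finally show "cmod ((LINT s|M. f s * h s) * (LINT t|N. g t * k t)) \<le> nrm (Lp (conj_exp p) M) f * nrm (Lp q N) g"
      by simp
  qed
  finally show ?thesis .
qed

lemma inj_norm_le_iff:
  assumes u: "u \<in> tensors"
  shows "0 \<le> inj_norm p q M N u"
    and "0 \<le> K \<Longrightarrow> inj_norm p q M N u \<le> K \<longleftrightarrow>
      (\<forall>h k. Lp_bound p M h 1 \<longrightarrow> Lp_bound (conj_exp q) N k 1 \<longrightarrow> cmod (tensor_form u h k) \<le> K)"
  unfolding inj_norm_def
  by (rule opnorm_dual[where B="tensor_form u" and M=M,
      OF localizable_semifinite[OF loc] p1 q1 tensor_op_Lp[OF u] tensor_op_pair[OF u] tensor_form_bound[OF u]]; assumption)+

text \<open>From here on a Schur bound is an inequality for scalar forms, without operators or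
  kernel representatives.\<close>

lemma schur_bound_iff:
  "schur_bound p q M N \<phi> C \<longleftrightarrow> 0 \<le> C \<and> (\<forall>u\<in>tensors. \<forall>h k. Lp_bound p M h 1 \<longrightarrow> Lp_bound (conj_exp q) N k 1 \<longrightarrow>
      cmod (schur_form u h k) \<le> C * inj_norm p q M N u)"
proof -
  have "opnorm (Lp p M) (Lp q N) (schur_map M N \<phi> u) \<le> C * inj_norm p q M N u \<longleftrightarrow>
    (\<forall>h k. Lp_bound p M h 1 \<longrightarrow> Lp_bound (conj_exp q) N k 1 \<longrightarrow> cmod (schur_form u h k) \<le> C * inj_norm p q M N u)"
    if u: "u \<in> tensors" and C: "0 \<le> C" for u
    by (rule opnorm_dual(2)[where B="schur_form u" and M=M,
        OF localizable_semifinite[OF loc] p1 q1 schur_map_Lp[OF u] schur_map_pair[OF u] schur_form_bound[OF u]])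
      (use inj_norm_le_iff(1)[OF u] C in auto)
  then show ?thesis unfolding schur_bound_def tensors_def by auto
qed

lemma tensor_form_scale: "tensor_form u (\<lambda>s. a * h s) (\<lambda>t. b * k t) = a * b * tensor_form u h k"
proof -
  have "(LINT s|M. f s * (a * h s)) = a * (LINT s|M. f s * h s)" for f
    by (simp add: mult.left_commute flip: integral_mult_right_zero)
  moreover have "(LINT t|N. g t * (b * k t)) = b * (LINT t|N. g t * k t)" for g
    by (simp add: mult.left_commute flip: integral_mult_right_zero)
  ultimately show ?thesis
    unfolding tensor_form_def by (induction u) (auto simp: algebra_simps)
qed

text \<open>By homogeneity. A function of norm 0 cannot be normalized, but it vanishes almost
  everywhere and so does the form.\<close>

lemma tensor_form_le:
  assumes u: "u \<in> tensors" and h: "h \<in> vecs (Lp p M)" and k: "k \<in> vecs (Lp (conj_exp q) N)"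
  shows "cmod (tensor_form u h k) \<le> inj_norm p q M N u * nrm (Lp p M) h * nrm (Lp (conj_exp q) N) k"
proof -
  let ?h = "nrm (Lp p M) h" and ?k = "nrm (Lp (conj_exp q) N) k"
  have bh: "Lp_bound p M h ?h" using Lp_bound_nrm[OF p1 h] .
  have bk: "Lp_bound (conj_exp q) N k ?k" using Lp_bound_nrm[OF q'1 k] .
  show ?thesis
  proof (cases "?h = 0 \<or> ?k = 0")
    case True
    then have "(AE s in M. h s = 0) \<or> (AE t in N. k t = 0)"
      using Lp_bound_0_AE[of p M h] Lp_bound_0_AE[of "conj_exp q" N k] bh bk p1 q'1 by auto
    then have "(LINT s|M. f s * h s) = 0 \<or> (LINT t|N. g t * k t) = 0" for f g
    proof
      assume "AE s in M. h s = 0"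
      then show ?thesis by (intro disjI1 integral_eq_zero_AE) (auto elim!: eventually_mono)
    next
      assume "AE t in N. k t = 0"
      then show ?thesis by (intro disjI2 integral_eq_zero_AE) (auto elim!: eventually_mono)
    qed
    then have "(LINT s|M. f s * h s) * (LINT t|N. g t * k t) = 0" for f g by auto
    then have "tensor_form u h k = (\<Sum>x\<leftarrow>u. 0)" unfolding tensor_form_def case_prod_unfold by (simp only:)
    then show ?thesis using True by auto
  next
    case False
    then have pos: "0 < ?h" "0 < ?k" using nrm_Lp_nonneg[of p M h] nrm_Lp_nonneg[of "conj_exp q" N k] by auto
    have "Lp_bound p M (\<lambda>s. of_real (1 / ?h) * h s) 1" "Lp_bound (conj_exp q) N (\<lambda>t. of_real (1 / ?k) * k t) 1"
      using Lp_bound_scale[OF bh, of "of_real (1 / ?h)"] Lp_bound_scale[OF bk, of "of_real (1 / ?k)"] pos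
      by (simp_all add: norm_divide)
    then have "cmod (tensor_form u (\<lambda>s. of_real (1 / ?h) * h s) (\<lambda>t. of_real (1 / ?k) * k t)) \<le> inj_norm p q M N u"
      using inj_norm_le_iff[OF u] by blast
    also have "tensor_form u (\<lambda>s. of_real (1 / ?h) * h s) (\<lambda>t. of_real (1 / ?k) * k t)
        = of_real (1 / ?h) * of_real (1 / ?k) * tensor_form u h k"
      by (rule tensor_form_scale)
    finally show ?thesis using pos by (simp add: norm_mult norm_divide field_simps)
  qed
qed

end

section \<open>Equality of the two norms\<close>

definition span_space :: "'c measure \<Rightarrow> 'c set set \<Rightarrow> 'c nspace" where
  "span_space L \<A> = (Lp 1 L)\<lparr>vecs := cfun.span (unit_ind L ` \<A>)\<rparr>"

lemma span_space:
  assumes "finite_partition L \<A>"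
  shows "fd_subspace (Lp 1 L) (span_space L \<A>)" "homogeneous (span_space L \<A>)"
    "A \<in> \<A> \<Longrightarrow> unit_ind L A \<in> vecs (span_space L \<A>)"
    "A \<in> \<A> \<Longrightarrow> nrm (span_space L \<A>) (unit_ind L A) = 1"
proof -
  show fd: "fd_subspace (Lp 1 L) (span_space L \<A>)" unfolding span_space_def
    using finite_partition_finite[OF assms] finite_partition_sets[OF assms]
    by (intro fd_subspace_span homogeneous_Lp_1) (auto simp: Lp_1_iff intro!: integrable_unit_ind)
  show "homogeneous (span_space L \<A>)" using fd_subspaceD(1)[OF fd homogeneous_Lp_1] .
  show "A \<in> \<A> \<Longrightarrow> unit_ind L A \<in> vecs (span_space L \<A>)"
    by (simp add: span_space_def cfun.span_base)
  show "A \<in> \<A> \<Longrightarrow> nrm (span_space L \<A>) (unit_ind L A) = 1"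
    using finite_partition_sets[OF assms, of A] by (simp add: span_space_def nrm_Lp_1 norm_unit_ind)
qed

text \<open>The adjoint of averaging: a functional on the span is determined by its values on the
  normalized indicators, and these become the values of a step function integrated against
  x.\<close>

lemma functional_avg_proj:
  assumes P: "finite_partition L \<A>" and x: "integrable L x" and f: "f \<in> vecs (dual (span_space L \<A>))"
  shows "avg_proj L \<A> x \<in> vecs (span_space L \<A>)"
    and "f (avg_proj L \<A> x) = (LINT s|L. step_fun \<A> (\<lambda>A. f (unit_ind L A)) s * x s)"
  using functional_sum[OF span_space(2)[OF P] f finite_partition_finite[OF P] span_space(3)[OF P], where k="\<lambda>A. mass L A x"]
  by (simp_all add: avg_proj_def integral_step_fun[OF P x] mult.commute[of "mass _ _ _"])

text \<open>Coefficients on a partition act through the masses on every subspace of L^1. X is one of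
  the arbitrary subspaces in the definition of \<alpha>', unrelated to the partition.\<close>

lemma mass_functional:
  assumes A: "finite_partition L \<A>" and X: "homogeneous X" "vecs X \<subseteq> vecs (Lp 1 L)" "nrm X = nrm (Lp 1 L)"
  shows "(\<lambda>x. \<Sum>A\<in>\<A>. a A * mass L A x) \<in> vecs (dual X)"
proof (rule in_dualI[where C="\<Sum>A\<in>\<A>. cmod (a A)"])
  have i: "integrable L x" if "x \<in> vecs X" for x using that X(2) by (auto simp: Lp_1_iff)
  show "(\<Sum>A\<in>\<A>. a A * mass L A (x + y)) = (\<Sum>A\<in>\<A>. a A * mass L A x) + (\<Sum>A\<in>\<A>. a A * mass L A y)"
    if "x \<in> vecs X" "y \<in> vecs X" for x y
    unfolding sum.distrib[symmetric] plus_fun_def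
    using i[OF that(1)] i[OF that(2)] finite_partition_sets(1)[OF A]
    by (intro sum.cong) (auto simp: mass_add distrib_left)
  show "(\<Sum>A\<in>\<A>. a A * mass L A (cscale c x)) = c * (\<Sum>A\<in>\<A>. a A * mass L A x)" for c x
    by (simp add: cscale_def mass_scale sum_distrib_left mult.left_commute)
  fix x assume x: "x \<in> vecs X"
  have m: "cmod (mass L A x) \<le> nrm X x" if "A \<in> \<A>" for A
  proof -
    have "cmod (mass L A x) \<le> (\<Sum>A\<in>\<A>. cmod (mass L A x))"
      using that finite_partition_finite[OF A] by (intro member_le_sum) auto
    also have "\<dots> \<le> nrm X x" using sum_mass_le[OF A i[OF x]] by (simp add: X(3) nrm_Lp_1)
    finally show ?thesis .
  qed
  have "cmod (\<Sum>A\<in>\<A>. a A * mass L A x) \<le> (\<Sum>A\<in>\<A>. cmod (a A * mass L A x))" by (rule norm_sum)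
  also have "\<dots> \<le> (\<Sum>A\<in>\<A>. cmod (a A) * nrm X x)"
    unfolding norm_mult by (intro sum_mono mult_left_mono m) auto
  finally show "cmod (\<Sum>A\<in>\<A>. a A * mass L A x) \<le> (\<Sum>A\<in>\<A>. cmod (a A)) * nrm X x"
    by (simp add: sum_distrib_right)
qed

text \<open>The masses of a vector in the unit ball lie in the unit ball of ell^1, so it is enough
  to control each coordinate A separately, where Hoelder's inequality in k applies.\<close>

lemma weak_norm_mass_functionals:
  assumes A: "finite_partition L \<A>" and X: "homogeneous X" "vecs X \<subseteq> vecs (Lp 1 L)" "nrm X = nrm (Lp 1 L)"
    and s: "1 \<le> s" and a: "\<And>A. A \<in> \<A> \<Longrightarrow> lnorm s (map (\<lambda>k. a k A) [0..<n]) \<le> 1"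
  shows "weak_norm s (dual X) (map (\<lambda>k x. \<Sum>A\<in>\<A>. a k A * mass L A x) [0..<n]) \<le> 1"
proof (rule weak_norm_dual_le[OF X(1) _ s])
  show "set (map (\<lambda>k x. \<Sum>A\<in>\<A>. a k A * mass L A x) [0..<n]) \<subseteq> vecs (dual X)"
    using mass_functional[OF A X] by auto
  fix c x assume c: "lnorm (conj_exp s) (map c [0..<length (map (\<lambda>k x. \<Sum>A\<in>\<A>. a k A * mass L A x) [0..<n])]) \<le> 1"
    and x: "x \<in> vecs X" "nrm X x \<le> 1"
  have c': "Lp_bound (conj_exp s) (count_space {..<n}) c 1"
    using c conj_exp_ge_1[OF s] by (simp add: lnorm_le_iff)
  have one: "cmod (\<Sum>k<n. c k * a k A) \<le> 1" if "A \<in> \<A>" for A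
  proof -
    have "Lp_bound s (count_space {..<n}) (\<lambda>k. a k A) 1" using a[OF that] s by (simp add: lnorm_le_iff)
    from Holder(3)[OF s c' this] show ?thesis by (simp add: lebesgue_integral_count_space_finite)
  qed
  have "(\<Sum>k<n. c k * (\<Sum>A\<in>\<A>. a k A * mass L A x)) = (\<Sum>A\<in>\<A>. (\<Sum>k<n. c k * a k A) * mass L A x)"
    unfolding sum_distrib_left sum_distrib_right by (subst sum.swap) (simp add: mult.assoc)
  also have "cmod \<dots> \<le> (\<Sum>A\<in>\<A>. cmod ((\<Sum>k<n. c k * a k A) * mass L A x))" by (rule norm_sum)
  also have "\<dots> \<le> (\<Sum>A\<in>\<A>. 1 * cmod (mass L A x))"
    unfolding norm_mult using one by (intro sum_mono mult_right_mono) auto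
  also have "\<dots> \<le> 1" using sum_mass_le[OF A, of x] x X by (auto simp: Lp_1_iff nrm_Lp_1)
  finally show "cmod (\<Sum>i<length (map (\<lambda>k x. \<Sum>A\<in>\<A>. a k A * mass L A x) [0..<n]). c i * (map (\<lambda>k x. \<Sum>A\<in>\<A>. a k A * mass L A x) [0..<n] ! i) x) \<le> 1"
    by simp
qed simp

lemma unit_ind_times_step_fun:
  assumes "finite_partition L \<A>" "A \<in> \<A>"
  shows "(\<lambda>s. c * unit_ind L A s * step_fun \<A> H s) = (\<lambda>s. c * H A * unit_ind L A s)"
proof
  fix s
  show "c * unit_ind L A s * step_fun \<A> H s = c * H A * unit_ind L A s"
    using step_fun_in[OF assms, of s H] by (cases "s \<in> A") (auto simp: unit_ind_def)
qed

context schur_setting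
begin

text \<open>Functionals on the spans are step functions, and averaging moves from z onto them. For a
  representation of v, the pairing becomes a sum over t of coefficients times
  \<open>tensor_form u\<close>, at h and k multiplied by step functions. The injective norm bounds
  each term, and Hoelder's inequality with r, p, q' sums them up to the cost of the
  representation.\<close>

lemma alpha_dual_fd_le_inj_norm:
  assumes A: "finite_partition M \<A>" and B: "finite_partition N \<B>"
    and u: "u \<in> tensors" and h: "Lp_bound p M h 1" and k: "Lp_bound (conj_exp q) N k 1"
  defines "z \<equiv> map (\<lambda>(f, g). (avg_proj M \<A> (\<lambda>s. f s * h s), avg_proj N \<B> (\<lambda>t. g t * k t))) u"
  shows "set z \<subseteq> vecs (span_space M \<A>) \<times> vecs (span_space N \<B>)"
    and "alpha_dual_fd q (conj_exp p) (span_space M \<A>) (span_space N \<B>) z \<le> inj_norm p q M N u"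
proof -
  let ?X = "span_space M \<A>" and ?Y = "span_space N \<B>"
  note hX = span_space(2)[OF A] and hY = span_space(2)[OF B]
  have fh: "integrable M (\<lambda>s. f s * h s)" and gk: "integrable N (\<lambda>t. g t * k t)" if "(f, g) \<in> set u" for f g
    using tensorsD[OF u that] left_product(1)[OF _ h] right_product(1)[OF _ k] by auto
  show z: "set z \<subseteq> vecs ?X \<times> vecs ?Y"
    using functional_avg_proj(1)[OF A fh zero_functional(1)[OF hX]] functional_avg_proj(1)[OF B gk zero_functional(1)[OF hY]]
    by (auto simp: z_def)
  let ?i = "inj_norm p q M N u"
  have i0: "0 \<le> ?i" using inj_norm_le_iff(1)[OF u] .
  show "alpha_dual_fd q (conj_exp p) ?X ?Y z \<le> ?i"
  proof (rule alpha_dual_fd_le[OF hX hY])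
    fix v assume v: "set v \<subseteq> vecs (dual ?X) \<times> vecs (dual ?Y)" "alpha q (conj_exp p) (dual ?X) (dual ?Y) v \<le> 1"
    have "cmod (pairing v z) \<le> ?i * alpha q (conj_exp p) (dual ?X) (dual ?Y) v"
    proof (rule le_alpha[OF v(1) i0])
      fix ts assume ts: "set ts \<subseteq> UNIV \<times> vecs (dual ?X) \<times> vecs (dual ?Y)"
        and eq: "tensor_eq (dual ?X) (dual ?Y) v (map (\<lambda>(c, x, y). (cscale c x, y)) ts)"
      let ?c = "\<lambda>(c :: complex, f :: ('a \<Rightarrow> complex) \<Rightarrow> complex, g :: ('b \<Rightarrow> complex) \<Rightarrow> complex). c"
        and ?f = "\<lambda>(c :: complex, f :: ('a \<Rightarrow> complex) \<Rightarrow> complex, g :: ('b \<Rightarrow> complex) \<Rightarrow> complex). f"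
        and ?g = "\<lambda>(c :: complex, f :: ('a \<Rightarrow> complex) \<Rightarrow> complex, g :: ('b \<Rightarrow> complex) \<Rightarrow> complex). g"
      define a where "a t A = ?f t (unit_ind M A)" for t A
      define b where "b t B = ?g t (unit_ind N B)" for t B
      let ?h = "\<lambda>t s. h s * step_fun \<A> (a t) s" and ?k = "\<lambda>t s. k s * step_fun \<B> (b t) s"
      let ?H = "\<lambda>t. nrm (Lp p M) (?h t)" and ?K = "\<lambda>t. nrm (Lp (conj_exp q) N) (?k t)"
      let ?Wa = "weak_norm p (dual ?X) (map ?f ts)" and ?Wb = "weak_norm (conj_exp q) (dual ?Y) (map ?g ts)"
      have fs: "set (map ?f ts) \<subseteq> vecs (dual ?X)" "set (map ?g ts) \<subseteq> vecs (dual ?Y)" using ts by auto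
      have Wa: "0 \<le> ?Wa" and Wb: "0 \<le> ?Wb"
        by (intro weak_norm_nonneg homogeneous_dual hX hY p1 q'1 fs)+
      \<comment> \<open>The coordinates are evaluations at unit vectors of the span, hence
        controlled by the weak norm.\<close>
      have la: "lnorm p (map (\<lambda>t. a t A) ts) \<le> ?Wa" if "A \<in> \<A>" for A
        using lnorm_eval_le[OF hX p1 span_space(3)[OF A that] fs(1)] span_space(4)[OF A that]
        by (simp add: comp_def a_def)
      have lb: "lnorm (conj_exp q) (map (\<lambda>t. b t B) ts) \<le> ?Wb" if "B \<in> \<B>" for B
        using lnorm_eval_le[OF hY q'1 span_space(3)[OF B that] fs(2)] span_space(4)[OF B that]
        by (simp add: comp_def b_def)
      note sa = step_fun_lnorm[where a=a and fs=ts, OF A p1 Wa h la]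
      note sb = step_fun_lnorm[where a=b and fs=ts, OF B q'1 Wb k lb]
      have one: "(\<Sum>(x, y)\<leftarrow>z. ?c t * ?f t x * ?g t y) = ?c t * tensor_form u (?h t) (?k t)"
        if t: "t \<in> set ts" for t
      proof -
        have f: "?f t \<in> vecs (dual ?X)" "?g t \<in> vecs (dual ?Y)" using t ts by auto
        have "?f t (avg_proj M \<A> (\<lambda>s. f s * h s)) * ?g t (avg_proj N \<B> (\<lambda>t. g t * k t))
            = (LINT s|M. f s * ?h t s) * (LINT s|N. g s * ?k t s)" if "(f, g) \<in> set u" for f g
          unfolding functional_avg_proj(2)[OF A fh[OF that] f(1)] functional_avg_proj(2)[OF B gk[OF that] f(2)]
          unfolding a_def[symmetric] b_def[symmetric] by (simp add: mult.commute mult.left_commute mult.assoc)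
        then have "(\<Sum>(f, g)\<leftarrow>u. ?f t (avg_proj M \<A> (\<lambda>s. f s * h s)) * ?g t (avg_proj N \<B> (\<lambda>t. g t * k t)))
            = tensor_form u (?h t) (?k t)"
          unfolding tensor_form_def by (intro arg_cong[where f=sum_list] map_cong) auto
        then show ?thesis
          by (simp add: z_def case_prod_unfold comp_def mult.assoc sum_list_const_mult)
      qed
      have "pairing v z = (\<Sum>(c, f, g)\<leftarrow>ts. \<Sum>(x, y)\<leftarrow>z. c * f x * g y)"
        using pairing_tensor_eq[OF hX hY z eq] pairing_map by simp
      also have "\<dots> = (\<Sum>t\<leftarrow>ts. ?c t * tensor_form u (?h t) (?k t))"
        using one by (intro arg_cong[where f=sum_list] map_cong) auto
      finally have "cmod (pairing v z) \<le> (\<Sum>t\<leftarrow>ts. cmod (?c t * tensor_form u (?h t) (?k t)))"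
        using norm_sum_list by simp
      also have "\<dots> \<le> (\<Sum>t\<leftarrow>ts. ?i * cmod (?c t * of_real (?H t) * of_real (?K t)))"
      proof (rule sum_list_mono)
        fix t assume "t \<in> set ts"
        have "cmod (tensor_form u (?h t) (?k t)) \<le> ?i * ?H t * ?K t"
          by (rule tensor_form_le[OF u sa(1) sb(1)])
        then have "cmod (?c t) * cmod (tensor_form u (?h t) (?k t)) \<le> cmod (?c t) * (?i * ?H t * ?K t)"
          by (rule mult_left_mono) simp
        then show "cmod (?c t * tensor_form u (?h t) (?k t)) \<le> ?i * cmod (?c t * of_real (?H t) * of_real (?K t))"
          by (simp add: norm_mult nrm_Lp_nonneg mult_ac)
      qed
      also have "\<dots> = ?i * (\<Sum>t\<leftarrow>ts. cmod (?c t * of_real (?H t) * of_real (?K t)))"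
        by (rule sum_list_const_mult)
      also have "\<dots> \<le> ?i * (lnorm r (map ?c ts) * lnorm p (map (\<lambda>t. of_real (?H t)) ts) * lnorm (conj_exp q) (map (\<lambda>t. of_real (?K t)) ts))"
        by (intro mult_left_mono[OF _ i0] Holder3_list[OF r1 p1 q'1 exponent_sum])
      also have "\<dots> \<le> ?i * (lnorm r (map ?c ts) * ?Wa * ?Wb)"
        using sa(2) sb(2) Wa by (intro mult_left_mono[OF _ i0] mult_mono mult_nonneg_nonneg lnorm_nonneg) auto
      finally show "cmod (pairing v z) \<le> ?i * val (dual ?X) (dual ?Y) ts" by (simp add: val_def)
    qed
    also have "\<dots> \<le> ?i" using v(2) i0 by (simp add: mult_left_le)
    finally show "cmod (pairing v z) \<le> ?i" .
  qed
qed

text \<open>The products f h and g k are averaged. The averaged tensor lies in the spans, where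
  \<alpha>' is at most the injective norm of u, and \<beta> changes by at most e.\<close>

lemma schur_bound_if_Lab_bound:
  assumes lab: "Lab_bound q (conj_exp p) (Lp 1 M) (Lp 1 N) \<beta> C"
  shows "schur_bound p q M N \<phi> C"
  unfolding schur_bound_iff
proof (intro conjI ballI allI impI)
  have C: "0 \<le> C" and L: "\<And>z. set z \<subseteq> vecs (Lp 1 M) \<times> vecs (Lp 1 N) \<Longrightarrow>
      cmod (\<Sum>(x, y)\<leftarrow>z. \<beta> x y) \<le> C * alpha_dual q (conj_exp p) (Lp 1 M) (Lp 1 N) z"
    using lab by (auto simp: Lab_bound_def)
  show "0 \<le> C" by (rule C)
  fix u h k assume u: "u \<in> tensors" and h: "Lp_bound p M h 1" and k: "Lp_bound (conj_exp q) N k 1"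
  define z where "z = map (\<lambda>(f, g). (\<lambda>s. f s * h s, \<lambda>t. g t * k t)) u"
  have z: "set z \<subseteq> vecs (Lp 1 M) \<times> vecs (Lp 1 N)"
    using tensorsD[OF u] left_product(1)[OF _ h] right_product(1)[OF _ k] by (auto simp: z_def Lp_1_iff)
  have sz: "schur_form u h k = (\<Sum>(x, y)\<leftarrow>z. \<beta> x y)"
    by (simp add: schur_form_def z_def case_prod_unfold comp_def)
  show "cmod (schur_form u h k) \<le> C * inj_norm p q M N u"
  proof (rule field_le_epsilon)
    fix e :: real assume e: "0 < e"
    obtain \<A> \<B> where A: "finite_partition M \<A>" and B: "finite_partition N \<B>"
      and err: "cmod ((\<Sum>(x, y)\<leftarrow>z. \<beta> x y) - (\<Sum>(x, y)\<leftarrow>z. \<beta> (avg_proj M \<A> x) (avg_proj N \<B> y))) \<le> e"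
      using \<beta>_approx[OF z e] by blast
    define w where "w = map (\<lambda>(f, g). (avg_proj M \<A> (\<lambda>s. f s * h s), avg_proj N \<B> (\<lambda>t. g t * k t))) u"
    note fd = alpha_dual_fd_le_inj_norm[OF A B u h k, folded w_def]
    have wL: "set w \<subseteq> vecs (Lp 1 M) \<times> vecs (Lp 1 N)"
      using integrable_avg_proj[OF A] integrable_avg_proj[OF B] by (auto simp: w_def Lp_1_iff)
    have "(\<Sum>(x, y)\<leftarrow>z. \<beta> (avg_proj M \<A> x) (avg_proj N \<B> y)) = (\<Sum>(x, y)\<leftarrow>w. \<beta> x y)"
      by (simp add: z_def w_def case_prod_unfold comp_def)
    also have "cmod \<dots> \<le> C * alpha_dual q (conj_exp p) (Lp 1 M) (Lp 1 N) w" by (rule L[OF wL])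
    also have "\<dots> \<le> C * inj_norm p q M N u"
      using alpha_dual_le[OF homogeneous_Lp_1 homogeneous_Lp_1 span_space(1)[OF A] span_space(1)[OF B] fd(1) tensor_eq_refl] fd(2)
      by (intro mult_left_mono C) linarith
    finally show "cmod (schur_form u h k) \<le> C * inj_norm p q M N u + e"
      using err norm_triangle_sub[of "\<Sum>(x, y)\<leftarrow>z. \<beta> x y" "\<Sum>(x, y)\<leftarrow>z. \<beta> (avg_proj M \<A> x) (avg_proj N \<B> y)"]
      unfolding sz by linarith
  qed
qed

text \<open>The averaged form sees only the matrix of masses of w, and the bound D on \<alpha>' says
  that this matrix is dominated. Divided by the roots of the Pietsch weights it becomes a tensor u
  of injective norm at most D; the roots, as test functions in the unit balls, restore the matrix in
  \<open>schur_form\<close>.\<close>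

lemma schur_bound_avg_proj:
  assumes sb: "schur_bound p q M N \<phi> C"
    and A: "finite_partition M \<A>" and B: "finite_partition N \<B>"
    and X: "homogeneous X" "vecs X \<subseteq> vecs (Lp 1 M)" "nrm X = nrm (Lp 1 M)"
    and Y: "homogeneous Y" "vecs Y \<subseteq> vecs (Lp 1 N)" "nrm Y = nrm (Lp 1 N)"
    and w: "set w \<subseteq> vecs X \<times> vecs Y" and D: "alpha_dual_fd q (conj_exp p) X Y w \<le> D" "0 < D"
  shows "cmod (\<Sum>(x, y)\<leftarrow>w. \<beta> (avg_proj M \<A> x) (avg_proj N \<B> y)) \<le> C * D"
proof -
  define z where "z A B = (\<Sum>(x, y)\<leftarrow>w. mass M A x * mass N B y)" for A B
  define Z where "Z = (\<lambda>a b. \<Sum>A\<in>\<A>. \<Sum>B\<in>\<B>. z A B * a A * b B)"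
  have Zw: "Z a b = (\<Sum>(x, y)\<leftarrow>w. (\<Sum>A\<in>\<A>. a A * mass M A x) * (\<Sum>B\<in>\<B>. b B * mass N B y))" for a b
    unfolding Z_def z_def
    by (induction w) (auto simp: sum_product sum.distrib algebra_simps)
  note finA = finite_partition_finite[OF A] and finB = finite_partition_finite[OF B]
  have "\<exists>h k. (\<forall>A\<in>\<A>. 0 \<le> h A) \<and> (\<Sum>A\<in>\<A>. h A) \<le> (1::real) \<and> (\<forall>B\<in>\<B>. 0 \<le> k B) \<and> (\<Sum>B\<in>\<B>. k B) \<le> (1::real) \<and>
    (\<forall>a b. weighted_ball p \<A> h a \<longrightarrow> weighted_ball (conj_exp q) \<B> k b \<longrightarrow>
      cmod (\<Sum>A\<in>\<A>. \<Sum>B\<in>\<B>. z A B * a A * b B) \<le> D)"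
  \<comment> \<open>Test families become a tensor of functionals, since their coefficients act on X
    and Y through the masses. Its cost is at most 1, so the dual norm bounds its pairing with w by
    D.\<close>
  proof (rule Pietsch_domination[OF finA finB p1 q'1 r1 exponent_sum D(2)])
    fix n l a b
    assume l: "lnorm r (map l [0..<n]) \<le> 1"
      and a: "\<And>A. A \<in> \<A> \<Longrightarrow> lnorm p (map (\<lambda>k. a k A) [0..<n]) \<le> 1"
      and b: "\<And>B. B \<in> \<B> \<Longrightarrow> lnorm (conj_exp q) (map (\<lambda>k. b k B) [0..<n]) \<le> 1"
    let ?F = "\<lambda>k x. \<Sum>A\<in>\<A>. a k A * mass M A x" and ?G = "\<lambda>k y. \<Sum>B\<in>\<B>. b k B * mass N B y"
    let ?ts = "map (\<lambda>k. (l k, ?F k, ?G k)) [0..<n]"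
    let ?v = "map (\<lambda>(c, x, y). (cscale c x, y)) ?ts"
    have F: "?F k \<in> vecs (dual X)" and G: "?G k \<in> vecs (dual Y)" for k
      using mass_functional[OF A X] mass_functional[OF B Y] by auto
    then have ts: "set ?ts \<subseteq> UNIV \<times> vecs (dual X) \<times> vecs (dual Y)" by auto
    have v: "set ?v \<subseteq> vecs (dual X) \<times> vecs (dual Y)"
      using F G homogeneousD(3)[OF homogeneous_dual[OF X(1)]] by auto
    have "alpha q (conj_exp p) (dual X) (dual Y) ?v \<le> val (dual X) (dual Y) ?ts"
      by (rule alpha_le[OF homogeneous_dual[OF X(1)] homogeneous_dual[OF Y(1)] ts])
    also have "\<dots> = lnorm r (map l [0..<n]) * weak_norm p (dual X) (map ?F [0..<n]) * weak_norm (conj_exp q) (dual Y) (map ?G [0..<n])"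
      by (simp add: val_def comp_def)
    also have "\<dots> \<le> 1 * 1 * 1"
    proof (intro mult_mono mult_nonneg_nonneg)
      show "weak_norm p (dual X) (map ?F [0..<n]) \<le> 1" by (rule weak_norm_mass_functionals[OF A X p1 a])
      show "weak_norm (conj_exp q) (dual Y) (map ?G [0..<n]) \<le> 1" by (rule weak_norm_mass_functionals[OF B Y q'1 b])
      show "0 \<le> weak_norm p (dual X) (map ?F [0..<n])"
        using F by (intro weak_norm_nonneg homogeneous_dual X p1) auto
      show "0 \<le> weak_norm (conj_exp q) (dual Y) (map ?G [0..<n])"
        using G by (intro weak_norm_nonneg homogeneous_dual Y q'1) auto
    qed (use l lnorm_nonneg in auto)
    finally have "cmod (pairing ?v w) \<le> D"
      using alpha_dual_fd_ge[OF X(1) Y(1) w v] D(1) by simp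
    moreover have "pairing ?v w = (\<Sum>k<n. Z (a k) (b k) * l k)"
    proof -
      have "pairing ?v w = (\<Sum>k\<leftarrow>[0..<n]. \<Sum>(x, y)\<leftarrow>w. l k * ?F k x * ?G k y)"
        by (simp add: pairing_def comp_def cscale_def)
      also have "\<dots> = (\<Sum>k\<leftarrow>[0..<n]. Z (a k) (b k) * l k)"
        unfolding Zw by (simp add: case_prod_unfold mult.assoc sum_list_const_mult mult.commute[of _ "l _"])
      finally show ?thesis by (simp add: interv_sum_list_conv_sum_set_nat atLeast0LessThan)
    qed
    ultimately show "cmod (\<Sum>k<n. (\<Sum>A\<in>\<A>. \<Sum>B\<in>\<B>. z A B * a k A * b k B) * l k) \<le> D"
      by (simp add: Z_def)
  qed
  then obtain h k where h: "\<And>A. A \<in> \<A> \<Longrightarrow> 0 \<le> h A" "sum h \<A> \<le> (1::real)"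
    and k: "\<And>B. B \<in> \<B> \<Longrightarrow> 0 \<le> k B" "sum k \<B> \<le> (1::real)"
    and dom: "\<And>a b. weighted_ball p \<A> h a \<Longrightarrow> weighted_ball (conj_exp q) \<B> k b \<Longrightarrow>
      cmod (\<Sum>A\<in>\<A>. \<Sum>B\<in>\<B>. z A B * a A * b B) \<le> D" by blast
  define H where "H A = complex_of_real (step_weight p M h A)" for A
  define K where "K B = complex_of_real (step_weight (conj_exp q) N k B)" for B
  \<comment> \<open>Where a weight vanishes, so does the row of the matrix; hence the division in
    \<open>co\<close> loses nothing, although x / 0 is 0.\<close>
  have zA: "z A B = 0" if AB: "A \<in> \<A>" "B \<in> \<B>" and "H A = 0" for A B
  proof -
    have "p \<noteq> \<infinity>" "h A = 0"
      using that finite_partition_sets(3)[OF A AB(1)] by (auto simp: H_def step_weight_def split: if_splits)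
    then show ?thesis using weighted_ball_0[OF dom finA finB p1 q'1 _ _ AB k] by simp
  qed
  have zB: "z A B = 0" if AB: "A \<in> \<A>" "B \<in> \<B>" and "K B = 0" for A B
  proof -
    have pk: "conj_exp q \<noteq> \<infinity>" "k B = 0"
      using that finite_partition_sets(3)[OF B AB(2)] by (auto simp: K_def step_weight_def split: if_splits)
    \<comment> \<open>The matrix is transposed, so that \<open>weighted_ball_0\<close> applies to
      columns.\<close>
    have "cmod (\<Sum>B\<in>\<B>. \<Sum>A\<in>\<A>. z A B * b B * a A) \<le> D"
      if "weighted_ball (conj_exp q) \<B> k b" "weighted_ball p \<A> h a" for b a
      using dom[OF that(2,1)] by (subst sum.swap) (simp add: mult.assoc mult.commute[of "b _"])
    from weighted_ball_0[where z="\<lambda>B A. z A B" and I=\<B> and J=\<A> and h=k and k=h and p="conj_exp q" and q=p and A=D, OF this finB finA q'1 p1 pk AB(2,1) h] show ?thesis .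
  qed
  define co where "co A B = z A B / (H A * K B)" for A B
  have co: "co A B * H A * K B = z A B" if "A \<in> \<A>" "B \<in> \<B>" for A B
    using zA[OF that] zB[OF that] by (auto simp: co_def)
  obtain L where L: "set L = \<A> \<times> \<B>" "distinct L"
    using finite_distinct_list[of "\<A> \<times> \<B>"] finA finB by auto
  have sumL: "(\<Sum>(A, B)\<leftarrow>L. F A B) = (\<Sum>A\<in>\<A>. \<Sum>B\<in>\<B>. F A B)" for F :: "'a set \<Rightarrow> 'b set \<Rightarrow> complex"
    using L by (simp add: sum_list_distinct_conv_sum_set sum.cartesian_product)
  define u where "u = map (\<lambda>(A, B). (\<lambda>s. co A B * unit_ind M A s, unit_ind N B)) L"
  have u: "u \<in> tensors"
    unfolding tensors_def u_def using L(1) finite_partition_sets[OF A] finite_partition_sets[OF B]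
    by (auto intro!: Lp_scale unit_ind_in_Lp conj_exp_ge_1 p1 q1)
  \<comment> \<open>The division by the weights is shifted to the averages of the test functions,
    which \<open>average_in_ball\<close> places in the weighted balls where the matrix is bounded by
    D.\<close>
  have iu: "inj_norm p q M N u \<le> D"
    unfolding inj_norm_le_iff(2)[OF u less_imp_le[OF D(2)]]
  proof (intro allI impI)
    fix f g assume f: "Lp_bound p M f 1" and g: "Lp_bound (conj_exp q) N g 1"
    let ?a = "\<lambda>A. (LINT s|M. unit_ind M A s * f s) / H A" and ?b = "\<lambda>B. (LINT t|N. unit_ind N B t * g t) / K B"
    have "tensor_form u f g = (\<Sum>(A, B)\<leftarrow>L. z A B * ?a A * ?b B)"
      by (simp add: tensor_form_def u_def case_prod_unfold comp_def co_def mult.assoc)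
    also have "\<dots> = (\<Sum>A\<in>\<A>. \<Sum>B\<in>\<B>. z A B * ?a A * ?b B)" by (rule sumL)
    also have "cmod \<dots> \<le> D"
      unfolding H_def K_def
      by (intro dom average_in_ball[OF A p1 h(1) f] average_in_ball[OF B q'1 k(1) g])
    finally show "cmod (tensor_form u f g) \<le> D" .
  qed
  have "(\<Sum>(x, y)\<leftarrow>w. \<beta> (avg_proj M \<A> x) (avg_proj N \<B> y))
      = (\<Sum>A\<in>\<A>. \<Sum>B\<in>\<B>. z A B * \<beta> (unit_ind M A) (unit_ind N B))"
    unfolding \<beta>_avg_proj[OF A B] z_def
    by (induction w) (auto simp: sum.distrib algebra_simps)
  also have "\<dots> = (\<Sum>(A, B)\<leftarrow>L. z A B * \<beta> (unit_ind M A) (unit_ind N B))" by (rule sumL[symmetric])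
  \<comment> \<open>Each indicator meets a single value of the step functions, so multiplying by
    them turns \<open>co A B\<close> back into \<open>z A B\<close>.\<close>
  also have "\<dots> = schur_form u (step_fun \<A> H) (step_fun \<B> K)"
  proof -
    have "z A B * \<beta> (unit_ind M A) (unit_ind N B)
        = \<beta> (\<lambda>s. co A B * unit_ind M A s * step_fun \<A> H s) (\<lambda>t. unit_ind N B t * step_fun \<B> K t)"
      if AB: "(A, B) \<in> set L" for A B
    proof -
      have AB': "A \<in> \<A>" "B \<in> \<B>" using AB L by auto
      have i: "integrable M (unit_ind M A)" "integrable N (unit_ind N B)"
        using finite_partition_sets[OF A AB'(1)] finite_partition_sets[OF B AB'(2)] by (auto intro: integrable_unit_ind)
      show ?thesis
        unfolding unit_ind_times_step_fun[OF A AB'(1)] unit_ind_times_step_fun[OF B AB'(2), of 1, simplified]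
        using i co[OF AB'] by (simp add: \<beta>_scale_left \<beta>_scale_right) (simp add: mult_ac)
    qed
    then show ?thesis unfolding schur_form_def u_def
      by (auto simp: comp_def case_prod_unfold intro!: arg_cong[where f=sum_list] map_cong)
  qed
  finally have "cmod (\<Sum>(x, y)\<leftarrow>w. \<beta> (avg_proj M \<A> x) (avg_proj N \<B> y)) = cmod (schur_form u (step_fun \<A> H) (step_fun \<B> K))"
    by simp
  also have "\<dots> \<le> C * inj_norm p q M N u"
    using sb u step_weight_bound[OF A p1 h] step_weight_bound[OF B q'1 k]
    unfolding schur_bound_iff H_def K_def by blast
  also have "\<dots> \<le> C * D" using iu sb by (intro mult_left_mono) (auto simp: schur_bound_def)
  finally show ?thesis .
qed

text \<open>Each pair of subspaces and each representative w in the infimum is treated separately,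
  with partitions adapted to w; \<beta> takes the same value on z and w.\<close>

lemma Lab_bound_if_schur_bound:
  assumes sb: "schur_bound p q M N \<phi> C"
  shows "Lab_bound q (conj_exp p) (Lp 1 M) (Lp 1 N) \<beta> C"
  unfolding Lab_bound_def
proof (intro conjI allI impI)
  show C: "0 \<le> C" using sb by (simp add: schur_bound_def)
  fix z assume z: "set z \<subseteq> vecs (Lp 1 M) \<times> vecs (Lp 1 N)"
  show "cmod (\<Sum>(x, y)\<leftarrow>z. \<beta> x y) \<le> C * alpha_dual q (conj_exp p) (Lp 1 M) (Lp 1 N) z"
  proof (rule le_alpha_dual[OF homogeneous_Lp_1 homogeneous_Lp_1 z C])
    fix X Y w assume fd: "fd_subspace (Lp 1 M) X" "fd_subspace (Lp 1 N) Y"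
      and w: "set w \<subseteq> vecs X \<times> vecs Y" and eq: "tensor_eq (Lp 1 M) (Lp 1 N) z w"
    note X = fd_subspaceD[OF fd(1) homogeneous_Lp_1] and Y = fd_subspaceD[OF fd(2) homogeneous_Lp_1]
    let ?a = "alpha_dual_fd q (conj_exp p) X Y w"
    have a: "0 \<le> ?a" by (rule alpha_dual_fd_nonneg[OF X(1) Y(1) w])
    have wL: "set w \<subseteq> vecs (Lp 1 M) \<times> vecs (Lp 1 N)" using w X(2) Y(2) by auto
    show "cmod (\<Sum>(x, y)\<leftarrow>z. \<beta> x y) \<le> C * ?a"
    proof (rule field_le_epsilon)
      fix e :: real assume e: "0 < e"
      \<comment> \<open>Pietsch domination asks for a positive bound, so \<open>?a\<close> is raised
        by d. This costs C d and the approximation costs d, which together make e.\<close>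
      define d where "d = e / (C + 1)"
      have d: "0 < d" using e C by (simp add: d_def)
      obtain \<A> \<B> where A: "finite_partition M \<A>" and B: "finite_partition N \<B>"
        and err: "cmod ((\<Sum>(x, y)\<leftarrow>w. \<beta> x y) - (\<Sum>(x, y)\<leftarrow>w. \<beta> (avg_proj M \<A> x) (avg_proj N \<B> y))) \<le> d"
        using \<beta>_approx[OF wL d] by blast
      have "cmod (\<Sum>(x, y)\<leftarrow>w. \<beta> (avg_proj M \<A> x) (avg_proj N \<B> y)) \<le> C * (?a + d)"
        using a d by (intro schur_bound_avg_proj[OF sb A B X Y w]) auto
      moreover have "C * (?a + d) + d = C * ?a + (C + 1) * d" by (simp add: algebra_simps)
      moreover have "(C + 1) * d = e" using C by (simp add: d_def)
      ultimately show "cmod (\<Sum>(x, y)\<leftarrow>z. \<beta> x y) \<le> C * ?a + e"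
        using err norm_triangle_sub[of "\<Sum>(x, y)\<leftarrow>w. \<beta> x y" "\<Sum>(x, y)\<leftarrow>w. \<beta> (avg_proj M \<A> x) (avg_proj N \<B> y)"]
        unfolding sum_\<beta>_tensor_eq[OF eq] by linarith
    qed
  qed
qed

text \<open>Stated for every single constant, so that existence of a bound and the infimum of all
  bounds are both carried over.\<close>

lemma schur_bound_eq_Lab_bound:
  "schur_bound p q M N \<phi> C \<longleftrightarrow> Lab_bound q (conj_exp p) (Lp 1 M) (Lp 1 N) \<beta> C"
  using schur_bound_if_Lab_bound Lab_bound_if_schur_bound by blast

end

theorem theorem4p2:
  fixes M1 :: "'a measure" and M2 :: "'b measure"
    and \<phi> :: "'a \<times> 'b \<Rightarrow> complex" and p q :: ennreal
  assumes "localizable M1" and "localizable M2"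
    and "\<phi> \<in> Linf_prod M1 M2"
    and "1 \<le> q" and "q \<le> p"
  shows "(schur_multiplier p q M1 M2 \<phi> \<longleftrightarrow>
            u_op M1 M2 \<phi> \<in> Lab q (conj_exp p) (Lp 1 M1) (Lp 1 M2)) \<and>
         (schur_multiplier p q M1 M2 \<phi> \<longrightarrow>
            schur_norm p q M1 M2 \<phi> = Lab_norm q (conj_exp p) (Lp 1 M1) (Lp 1 M2) (u_op M1 M2 \<phi>))"
proof -
  interpret schur_setting M1 M2 \<phi> p q
    using assms by unfold_locales
  show ?thesis
    using bounded_op_\<beta>
    by (simp add: schur_multiplier_def Lab_def schur_norm_def Lab_norm_def schur_bound_eq_Lab_bound)
qed

end
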